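(* Let $J\ge 2$, $\rho>0$. For $j=1,\dots,J$ let $D_j^x\subseteq\mathbb{R}^n$ and $D_j^y\subseteq\mathbb{R}^{m_j}$ be nonempty open convex sets and let $f_j,h_j:D_j^x\times D_j^y\to\mathbb{R}$ be twice continuously differentiable, with $h_j$ strongly bi-convex and $f_j$ being $(L_j^x,L_j^y)$-relatively bi-smooth with respect to $h_j$ for some $L_j^x,L_j^y>0$. Let $0<\eta<\min_{1\le j\le J}\min(1/L_j^x,1/L_j^y)$. Assume that there is an open set $\Omega\subseteq\prod_{j=1}^J(D_j^x\times D_j^y)\times(\mathbb{R}^n)^{J-1}$ such that the one-iteration map $g$ of Consensus Bregman ADMM (defined in the context) is well defined on $\Omega$ and $g(\Omega)\subseteq\Omega$. Let the initial state $\mathbf{z}^0=(\mathbf{x}_1^0,\mathbf{y}_1^0,\dots,\mathbf{x}_J^0,\mathbf{y}_J^0,\boldsymbol{\lambda}_2^0,\dots,\boldsymbol{\lambda}_J^0)$ be drawn from a probability distribution on $\Omega$ that is absolutely continuous with respect to Lebesgue measure, and let $\mathbf{z}^k=g(\mathbf{z}^{k-1})$ for $k\ge1$. Then the probability that $\mathbf{z}^k$ converges to a strict-saddle KKT point $\mathbf{z}^\star\in\Omega$ of the consensus problem of minimizing $\sum_{j=1}^J f_j(\mathbf{x}_j,\mathbf{y}_j)$ subject to $\mathbf{x}_j=\mathbf{x}_1$ for all $j\ge2$ is zero.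
   Context: Strongly bi-convex: a $\mathcal{C}^2$ function $h(\mathbf{x},\mathbf{y})$ is strongly bi-convex on its domain if there is $m_h>0$ with $\nabla^2_{\mathbf{x}\mathbf{x}}h(\mathbf{x},\mathbf{y})\succeq m_h\mathbf{I}$ and $\nabla^2_{\mathbf{y}\mathbf{y}}h(\mathbf{x},\mathbf{y})\succeq m_h\mathbf{I}$ for all $(\mathbf{x},\mathbf{y})$ in the domain. Relatively bi-smooth: a $\mathcal{C}^2$ function $f(\mathbf{x},\mathbf{y})$ is $(L^x,L^y)$-relatively bi-smooth with respect to $h$ if $L^x\nabla^2_{\mathbf{x}\mathbf{x}}h\pm\nabla^2_{\mathbf{x}\mathbf{x}}f\succeq0$ and $L^y\nabla^2_{\mathbf{y}\mathbf{y}}h\pm\nabla^2_{\mathbf{y}\mathbf{y}}f\succeq0$ (both signs) at every $(\mathbf{x},\mathbf{y})$ in the domain. Bi-Bregman divergences: $D_h^x(\mathbf{x}_1,\mathbf{x}_2;\mathbf{y})=h(\mathbf{x}_1,\mathbf{y})-h(\mathbf{x}_2,\mathbf{y})-\langle\nabla_{\mathbf{x}}h(\mathbf{x}_2,\mathbf{y}),\mathbf{x}_1-\mathbf{x}_2\rangle$ and $D_h^y(\mathbf{y}_1,\mathbf{y}_2;\mathbf{x})=h(\mathbf{x},\mathbf{y}_1)-h(\mathbf{x},\mathbf{y}_2)-\langle\nabla_{\mathbf{y}}h(\mathbf{x},\mathbf{y}_2),\mathbf{y}_1-\mathbf{y}_2\rangle$. Augmented Lagrangian: $\mathcal{L}(\mathbf{x}_1,\mathbf{y}_1,\dots,\mathbf{x}_J,\mathbf{y}_J,\boldsymbol{\lambda}_2,\dots,\boldsymbol{\lambda}_J)=\sum_{j=1}^J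 f_j(\mathbf{x}_j,\mathbf{y}_j)+\sum_{j=2}^J\langle\boldsymbol{\lambda}_j,\mathbf{x}_j-\mathbf{x}_1\rangle+\frac{\rho}{2}\sum_{j=2}^J\|\mathbf{x}_j-\mathbf{x}_1\|_2^2$. Consensus Bregman ADMM one-iteration map $g$: given the state $(\mathbf{x}_1,\mathbf{y}_1,\dots,\mathbf{x}_J,\mathbf{y}_J,\boldsymbol{\lambda}_2,\dots,\boldsymbol{\lambda}_J)$, for $j=1,2,\dots,J$ successively (Gauss–Seidel order) set $\mathbf{x}_j^+=\operatorname{argmin}_{\mathbf{u}\in D_j^x}\ \frac1\eta D^x_{h_j}(\mathbf{u},\mathbf{x}_j;\mathbf{y}_j)+\mathcal{L}(\mathbf{x}_1^+,\mathbf{y}_1^+,\dots,\mathbf{x}_{j-1}^+,\mathbf{y}_{j-1}^+,\mathbf{u},\mathbf{y}_j,\mathbf{x}_{j+1},\mathbf{y}_{j+1},\dots,\mathbf{x}_J,\mathbf{y}_J,\boldsymbol{\lambda}_2,\dots,\boldsymbol{\lambda}_J)$, $\mathbf{y}_j^+=\operatorname{argmin}_{\mathbf{v}\in D_j^y}\ \frac1\eta D^y_{h_j}(\mathbf{v},\mathbf{y}_j;\mathbf{x}_j^+)+\mathcal{L}(\mathbf{x}_1^+,\mathbf{y}_1^+,\dots,\mathbf{x}_{j-1}^+,\mathbf{y}_{j-1}^+,\mathbf{x}_j^+,\mathbf{v},\mathbf{x}_{j+1},\mathbf{y}_{j+1},\dots,\mathbf{x}_J,\mathbf{y}_J,\boldsymbol{\lambda}_2,\dots,\boldsymbol{\lambda}_J)$,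 and then $\boldsymbol{\lambda}_j^+=\boldsymbol{\lambda}_j+\rho(\mathbf{x}_j^+-\mathbf{x}_1^+)$ for $j=2,\dots,J$. The value of $g$ is $(\mathbf{x}_1^+,\mathbf{y}_1^+,\dots,\mathbf{x}_J^+,\mathbf{y}_J^+,\boldsymbol{\lambda}_2^+,\dots,\boldsymbol{\lambda}_J^+)$. "Well defined on $\Omega$" means that all these minimizers exist for every state in $\Omega$; they are unique since the subproblems are strongly convex under the stated conditions. KKT point of the consensus problem: $(\mathbf{x}_1^\star,\mathbf{y}_1^\star,\dots,\mathbf{x}_J^\star,\mathbf{y}_J^\star,\boldsymbol{\lambda}_2^\star,\dots,\boldsymbol{\lambda}_J^\star)$ with $\mathbf{x}_j^\star=\mathbf{x}_1^\star$ for $j\ge2$, $\nabla_{\mathbf{x}}f_1(\mathbf{x}_1^\star,\mathbf{y}_1^\star)-\sum_{j=2}^J\boldsymbol{\lambda}_j^\star=\mathbf{0}$, $\nabla_{\mathbf{x}}f_j(\mathbf{x}_j^\star,\mathbf{y}_j^\star)+\boldsymbol{\lambda}_j^\star=\mathbf{0}$ for $j\ge2$, and $\nabla_{\mathbf{y}}f_j(\mathbf{x}_j^\star,\mathbf{y}_j^\star)=\mathbf{0}$ for all $j$. It is a strict-saddle KKT point if in addition there are $\mathbf{d}_{\mathbf{x}}\in\mathbb{R}^n$, $\mathbf{d}_{\mathbf{y}}^j\in\mathbb{R}^{m_j}$ with $\sum_{j=1}^J\begin{bmatrix}\mathbf{d}_{\mathbf{x}}\\ \mathbf{d}_{\mathbf{y}}^j\end{bmatrix}^\top\nabla^2f_j(\mathbf{x}_j^\star,\mathbf{y}_j^\star)\begin{bmatrix}\mathbf{d}_{\mathbf{x}}\\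 \mathbf{d}_{\mathbf{y}}^j\end{bmatrix}<0$. *)

theory Defs
  imports "HOL-Probability.Probability" "HOL-Library.Option_ord"
begin

text \<open>
  Encoding of the variables. The agents \<open>1, \<dots>, J\<close> are the elements of the type \<open>'k option\<close>, with
  \<open>'k\<close> a finite linear order of cardinality \<open>J - 1\<close>: agent \<open>1\<close> is \<open>None\<close>, the agents \<open>2, \<dots>, J\<close>
  are \<open>Some k\<close>, and \<open>None\<close> precedes every \<open>Some k\<close>. Since \<open>'k\<close> is nonempty, \<open>J \<ge> 2\<close>.

  The dimensions \<open>m\<^sub>j\<close> of the \<open>y\<^sub>j\<close> may differ. The vectors \<open>y\<^sub>1, \<dots>, y\<^sub>J\<close> are therefore stored as one
  vector \<open>y :: real^'m\<close> with \<open>CARD('m) = m\<^sub>1 + \<dots> + m\<^sub>J\<close>, and \<open>blk :: 'm \<Rightarrow> 'k option\<close> says which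
  agent owns a coordinate. The space \<open>\<real>\<^bsup>m\<^sub>j\<^esup>\<close> is the coordinate subspace \<open>block blk j\<close>.
\<close>

type_synonym ('n, 'm, 'k) state = "((real^'n)^('k option)) \<times> (real^'m) \<times> ((real^'n)^'k)"

definition block :: "('m::finite \<Rightarrow> 'j) \<Rightarrow> 'j \<Rightarrow> (real^'m) set" where
  "block blk j = {v. \<forall>i. blk i \<noteq> j \<longrightarrow> v $ i = 0}"

definition block_part :: "('m::finite \<Rightarrow> 'j) \<Rightarrow> 'j \<Rightarrow> real^'m \<Rightarrow> real^'m" where
  "block_part blk j y = (\<chi> i. if blk i = j then y $ i else 0)"

definition upd_block :: "('m::finite \<Rightarrow> 'j) \<Rightarrow> 'j \<Rightarrow> real^'m \<Rightarrow> real^'m \<Rightarrow> real^'m" where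
  "upd_block blk j v y = (\<chi> i. if blk i = j then v $ i else y $ i)"

definition upd_vec :: "'j::finite \<Rightarrow> 'a \<Rightarrow> 'a^'j \<Rightarrow> 'a^'j" where
  "upd_vec j u x = (\<chi> i. if i = j then u else x $ i)"


text \<open>
  Calculus on a linear subspace \<open>S\<close>, for functions that are meaningful on a relatively open subset
  of \<open>S\<close>. Derivatives within \<open>S\<close> are determined only on directions in \<open>S\<close>; hence the
  gradient is required to lie in \<open>S\<close>, and Hessians are applied only to directions in \<open>S\<close>.
\<close>

definition gradient :: "'a::euclidean_space set \<Rightarrow> ('a \<Rightarrow> real) \<Rightarrow> 'a \<Rightarrow> 'a" where
  "gradient S F v = (THE g. g \<in> S \<and> (F has_derivative (\<lambda>d. g \<bullet> d)) (at v within S))"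

definition hessian :: "'a::euclidean_space set \<Rightarrow> ('a \<Rightarrow> real) \<Rightarrow> 'a \<Rightarrow> 'a \<Rightarrow> 'a" where
  "hessian S F v = frechet_derivative (gradient S F) (at v within S)"

definition hess_form :: "'a::euclidean_space set \<Rightarrow> ('a \<Rightarrow> real) \<Rightarrow> 'a \<Rightarrow> 'a \<Rightarrow> real" where
  "hess_form S F v d = d \<bullet> hessian S F v d"

text \<open>In finite dimension, continuity of the Hessian is continuity along each direction.\<close>

definition C2_on :: "'a::euclidean_space set \<Rightarrow> 'a set \<Rightarrow> ('a \<Rightarrow> real) \<Rightarrow> bool" where
  "C2_on S D F \<longleftrightarrow>
     (\<forall>v\<in>D. F differentiable (at v within S)) \<and>
     (\<forall>v\<in>D. gradient S F differentiable (at v within S)) \<and>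
     (\<forall>d\<in>S. continuous_on D (\<lambda>v. hessian S F v d))"

lemma subspace_block: "subspace (block blk j)"
  by (auto simp: block_def subspace_def)

lemma block_part_in_block: "block_part blk j y \<in> block blk j"
  by (simp add: block_part_def block_def)

lemma has_derivative_within_subspace_unique:
  fixes G :: "'a::euclidean_space \<Rightarrow> 'b::real_normed_vector"
  assumes S: "subspace S" "v \<in> S" "d \<in> S"
    and A: "(G has_derivative A) (at v within S)" and B: "(G has_derivative B) (at v within S)"
  shows "A d = B d"
proof -
  have *: "((\<lambda>t. G (v + t *\<^sub>R d)) has_derivative (\<lambda>t. L (t *\<^sub>R d))) (at (0::real))"
    if L: "(G has_derivative L) (at v within S)" for L
  proof -
    have sub: "range (\<lambda>t. v + t *\<^sub>R d) \<subseteq> S"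
      using S by (auto intro: subspace_add subspace_scale)
    have 1: "((\<lambda>t. v + t *\<^sub>R d) has_derivative (\<lambda>t. t *\<^sub>R d)) (at (0::real))"
      by (auto intro!: derivative_eq_intros)
    have "(G has_derivative L) (at (v + 0 *\<^sub>R d) within range (\<lambda>t. v + t *\<^sub>R d))"
      using has_derivative_subset[OF L sub] by simp
    from has_derivative_in_compose[OF 1 this] show ?thesis by simp
  qed
  have "(\<lambda>t::real. A (t *\<^sub>R d)) = (\<lambda>t. B (t *\<^sub>R d))"
    by (rule has_derivative_unique[OF *[OF A] *[OF B]])
  from fun_cong[OF this, of 1] show ?thesis by simp
qed

lemma gradient_eqI:
  assumes "subspace S" "v \<in> S" "g \<in> S" "(F has_derivative (\<lambda>d. g \<bullet> d)) (at v within S)"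
  shows "gradient S F v = g"
  unfolding gradient_def
proof (rule the_equality)
  fix g' assume g': "g' \<in> S \<and> (F has_derivative (\<lambda>d. g' \<bullet> d)) (at v within S)"
  have "g' - g \<in> S" using assms g' by (simp add: subspace_diff)
  then have "g' \<bullet> (g' - g) = g \<bullet> (g' - g)"
    using has_derivative_within_subspace_unique[OF assms(1,2)] g' assms(4) by blast
  then have "(g' - g) \<bullet> (g' - g) = 0" by (simp add: inner_diff_left)
  then show "g' = g" by simp
qed (use assms in auto)

lemma hessian_eqI:
  assumes "subspace S" "v \<in> S" "d \<in> S" "(gradient S F has_derivative H) (at v within S)"
  shows "hessian S F v d = H d"
  unfolding hessian_def
  using has_derivative_within_subspace_unique[OF assms(1-3) _ assms(4)] assms(4)
  by (metis differentiableI frechet_derivative_works)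


text \<open>
  Below, \<open>Y\<close> is the subspace over which \<open>y\<close> ranges and \<open>Dx \<times> Dy\<close> the domain.
\<close>

definition strongly_biconvex ::
  "'b::euclidean_space set \<Rightarrow> 'a::euclidean_space set \<Rightarrow> 'b set \<Rightarrow> ('a \<Rightarrow> 'b \<Rightarrow> real) \<Rightarrow> bool" where
  "strongly_biconvex Y Dx Dy h \<longleftrightarrow>
     (\<exists>m>0. \<forall>x\<in>Dx. \<forall>y\<in>Dy.
        (\<forall>d. hess_form UNIV (\<lambda>u. h u y) x d \<ge> m * (d \<bullet> d)) \<and>
        (\<forall>d\<in>Y. hess_form Y (\<lambda>v. h x v) y d \<ge> m * (d \<bullet> d)))"

definition relatively_bismooth ::
  "'b::euclidean_space set \<Rightarrow> 'a::euclidean_space set \<Rightarrow> 'b set \<Rightarrow> real \<Rightarrow> real \<Rightarrow>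
   ('a \<Rightarrow> 'b \<Rightarrow> real) \<Rightarrow> ('a \<Rightarrow> 'b \<Rightarrow> real) \<Rightarrow> bool" where
  "relatively_bismooth Y Dx Dy Lx Ly h f \<longleftrightarrow>
     (\<forall>x\<in>Dx. \<forall>y\<in>Dy.
        (\<forall>d. Lx * hess_form UNIV (\<lambda>u. h u y) x d + hess_form UNIV (\<lambda>u. f u y) x d \<ge> 0 \<and>
             Lx * hess_form UNIV (\<lambda>u. h u y) x d - hess_form UNIV (\<lambda>u. f u y) x d \<ge> 0) \<and>
        (\<forall>d\<in>Y. Ly * hess_form Y (\<lambda>v. h x v) y d + hess_form Y (\<lambda>v. f x v) y d \<ge> 0 \<and>
               Ly * hess_form Y (\<lambda>v. h x v) y d - hess_form Y (\<lambda>v. f x v) y d \<ge> 0))"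

definition bregman_x ::
  "('a::euclidean_space \<Rightarrow> 'b \<Rightarrow> real) \<Rightarrow> 'a \<Rightarrow> 'a \<Rightarrow> 'b \<Rightarrow> real" where
  "bregman_x h x1 x2 y = h x1 y - h x2 y - gradient UNIV (\<lambda>u. h u y) x2 \<bullet> (x1 - x2)"

definition bregman_y ::
  "'b::euclidean_space set \<Rightarrow> ('a \<Rightarrow> 'b \<Rightarrow> real) \<Rightarrow> 'b \<Rightarrow> 'b \<Rightarrow> 'a \<Rightarrow> real" where
  "bregman_y Y h y1 y2 x = h x y1 - h x y2 - gradient Y (\<lambda>v. h x v) y2 \<bullet> (y1 - y2)"


definition aug_lagrangian ::
  "('m::finite \<Rightarrow> 'k option) \<Rightarrow> real \<Rightarrow> ('k option \<Rightarrow> real^'n \<Rightarrow> real^'m \<Rightarrow> real) \<Rightarrow>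
   ('n::finite, 'm, 'k::finite) state \<Rightarrow> real" where
  "aug_lagrangian blk \<rho> f = (\<lambda>(x, y, l).
     (\<Sum>j\<in>UNIV. f j (x $ j) (block_part blk j y))
     + (\<Sum>k\<in>UNIV. l $ k \<bullet> (x $ Some k - x $ None))
     + \<rho> / 2 * (\<Sum>k\<in>UNIV. (norm (x $ Some k - x $ None))\<^sup>2))"

text \<open>
  Objectives of the two subproblems of agent \<open>j\<close>. The state argument is the current one, in which
  the agents before \<open>j\<close> (and, for the second objective, also \<open>x\<^sub>j\<close>) have already been updated.
\<close>

definition x_objective ::
  "('m::finite \<Rightarrow> 'k option) \<Rightarrow> real \<Rightarrow> real \<Rightarrow> ('k option \<Rightarrow> real^'n \<Rightarrow> real^'m \<Rightarrow> real) \<Rightarrow>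
   ('k option \<Rightarrow> real^'n \<Rightarrow> real^'m \<Rightarrow> real) \<Rightarrow> 'k option \<Rightarrow>
   ('n::finite, 'm, 'k::finite) state \<Rightarrow> real^'n \<Rightarrow> real" where
  "x_objective blk \<rho> \<eta> f h j = (\<lambda>(x, y, l) u.
     1 / \<eta> * bregman_x (h j) u (x $ j) (block_part blk j y)
     + aug_lagrangian blk \<rho> f (upd_vec j u x, y, l))"

definition y_objective ::
  "('m::finite \<Rightarrow> 'k option) \<Rightarrow> real \<Rightarrow> real \<Rightarrow> ('k option \<Rightarrow> real^'n \<Rightarrow> real^'m \<Rightarrow> real) \<Rightarrow>
   ('k option \<Rightarrow> real^'n \<Rightarrow> real^'m \<Rightarrow> real) \<Rightarrow> 'k option \<Rightarrow>
   ('n::finite, 'm, 'k::finite) state \<Rightarrow> real^'m \<Rightarrow> real" where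
  "y_objective blk \<rho> \<eta> f h j = (\<lambda>(x, y, l) v.
     1 / \<eta> * bregman_y (block blk j) (h j) v (block_part blk j y) (x $ j)
     + aug_lagrangian blk \<rho> f (x, upd_block blk j v y, l))"

definition x_step ::
  "('m::finite \<Rightarrow> 'k option) \<Rightarrow> real \<Rightarrow> real \<Rightarrow> ('k option \<Rightarrow> real^'n \<Rightarrow> real^'m \<Rightarrow> real) \<Rightarrow>
   ('k option \<Rightarrow> real^'n \<Rightarrow> real^'m \<Rightarrow> real) \<Rightarrow> ('k option \<Rightarrow> (real^'n) set) \<Rightarrow> 'k option \<Rightarrow>
   ('n::finite, 'm, 'k::finite) state \<Rightarrow> ('n, 'm, 'k) state" where
  "x_step blk \<rho> \<eta> f h Dx j = (\<lambda>(x, y, l).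
     (upd_vec j (arg_min_on (x_objective blk \<rho> \<eta> f h j (x, y, l)) (Dx j)) x, y, l))"

definition y_step ::
  "('m::finite \<Rightarrow> 'k option) \<Rightarrow> real \<Rightarrow> real \<Rightarrow> ('k option \<Rightarrow> real^'n \<Rightarrow> real^'m \<Rightarrow> real) \<Rightarrow>
   ('k option \<Rightarrow> real^'n \<Rightarrow> real^'m \<Rightarrow> real) \<Rightarrow> ('k option \<Rightarrow> (real^'m) set) \<Rightarrow> 'k option \<Rightarrow>
   ('n::finite, 'm, 'k::finite) state \<Rightarrow> ('n, 'm, 'k) state" where
  "y_step blk \<rho> \<eta> f h Dy j = (\<lambda>(x, y, l).
     (x, upd_block blk j (arg_min_on (y_objective blk \<rho> \<eta> f h j (x, y, l)) (Dy j)) y, l))"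

definition dual_step ::
  "real \<Rightarrow> ('n::finite, 'm::finite, 'k::finite) state \<Rightarrow> ('n, 'm, 'k) state" where
  "dual_step \<rho> = (\<lambda>(x, y, l). (x, y, \<chi> k. l $ k + \<rho> *\<^sub>R (x $ Some k - x $ None)))"

definition sweep ::
  "('m::finite \<Rightarrow> 'k option) \<Rightarrow> real \<Rightarrow> real \<Rightarrow> ('k option \<Rightarrow> real^'n \<Rightarrow> real^'m \<Rightarrow> real) \<Rightarrow>
   ('k option \<Rightarrow> real^'n \<Rightarrow> real^'m \<Rightarrow> real) \<Rightarrow> ('k option \<Rightarrow> (real^'n) set) \<Rightarrow>
   ('k option \<Rightarrow> (real^'m) set) \<Rightarrow> ('k option) set \<Rightarrow>
   ('n::finite, 'm, 'k::{finite,linorder}) state \<Rightarrow> ('n, 'm, 'k) state" where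
  "sweep blk \<rho> \<eta> f h Dx Dy A =
     fold (\<lambda>j. y_step blk \<rho> \<eta> f h Dy j \<circ> x_step blk \<rho> \<eta> f h Dx j) (sorted_list_of_set A)"

definition admm_map ::
  "('m::finite \<Rightarrow> 'k option) \<Rightarrow> real \<Rightarrow> real \<Rightarrow> ('k option \<Rightarrow> real^'n \<Rightarrow> real^'m \<Rightarrow> real) \<Rightarrow>
   ('k option \<Rightarrow> real^'n \<Rightarrow> real^'m \<Rightarrow> real) \<Rightarrow> ('k option \<Rightarrow> (real^'n) set) \<Rightarrow>
   ('k option \<Rightarrow> (real^'m) set) \<Rightarrow>
   ('n::finite, 'm, 'k::{finite,linorder}) state \<Rightarrow> ('n, 'm, 'k) state" where
  "admm_map blk \<rho> \<eta> f h Dx Dy = dual_step \<rho> \<circ> sweep blk \<rho> \<eta> f h Dx Dy UNIV"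

text \<open>
  \<open>arg_min_on\<close> is total, so existence of every minimizer met during one iteration is a separate
  condition. \<open>sweep \<dots> {..<j} z\<close> is the state from which agent \<open>j\<close> starts.
\<close>

definition admm_well_defined_on ::
  "('m::finite \<Rightarrow> 'k option) \<Rightarrow> real \<Rightarrow> real \<Rightarrow> ('k option \<Rightarrow> real^'n \<Rightarrow> real^'m \<Rightarrow> real) \<Rightarrow>
   ('k option \<Rightarrow> real^'n \<Rightarrow> real^'m \<Rightarrow> real) \<Rightarrow> ('k option \<Rightarrow> (real^'n) set) \<Rightarrow>
   ('k option \<Rightarrow> (real^'m) set) \<Rightarrow> ('n::finite, 'm, 'k::{finite,linorder}) state set \<Rightarrow> bool" where
  "admm_well_defined_on blk \<rho> \<eta> f h Dx Dy \<Omega> \<longleftrightarrow>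
     (\<forall>z\<in>\<Omega>. \<forall>j.
        (let s = sweep blk \<rho> \<eta> f h Dx Dy {..<j} z in
           (\<exists>u. is_arg_min (x_objective blk \<rho> \<eta> f h j s) (\<lambda>u. u \<in> Dx j) u) \<and>
           (\<exists>v. is_arg_min (y_objective blk \<rho> \<eta> f h j (x_step blk \<rho> \<eta> f h Dx j s))
                  (\<lambda>v. v \<in> Dy j) v)))"

definition KKT_point ::
  "('m::finite \<Rightarrow> 'k option) \<Rightarrow> ('k option \<Rightarrow> real^'n \<Rightarrow> real^'m \<Rightarrow> real) \<Rightarrow>
   ('n::finite, 'm, 'k::finite) state \<Rightarrow> bool" where
  "KKT_point blk f = (\<lambda>(x, y, l).
     (\<forall>k. x $ Some k = x $ None) \<and>
     gradient UNIV (\<lambda>u. f None u (block_part blk None y)) (x $ None) - (\<Sum>k\<in>UNIV. l $ k) = 0 \<and>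
     (\<forall>k. gradient UNIV (\<lambda>u. f (Some k) u (block_part blk (Some k) y)) (x $ Some k) + l $ k = 0) \<and>
     (\<forall>j. gradient (block blk j) (\<lambda>v. f j (x $ j) v) (block_part blk j y) = 0))"

definition strict_saddle_KKT_point ::
  "('m::finite \<Rightarrow> 'k option) \<Rightarrow> ('k option \<Rightarrow> real^'n \<Rightarrow> real^'m \<Rightarrow> real) \<Rightarrow>
   ('n::finite, 'm, 'k::finite) state \<Rightarrow> bool" where
  "strict_saddle_KKT_point blk f z \<longleftrightarrow>
     KKT_point blk f z \<and>
     (case z of (x, y, l) \<Rightarrow>
        \<exists>dx dy. (\<forall>j. dy j \<in> block blk j) \<and>
          (\<Sum>j\<in>UNIV. hess_form (UNIV \<times> block blk j) (\<lambda>(u, v). f j u v)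
              (x $ j, block_part blk j y) (dx, dy j)) < 0)"

end

theory Submission
  imports Defs "HOL-Computational_Algebra.Fundamental_Theorem_Algebra"
begin

text \<open>
  Every block update solves \<open>proj (\<Psi> s\<^sup>+) = proj (\<Theta> s)\<close>, where \<open>\<Theta> = \<nabla>h / \<eta>\<close> collects the kernels,
  \<open>\<Psi> = \<nabla>\<L> + \<Theta>\<close>, and \<open>proj\<close> selects the block; only that block moves. The step size makes both
  maps strongly monotone along the block. Monotonicity of \<open>\<Theta>\<close> shows that the update is injective
  with a locally Lipschitz inverse, so that preimages of null sets under the iteration are null;
  monotonicity of \<open>\<Psi>\<close> shows that it is strictly differentiable at every KKT point.

  At a strict saddle the linearized iteration has a real eigenvalue \<open>\<mu> > 1\<close>: after eliminating the
  multipliers the eigenvalue equation is equivalent to the singularity of a symmetric form depending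
  on \<open>\<mu>\<close>, which takes a negative value for \<open>\<mu>\<close> near \<open>1\<close> and is positive definite for large \<open>\<mu>\<close>.

  Near such a point there is a quadratic form that the iteration expands along differences of orbits.
  Orbits that stay close to the point forever therefore start in a Lipschitz graph of positive
  codimension, and by Lindelof countably many such null sets and their preimages suffice.
\<close>


text \<open>Two obstacles shape the proof. The minimizers are guaranteed only along sweeps that
  start in \<Omega>, so every local property is stated relative to a set, and a block update is
  differentiated only where its continuity is visible: a KKT point solves all block equations
  itself, and monotonicity then bounds how far a nearby state can move. Since two orbits are
  compared with each other, and neither is the fixed point, the derivative there has to be strict.
  The linearization at a saddle is nonsymmetric and may have Jordan blocks and spectrum on the unit
  circle beside the eigenvalue \<mu>. Growth is therefore compared not with 1 but with a number c
  strictly between 1 and \<mu>^2 that avoids finitely many squared moduli. Any linear map admits an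
  expanding form for such a c, and c < \<mu>^2 by itself makes the form positive at the unstable
  eigenvector, so nothing else about the spectrum has to be known.\<close>

section \<open>Expanding quadratic forms\<close>

text \<open>Young's inequality with a free weight: complete the square. Cross terms are absorbed
  with it below.\<close>

lemma weighted_product_le:
  fixes a b r \<theta> :: real
  assumes "\<theta> > 0"
  shows "2 * r * a * b \<le> \<theta> * a\<^sup>2 + r\<^sup>2 / \<theta> * b\<^sup>2"
proof -
  have "0 \<le> (\<theta> * a - r * b)\<^sup>2 / \<theta>" using assms by simp
  also have "\<dots> = \<theta> * a\<^sup>2 + r\<^sup>2 / \<theta> * b\<^sup>2 - 2 * r * a * b"
    using assms by (simp add: power2_diff field_simps power2_eq_square)
  finally show ?thesis by simp
qed

lemma bounded_bilinear_plus:
  assumes "bounded_bilinear f" "bounded_bilinear g"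
  shows "bounded_bilinear (\<lambda>x y. f x y + g x y)"
proof -
  interpret f: bounded_bilinear f by fact
  interpret g: bounded_bilinear g by fact
  obtain B1 B2 where B: "\<And>x y. norm (f x y) \<le> norm x * norm y * B1"
      "\<And>x y. norm (g x y) \<le> norm x * norm y * B2"
    using f.bounded g.bounded by blast
  have "norm (f x y + g x y) \<le> norm x * norm y * (B1 + B2)" for x y
    using norm_triangle_le[OF add_mono[OF B(1)[of x y] B(2)[of x y]]] by (simp add: distrib_left)
  then show ?thesis
    by (intro bounded_bilinear.intro exI[of _ "B1 + B2"] allI)
      (auto simp: f.add_left f.add_right g.add_left g.add_right f.scaleR_left f.scaleR_right
        g.scaleR_left g.scaleR_right scaleR_add_right)
qed

text \<open>A complex vector space kept as a real Euclidean space: \<open>J\<close> is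
  multiplication by i, and \<open>U_J\<close> makes \<open>U\<close> complex linear. Forms, norms
  and dimensions stay real, while eigenvalues of \<open>U\<close> may be complex.\<close>

locale complex_linear_operator =
  fixes U J :: "'b::euclidean_space \<Rightarrow> 'b"
  assumes linear_U: "linear U" and linear_J: "linear J"
    and J_J: "J (J z) = - z" and norm_J: "norm (J z) = norm z"
    and U_J: "U (J z) = J (U z)"
begin

definition cscale :: "complex \<Rightarrow> 'b \<Rightarrow> 'b" where
  "cscale c z = Re c *\<^sub>R z + Im c *\<^sub>R J z"

text \<open>\<open>J\<close> preserves the norm of z + J z and maps it to J z - z; the cross terms
  of the two squared norms have opposite signs.\<close>

lemma inner_J_self: "z \<bullet> J z = 0"
proof -
  have "(norm (J (z + J z)))\<^sup>2 = (norm (z + J z))\<^sup>2" by (simp add: norm_J)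
  moreover have "J (z + J z) = J z - z" using linear_J by (simp add: linear_add J_J)
  ultimately show ?thesis
    by (simp add: power2_norm_eq_inner inner_add inner_diff inner_commute)
qed

lemma norm_cscale: "norm (cscale c z) = cmod c * norm z"
proof -
  have "(norm (cscale c z))\<^sup>2 = (Re c)\<^sup>2 * (norm z)\<^sup>2 + (Im c)\<^sup>2 * (norm (J z))\<^sup>2"
    using inner_J_self[of z] unfolding cscale_def power2_norm_eq_inner
    by (simp add: inner_add inner_commute power2_eq_square algebra_simps)
  also have "\<dots> = (cmod c * norm z)\<^sup>2" by (simp add: norm_J cmod_power2 power_mult_distrib algebra_simps)
  finally show ?thesis by (simp add: power2_eq_iff_nonneg)
qed

lemma U_cscale: "U (cscale c z) = cscale c (U z)"
  using linear_U by (simp add: cscale_def linear_add linear_scale U_J)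

lemma cscale_diff: "cscale c (z - w) = cscale c z - cscale c w"
  using linear_J by (simp add: cscale_def linear_diff algebra_simps)

lemma cscale_minus: "cscale c (- z) = - cscale c z"
  using cscale_diff[of c 0 z] linear_0[OF linear_J] by (simp add: cscale_def)

lemma cscale_plus: "cscale (c + d) z = cscale c z + cscale d z"
  by (simp add: cscale_def algebra_simps)

lemma cscale_of_real: "cscale (of_real r) z = r *\<^sub>R z"
  by (simp add: cscale_def)

section \<open>Products of complex linear factors of the operator that annihilate the space\<close>

fun chain :: "complex list \<Rightarrow> 'b \<Rightarrow> 'b" where
  "chain [] z = z"
| "chain (\<mu> # \<Lambda>) z = chain \<Lambda> (U z - cscale \<mu> z)"

lemma linear_factor: "linear (\<lambda>z. U z - cscale c z)"
  unfolding cscale_def using linear_U linear_J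
  by (intro linear_compose_sub linear_compose_add linear_compose_scale_right linear_id[unfolded id_def])

lemma linear_chain: "linear (chain \<Lambda>)"
proof (induction \<Lambda>)
  case Nil
  then show ?case by (simp add: linear_iff)
next
  case (Cons c \<Lambda>)
  show ?case using linear_compose[OF linear_factor[of c] Cons] by (simp add: o_def)
qed

lemma chain_append: "chain (\<Lambda> @ \<Lambda>') z = chain \<Lambda>' (chain \<Lambda> z)"
  by (induction \<Lambda> arbitrary: z) auto

definition poly_act :: "complex poly \<Rightarrow> 'b \<Rightarrow> 'b" where
  "poly_act p z = (\<Sum>i\<le>degree p. cscale (coeff p i) ((U ^^ i) z))"

lemma poly_act_le:
  assumes "degree p \<le> n"
  shows "poly_act p z = (\<Sum>i\<le>n. cscale (coeff p i) ((U ^^ i) z))"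
  unfolding poly_act_def
  by (rule sum.mono_neutral_left) (use assms in \<open>auto simp: coeff_eq_0 cscale_def\<close>)

lemma U_pow_diff_cscale: "(U ^^ i) (z - cscale c w) = (U ^^ i) z - cscale c ((U ^^ i) w)"
  by (induction i) (use linear_U in \<open>auto simp: linear_diff U_cscale\<close>)

text \<open>Turns the factorization of a polynomial into a \<open>chain\<close>. Both summands of (X
  - c) p are padded to the common length \<open>?n\<close> before their coefficients are
  compared.\<close>

lemma poly_act_linear_factor: "poly_act ([:- c, 1:] * p) z = poly_act p (U z - cscale c z)"
proof -
  let ?n = "Suc (degree p)"
  let ?u = "\<lambda>i. (U ^^ i) z"
  have e: "[:- c, 1:] * p = smult (- c) p + pCons 0 p" by simp
  have "degree ([:- c, 1:] * p) \<le> ?n"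
    unfolding e by (intro degree_add_le) (auto simp: le_SucI degree_pCons_le)
  then have "poly_act ([:- c, 1:] * p) z = (\<Sum>i\<le>?n. cscale (coeff (smult (- c) p + pCons 0 p) i) (?u i))"
    unfolding e by (rule poly_act_le)
  also have "\<dots> = (\<Sum>i\<le>?n. cscale (coeff p i) (- cscale c (?u i))) + (\<Sum>i\<le>?n. cscale (coeff (pCons 0 p) i) (?u i))"
  proof -
    have *: "cscale (- (c * d)) w = cscale d (- cscale c w)" for d w
      using linear_J
      by (simp add: cscale_def linear_add linear_diff linear_scale linear_neg J_J algebra_simps)
    show ?thesis by (simp only: coeff_add coeff_smult cscale_plus sum.distrib) (simp add: *)
  qed
  also have "(\<Sum>i\<le>?n. cscale (coeff (pCons 0 p) i) (?u i)) = (\<Sum>i\<le>degree p. cscale (coeff p i) (?u (Suc i)))"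
    by (subst sum.atMost_Suc_shift) (simp add: cscale_def)
  also have "(\<Sum>i\<le>?n. cscale (coeff p i) (- cscale c (?u i))) = (\<Sum>i\<le>degree p. cscale (coeff p i) (- cscale c (?u i)))"
    by (simp add: coeff_eq_0 cscale_def)
  finally show ?thesis
    by (simp add: poly_act_def U_pow_diff_cscale cscale_diff cscale_minus sum_subtractf funpow_swap1 sum_negf)
qed

text \<open>Roots are split off one at a time by the fundamental theorem of algebra; the constant
  that remains is nonzero, so it annihilates only 0.\<close>

lemma chain_kills_if_poly_act_0:
  assumes "p \<noteq> 0" "poly_act p z = 0"
  shows "\<exists>\<Lambda>. chain \<Lambda> z = 0"
  using assms
proof (induction "degree p" arbitrary: p z)
  case 0
  then obtain a where a: "p = [:a:]" using degree_0_id by metis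
  then have "cmod a * norm z = 0" using 0 by (simp add: poly_act_def flip: norm_cscale)
  then have "chain [] z = 0" using 0 a by simp
  then show ?case by blast
next
  case (Suc n)
  then have "\<not> constant (poly p)" by (simp add: constant_degree)
  then obtain c where "poly p c = 0" using fundamental_theorem_of_algebra by blast
  then obtain q where q: "p = [:- c, 1:] * q" by (auto simp: poly_eq_0_iff_dvd)
  then have "q \<noteq> 0" using Suc by auto
  then have "n = degree q" using q Suc by (simp add: degree_mult_eq del: mult_pCons_left)
  from Suc(1)[OF this \<open>q \<noteq> 0\<close>, of "U z - cscale c z"] Suc(4)
  obtain \<Lambda> where "chain \<Lambda> (U z - cscale c z) = 0"
    unfolding q poly_act_linear_factor by blast
  then have "chain (c # \<Lambda>) z = 0" by simp
  then show ?case by blast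
qed

text \<open>One more iterate of z than the dimension gives a linear dependence, that is, a nonzero
  polynomial in \<open>U\<close> that annihilates z.\<close>

lemma chain_kills_vector: "\<exists>\<Lambda>. chain \<Lambda> z = 0"
proof -
  let ?n = "DIM('b)"
  have "\<exists>c. (\<exists>i\<le>?n. c i \<noteq> 0) \<and> (\<Sum>i\<le>?n. c i *\<^sub>R (U ^^ i) z) = 0"
  proof (cases "inj_on (\<lambda>i. (U ^^ i) z) {..?n}")
    case True
    let ?S = "(\<lambda>i. (U ^^ i) z) ` {..?n}"
    have "card ?S = Suc ?n" using True by (simp add: card_image)
    then have "dependent ?S" by (intro dependent_biggerset) auto
    then obtain u where u: "\<exists>v\<in>?S. u v \<noteq> 0" "(\<Sum>v\<in>?S. u v *\<^sub>R v) = 0"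
      using dependent_finite[of ?S] by auto
    have "(\<Sum>i\<le>?n. u ((U ^^ i) z) *\<^sub>R (U ^^ i) z) = 0"
      using u(2) sum.reindex[OF True, of "\<lambda>v. u v *\<^sub>R v"] by (simp add: o_def)
    then show ?thesis using u(1) by (intro exI[of _ "\<lambda>i. u ((U ^^ i) z)"]) auto
  next
    \<comment> \<open>If two iterates coincide, their set is too small for the dimension count, but
      then X^i - X^j annihilates z.\<close>
    case False
    then obtain i j where ij: "i \<le> ?n" "j \<le> ?n" "i \<noteq> j" "(U ^^ i) z = (U ^^ j) z"
      by (auto simp: inj_on_def)
    let ?c = "\<lambda>k. (if k = i then 1 else 0) - (if k = j then 1 else 0 :: real)"
    have "(\<Sum>k\<le>?n. ?c k *\<^sub>R (U ^^ k) z) = 0"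
      using ij by (simp add: scaleR_diff_left sum_subtractf if_distrib[of "\<lambda>a. a *\<^sub>R _"] cong: if_cong)
    then show ?thesis using ij by (intro exI[of _ ?c]) (auto intro!: exI[of _ i])
  qed
  then obtain c i where c: "i \<le> ?n" "c i \<noteq> 0" "(\<Sum>i\<le>?n. c i *\<^sub>R (U ^^ i) z) = 0" by blast
  define p :: "complex poly" where "p = (\<Sum>i\<le>?n. monom (of_real (c i)) i)"
  have co: "coeff p k = (if k \<le> ?n then of_real (c k) else 0)" for k
    by (simp add: p_def coeff_sum)
  have "coeff p i \<noteq> 0" using c by (simp add: co)
  then have "p \<noteq> 0" by auto
  have "degree p \<le> ?n" by (rule degree_le) (simp add: co)
  then have "poly_act p z = 0" using c(3) by (simp add: poly_act_le co cscale_of_real)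
  then show ?thesis using chain_kills_if_poly_act_0 \<open>p \<noteq> 0\<close> by blast
qed

lemma chain_0: "chain \<Lambda> 0 = 0"
  using linear_chain linear_0 by blast

text \<open>Chains for the basis vectors are concatenated: the next one is chosen for the image of
  its vector under the chain built so far, and vectors already sent to 0 stay there.\<close>

lemma chain_kills_all: "\<exists>\<Lambda>. \<forall>z. chain \<Lambda> z = 0"
proof -
  have "\<exists>\<Lambda>. \<forall>z\<in>B. chain \<Lambda> z = 0" if "finite B" for B
    using that
  proof (induction B)
    case empty
    show ?case by simp
  next
    case (insert b B)
    then obtain \<Lambda> where "\<forall>z\<in>B. chain \<Lambda> z = 0" by blast
    moreover obtain \<Lambda>' where "chain \<Lambda>' (chain \<Lambda> b) = 0" using chain_kills_vector by blast
    ultimately have "\<forall>z\<in>insert b B. chain (\<Lambda> @ \<Lambda>') z = 0" by (simp add: chain_append chain_0)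
    then show ?case by blast
  qed
  from this[OF finite_Basis] obtain \<Lambda> where \<Lambda>: "\<forall>z\<in>Basis. chain \<Lambda> z = 0" ..
  have "chain \<Lambda> z = 0" for z
    using linear_eq_on[OF linear_chain linear_zero, of z Basis \<Lambda>] \<Lambda> by auto
  then show ?thesis by blast
qed

text \<open>A Stein inequality built one root at a time, which also handles Jordan blocks. Where U z
  = \<mu> z, the squared norm, signed by |\<mu>|^2 - c, gains strictly over the factor c. In general
  the defect w = U z - \<mu> z spoils this by a multiple of |w|^2, which is paid for by the form of
  the remaining chain evaluated at w.\<close>

lemma expanding_form_modulo_chain:
  assumes "\<forall>\<mu>\<in>set \<Lambda>. (cmod \<mu>)\<^sup>2 \<noteq> c"
  shows "\<exists>b \<delta> C. bounded_bilinear b \<and> \<delta> > 0 \<and> C \<ge> 0 \<and>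
    (\<forall>z. \<delta> * (norm z)\<^sup>2 - C * (norm (chain \<Lambda> z))\<^sup>2 \<le> b (U z) (U z) - c * (b z z :: real))"
  using assms
proof (induction \<Lambda>)
  case Nil
  show ?case
    by (rule exI[of _ "\<lambda>_ _. 0"], rule exI[of _ 1], rule exI[of _ 1])
       (auto intro!: bounded_bilinear.intro exI[of _ 0])
next
  case (Cons \<mu> \<Lambda>)
  then obtain b \<delta> C where b: "bounded_bilinear b" "\<delta> > 0" "C \<ge> 0"
    and *: "\<And>z. \<delta> * (norm z)\<^sup>2 - C * (norm (chain \<Lambda> z))\<^sup>2 \<le> b (U z) (U z) - c * (b z z :: real)"
    by auto
  define r where "r = cmod \<mu>"
  \<comment> \<open>Half of the gap: the gain is 2 \<theta> |z|^2, and one \<theta> is spent on the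
    cross term between z and w.\<close>
  define \<theta> where "\<theta> = \<bar>r\<^sup>2 - c\<bar> / 2"
  define \<sigma> where "\<sigma> = sgn (r\<^sup>2 - c)"
  have \<theta>: "\<theta> > 0" using Cons.prems by (simp add: \<theta>_def r_def)
  define C1 where "C1 = r\<^sup>2 / \<theta> + 1"
  have C1: "C1 > 0" using \<theta> by (simp add: C1_def add_nonneg_pos)
  \<comment> \<open>Chosen so that the gain K \<delta> |w|^2 of the inductive form cancels the error
    C1 |w|^2 exactly.\<close>
  define K where "K = C1 / \<delta>"
  have K: "K > 0" "K * \<delta> = C1" using C1 b by (auto simp: K_def)
  let ?L = "\<lambda>z. U z - cscale \<mu> z"
  define q where "q = (\<lambda>z w. \<sigma> *\<^sub>R z \<bullet> w + b (K *\<^sub>R ?L z) (?L w))"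
  have L: "bounded_linear ?L" using linear_factor by (simp add: linear_conv_bounded_linear)
  have bq: "bounded_bilinear q"
  proof -
    interpret l: bounded_bilinear "\<lambda>z w::'b. \<sigma> *\<^sub>R z \<bullet> w"
      by (rule bounded_bilinear.comp1[OF bounded_bilinear_inner bounded_linear_scaleR_right])
    interpret r: bounded_bilinear "\<lambda>z w. b (K *\<^sub>R ?L z) (?L w)"
      by (rule bounded_bilinear.comp[OF b(1) bounded_linear_compose[OF bounded_linear_scaleR_right L] L])
    show ?thesis unfolding q_def by (intro bounded_bilinear_plus l.bounded_bilinear_axioms r.bounded_bilinear_axioms)
  qed
  have est: "\<theta> * (norm z)\<^sup>2 - K * C * (norm (chain (\<mu> # \<Lambda>) z))\<^sup>2 \<le> q (U z) (U z) - c * q z z" for z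
  proof -
    define w where "w = ?L z"
    have Uz: "U z = cscale \<mu> z + w" by (simp add: w_def)
    have "\<bar>U z \<bullet> U z - r\<^sup>2 * (z \<bullet> z)\<bar> \<le> 2 * r * norm z * norm w + (norm w)\<^sup>2"
    proof -
      have "U z \<bullet> U z = (norm (cscale \<mu> z))\<^sup>2 + 2 * (cscale \<mu> z \<bullet> w) + (norm w)\<^sup>2"
        unfolding Uz by (simp add: inner_add power2_norm_eq_inner inner_commute)
      then have "U z \<bullet> U z - r\<^sup>2 * (z \<bullet> z) = 2 * (cscale \<mu> z \<bullet> w) + (norm w)\<^sup>2"
        by (simp add: norm_cscale r_def power_mult_distrib power2_norm_eq_inner)
      moreover have "\<bar>cscale \<mu> z \<bullet> w\<bar> \<le> r * norm z * norm w"
        using Cauchy_Schwarz_ineq2[of "cscale \<mu> z" w] by (simp add: norm_cscale r_def)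
      moreover have "0 \<le> (norm w)\<^sup>2" by simp
      ultimately show ?thesis by argo
    qed
    also have "\<dots> \<le> \<theta> * (norm z)\<^sup>2 + C1 * (norm w)\<^sup>2"
      using weighted_product_le[OF \<theta>, of r "norm z" "norm w"] by (simp add: C1_def algebra_simps)
    finally have d: "\<bar>U z \<bullet> U z - r\<^sup>2 * (z \<bullet> z)\<bar> \<le> \<theta> * (norm z)\<^sup>2 + C1 * (norm w)\<^sup>2" .
    have "\<sigma> * (r\<^sup>2 - c) = 2 * \<theta>" by (auto simp: \<sigma>_def \<theta>_def sgn_if)
    then have "\<sigma> * (U z \<bullet> U z - c * (z \<bullet> z)) = \<sigma> * (U z \<bullet> U z - r\<^sup>2 * (z \<bullet> z)) + 2 * \<theta> * (z \<bullet> z)"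
      by algebra
    moreover have "- \<bar>U z \<bullet> U z - r\<^sup>2 * (z \<bullet> z)\<bar> \<le> \<sigma> * (U z \<bullet> U z - r\<^sup>2 * (z \<bullet> z))"
      by (auto simp: \<sigma>_def sgn_if)
    ultimately have 1: "\<theta> * (norm z)\<^sup>2 - C1 * (norm w)\<^sup>2 \<le> \<sigma> * (U z \<bullet> U z - c * (z \<bullet> z))"
      using d unfolding power2_norm_eq_inner by argo
    \<comment> \<open>The factor commutes with \<open>U\<close>, so the part of q that sees only
      defects is the inductive form at w and U w.\<close>
    have LU: "?L (U z) = U w" unfolding w_def using linear_U by (simp add: linear_diff U_cscale)
    have "K * (\<delta> * (norm w)\<^sup>2 - C * (norm (chain \<Lambda> w))\<^sup>2) \<le> K * (b (U w) (U w) - c * b w w)"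
      using *[of w] K by simp
    moreover have "q (U z) (U z) - c * q z z = \<sigma> * (U z \<bullet> U z - c * (z \<bullet> z)) + K * (b (U w) (U w) - c * b w w)"
      unfolding q_def LU w_def[symmetric]
      by (simp add: bounded_bilinear.scaleR_left[OF b(1)] algebra_simps)
    ultimately have "q (U z) (U z) - c * q z z \<ge> \<theta> * (norm z)\<^sup>2 - C1 * (norm w)\<^sup>2 + K * \<delta> * (norm w)\<^sup>2
        - K * C * (norm (chain \<Lambda> w))\<^sup>2"
      using 1 by (simp add: algebra_simps)
    then show ?thesis using K(2) by (simp add: w_def)
  qed
  have "K * C \<ge> 0" using K b by simp
  then show ?case using bq \<theta> est by blast
qed

end

text \<open>Complexify: the pair (x, y) stands for x + i y. Some chain annihilates everything, which
  removes the error term of the previous lemma, and the interval leaves room for a c that avoids the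
  squared moduli of its finitely many entries. The real vectors (x, 0) are invariant under
  \<open>U\<close>, so the form restricts to them.\<close>

lemma expanding_quadratic_form:
  fixes T :: "'a::euclidean_space \<Rightarrow> 'a"
  assumes T: "linear T" and "a < b"
  obtains q :: "'a \<Rightarrow> 'a \<Rightarrow> real" and c \<delta> where "bounded_bilinear q" "a < c" "c < b" "\<delta> > 0"
    "\<And>x. c * q x x + \<delta> * (norm x)\<^sup>2 \<le> q (T x) (T x)"
proof -
  define U where "U = (\<lambda>z. (T (fst z), T (snd z)))"
  define J where "J = (\<lambda>z::'a\<times>'a. (- snd z, fst z))"
  have "linear U" unfolding U_def
    by (rule linearI) (auto simp: linear_add[OF T] linear_scale[OF T])
  moreover have "linear J" unfolding J_def by (rule linearI) auto
  ultimately interpret complex_linear_operator U J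
    by (simp add: complex_linear_operator_def U_def J_def norm_prod_def add.commute linear_neg[OF T])
  obtain \<Lambda> where \<Lambda>: "\<forall>z. chain \<Lambda> z = 0" using chain_kills_all by blast
  have "infinite ({a<..<b} - (\<lambda>\<mu>. (cmod \<mu>)\<^sup>2) ` set \<Lambda>)"
    using \<open>a < b\<close> by (intro Diff_infinite_finite) auto
  then obtain c where c: "c \<in> {a<..<b} - (\<lambda>\<mu>. (cmod \<mu>)\<^sup>2) ` set \<Lambda>"
    using infinite_imp_nonempty by blast
  then have "\<forall>\<mu>\<in>set \<Lambda>. (cmod \<mu>)\<^sup>2 \<noteq> c" by auto
  from expanding_form_modulo_chain[OF this] obtain b \<delta> where b: "bounded_bilinear b" "\<delta> > 0"
    and *: "\<And>z. \<delta> * (norm z)\<^sup>2 \<le> b (U z) (U z) - c * (b z z :: real)"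
    using \<Lambda> by auto
  have "bounded_bilinear (\<lambda>x y::'a. b (x, 0) (y, 0))"
    by (intro bounded_bilinear.comp[OF b(1)] bounded_linear_Pair bounded_linear_ident bounded_linear_zero)
  moreover have "c * b (x, 0) (x, 0) + \<delta> * (norm x)\<^sup>2 \<le> b (T x, 0) (T x, 0)" for x
    using *[of "(x, 0)"] linear_0[OF T] by (simp add: U_def norm_prod_def)
  ultimately show ?thesis using that[of "\<lambda>x y. b (x, 0) (y, 0)" c \<delta>] b c by auto
qed

section \<open>Initial points attracted by unstable fixed points\<close>

text \<open>Both points vary, because differences of two orbits are to be controlled. Only points of
  X count, because the states between two block updates range over images of \<Omega>.\<close>

definition has_strict_derivative_on ::
  "('a::euclidean_space \<Rightarrow> 'b::euclidean_space) \<Rightarrow> ('a \<Rightarrow> 'b) \<Rightarrow> 'a set \<Rightarrow> 'a \<Rightarrow> bool" where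
  "has_strict_derivative_on g T X a \<longleftrightarrow> linear T \<and>
     (\<forall>\<epsilon>>0. \<exists>U. open U \<and> a \<in> U \<and>
        (\<forall>z\<in>U \<inter> X. \<forall>z'\<in>U \<inter> X. norm (g z' - g z - T (z' - z)) \<le> \<epsilon> * norm (z' - z)))"

text \<open>Closeness is measured between the images, so the bound contains injectivity: equal
  images force z' = z. It says that the inverse is Lipschitz at each point of g(X), with constants
  depending on the point.\<close>

definition locally_inverse_lipschitz_on ::
  "('a::euclidean_space \<Rightarrow> 'b::euclidean_space) \<Rightarrow> 'a set \<Rightarrow> bool" where
  "locally_inverse_lipschitz_on g X \<longleftrightarrow>
     (\<forall>z\<in>X. \<exists>B. \<exists>\<delta>>0. \<forall>z'\<in>X. norm (g z' - g z) < \<delta> \<longrightarrow> norm (z' - z) \<le> B * norm (g z' - g z))"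

lemma linear_bound:
  fixes T :: "'a::euclidean_space \<Rightarrow> 'b::euclidean_space"
  assumes "linear T"
  obtains M where "M > 0" "\<And>x. norm (T x) \<le> M * norm x"
  using linear_bounded_pos[OF assms] by blast

section \<open>Composition rules and preimages of null sets\<close>

lemma has_strict_derivative_on_linear:
  "linear T \<Longrightarrow> (\<And>z z'. g z' - g z = T (z' - z)) \<Longrightarrow> has_strict_derivative_on g T X a"
  unfolding has_strict_derivative_on_def by (auto intro!: exI[of _ UNIV])

lemma has_strict_derivative_on_compose:
  assumes g: "has_strict_derivative_on g T X a" and h: "has_strict_derivative_on h S Y (g a)"
    and "a \<in> X" "g ` X \<subseteq> Y"
  shows "has_strict_derivative_on (h \<circ> g) (S \<circ> T) X a"
  unfolding has_strict_derivative_on_def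
proof (intro conjI allI impI)
  have lin: "linear T" "linear S" using g h by (auto simp: has_strict_derivative_on_def)
  then show "linear (S \<circ> T)" by (rule linear_compose)
  fix \<epsilon> :: real assume "\<epsilon> > 0"
  obtain M N where M: "M > 0" "\<And>x. norm (T x) \<le> M * norm x" and N: "N > 0" "\<And>x. norm (S x) \<le> N * norm x"
    using linear_bound lin by metis
  \<comment> \<open>The bound 1 makes g Lipschitz near a with constant M + 1; the other entry and
    \<open>\<epsilon>2\<close> each use half of \<epsilon>.\<close>
  define \<epsilon>1 where "\<epsilon>1 = min 1 (\<epsilon> / (2 * N))"
  define \<epsilon>2 where "\<epsilon>2 = \<epsilon> / (2 * (M + 1))"
  have \<epsilon>: "\<epsilon>1 > 0" "\<epsilon>2 > 0" "\<epsilon>1 \<le> 1" "N * \<epsilon>1 \<le> \<epsilon> / 2" "\<epsilon>2 * (M + 1) = \<epsilon> / 2"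
    using M(1) N(1) \<open>\<epsilon> > 0\<close> by (auto simp: \<epsilon>1_def \<epsilon>2_def min_def field_simps)
  obtain V where V: "open V" "g a \<in> V"
    and V': "\<And>w w'. w \<in> V \<inter> Y \<Longrightarrow> w' \<in> V \<inter> Y \<Longrightarrow> norm (h w' - h w - S (w' - w)) \<le> \<epsilon>2 * norm (w' - w)"
    using h \<epsilon> unfolding has_strict_derivative_on_def by metis
  obtain U where U: "open U" "a \<in> U"
    and U': "\<And>z z'. z \<in> U \<inter> X \<Longrightarrow> z' \<in> U \<inter> X \<Longrightarrow> norm (g z' - g z - T (z' - z)) \<le> \<epsilon>1 * norm (z' - z)"
    using g \<epsilon> unfolding has_strict_derivative_on_def by metis
  have lip: "norm (g z' - g z) \<le> (M + 1) * norm (z' - z)" if "z \<in> U \<inter> X" "z' \<in> U \<inter> X" for z z'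
  proof -
    have "norm (g z' - g z) \<le> norm (g z' - g z - T (z' - z)) + norm (T (z' - z))"
      using norm_triangle_ineq[of "g z' - g z - T (z' - z)" "T (z' - z)"] by simp
    also have "\<dots> \<le> 1 * norm (z' - z) + M * norm (z' - z)"
      using U'[OF that] M(2)[of "z' - z"] mult_right_mono[OF \<epsilon>(3), of "norm (z' - z)"] by simp
    finally show ?thesis by (simp add: algebra_simps)
  qed
  obtain r where r: "r > 0" "ball (g a) r \<subseteq> V" using V open_contains_ball by blast
  let ?U = "U \<inter> ball a (r / (M + 1))"
  have inV: "g z \<in> V \<inter> Y" if "z \<in> ?U \<inter> X" for z
  proof -
    have "norm (g z - g a) \<le> (M + 1) * norm (z - a)" using lip[of a z] that U(2) \<open>a \<in> X\<close> by auto
    also have "\<dots> < r" using that M(1) by (auto simp: dist_norm norm_minus_commute field_simps)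
    finally have "g z \<in> ball (g a) r" by (simp add: dist_norm norm_minus_commute)
    then show ?thesis using r(2) that \<open>g ` X \<subseteq> Y\<close> by auto
  qed
  have "norm ((h \<circ> g) z' - (h \<circ> g) z - (S \<circ> T) (z' - z)) \<le> \<epsilon> * norm (z' - z)"
    if z: "z \<in> ?U \<inter> X" "z' \<in> ?U \<inter> X" for z z'
  proof -
    have "(h \<circ> g) z' - (h \<circ> g) z - (S \<circ> T) (z' - z) =
      (h (g z') - h (g z) - S (g z' - g z)) + S (g z' - g z - T (z' - z))"
      by (simp add: linear_diff[OF lin(2)])
    also have "norm \<dots> \<le> \<epsilon>2 * norm (g z' - g z) + N * norm (g z' - g z - T (z' - z))"
      by (intro norm_triangle_mono V' inV z N)
    also have "\<dots> \<le> \<epsilon>2 * ((M + 1) * norm (z' - z)) + N * (\<epsilon>1 * norm (z' - z))"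
      using z \<epsilon> N by (intro add_mono mult_left_mono lip U') auto
    also have "\<dots> = (\<epsilon>2 * (M + 1) + N * \<epsilon>1) * norm (z' - z)" by (simp add: algebra_simps)
    also have "\<dots> \<le> \<epsilon> * norm (z' - z)" using \<epsilon> by (intro mult_right_mono) auto
    finally show ?thesis .
  qed
  then show "\<exists>U. open U \<and> a \<in> U \<and> (\<forall>z\<in>U \<inter> X. \<forall>z'\<in>U \<inter> X.
      norm ((h \<circ> g) z' - (h \<circ> g) z - (S \<circ> T) (z' - z)) \<le> \<epsilon> * norm (z' - z))"
    using U r M(1) by (intro exI[of _ ?U]) auto
qed

lemma locally_inverse_lipschitz_on_compose:
  assumes g: "locally_inverse_lipschitz_on g X" and h: "locally_inverse_lipschitz_on h (g ` X)"
  shows "locally_inverse_lipschitz_on (h \<circ> g) X"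
  unfolding locally_inverse_lipschitz_on_def
proof
  fix z assume "z \<in> X"
  obtain B1 \<delta>1 where 1: "\<delta>1 > 0" "\<And>z'. z' \<in> X \<Longrightarrow> norm (g z' - g z) < \<delta>1 \<Longrightarrow> norm (z' - z) \<le> B1 * norm (g z' - g z)"
    using g \<open>z \<in> X\<close> unfolding locally_inverse_lipschitz_on_def by blast
  have "g z \<in> g ` X" using \<open>z \<in> X\<close> by simp
  then obtain B2 \<delta>2 where 2: "\<delta>2 > 0"
    "\<And>z'. z' \<in> X \<Longrightarrow> norm (h (g z') - h (g z)) < \<delta>2 \<Longrightarrow> norm (g z' - g z) \<le> B2 * norm (h (g z') - h (g z))"
    using h unfolding locally_inverse_lipschitz_on_def by (metis imageI)
  define \<delta> where "\<delta> = min \<delta>2 (\<delta>1 / (\<bar>B2\<bar> + 1))"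
  have "norm (z' - z) \<le> \<bar>B1\<bar> * \<bar>B2\<bar> * norm (h (g z') - h (g z))"
    if "z' \<in> X" "norm (h (g z') - h (g z)) < \<delta>" for z'
  proof -
    let ?n = "norm (h (g z') - h (g z))"
    have "norm (g z' - g z) \<le> B2 * ?n" using 2(2) that by (simp add: \<delta>_def)
    also have "\<dots> \<le> \<bar>B2\<bar> * ?n" by (intro mult_right_mono) auto
    finally have a: "norm (g z' - g z) \<le> \<bar>B2\<bar> * ?n" .
    have "(\<bar>B2\<bar> + 1) * ?n < \<delta>1" using that(2) by (auto simp: \<delta>_def field_simps)
    then have "norm (g z' - g z) < \<delta>1" using a norm_ge_zero[of "h (g z') - h (g z)"] unfolding distrib_right by linarith
    then have "norm (z' - z) \<le> B1 * norm (g z' - g z)" using 1(2) that(1) by blast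
    also have "\<dots> \<le> \<bar>B1\<bar> * norm (g z' - g z)" by (intro mult_right_mono) auto
    also have "\<dots> \<le> \<bar>B1\<bar> * (\<bar>B2\<bar> * ?n)" using a by (intro mult_left_mono) auto
    finally show ?thesis by (simp add: mult.assoc)
  qed
  moreover have "\<delta> > 0" using 1 2 by (auto simp: \<delta>_def)
  ultimately show "\<exists>B. \<exists>\<delta>>0. \<forall>z'\<in>X. norm ((h \<circ> g) z' - (h \<circ> g) z) < \<delta> \<longrightarrow>
      norm (z' - z) \<le> B * norm ((h \<circ> g) z' - (h \<circ> g) z)"
    by (intro exI[of _ "\<bar>B1\<bar> * \<bar>B2\<bar>"] exI[of _ \<delta>]) auto
qed

text \<open>The preimage is the image of N \<inter> g(X) under the inverse, and a map that is
  Lipschitz at each point keeps null sets null.\<close>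

lemma negligible_preimage:
  fixes g :: "'a::euclidean_space \<Rightarrow> 'a"
  assumes g: "locally_inverse_lipschitz_on g X" and N: "negligible N"
  shows "negligible {z \<in> X. g z \<in> N}"
proof -
  have inj: "inj_on g X"
  proof (rule inj_onI)
    fix z z' assume "z \<in> X" "z' \<in> X" "g z = g z'"
    then have "norm (z' - z) \<le> 0"
      using g unfolding locally_inverse_lipschitz_on_def by fastforce
    then show "z = z'" by simp
  qed
  let ?S = "N \<inter> g ` X"
  have "negligible (the_inv_into X g ` ?S)"
  proof (rule negligible_locally_Lipschitz_image)
    show "negligible ?S" using N by (rule negligible_subset) auto
    fix x assume "x \<in> ?S"
    then obtain z where z: "z \<in> X" "x = g z" by auto
    then obtain B \<delta> where "\<delta> > 0" and
      *: "\<And>z'. z' \<in> X \<Longrightarrow> norm (g z' - g z) < \<delta> \<Longrightarrow> norm (z' - z) \<le> B * norm (g z' - g z)"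
      using g unfolding locally_inverse_lipschitz_on_def by blast
    then have "\<forall>y\<in>?S \<inter> ball x \<delta>. norm (the_inv_into X g y - the_inv_into X g x) \<le> B * norm (y - x)"
      using z inj by (auto simp: the_inv_into_f_f dist_norm norm_minus_commute)
    then show "\<exists>T B. open T \<and> x \<in> T \<and>
        (\<forall>y\<in>?S \<inter> T. norm (the_inv_into X g y - the_inv_into X g x) \<le> B * norm (y - x))"
      using \<open>\<delta> > 0\<close> by (intro exI[of _ "ball x \<delta>"] exI[of _ B]) auto
  qed simp
  then show ?thesis
    by (rule negligible_subset) (use inj in \<open>force simp: the_inv_into_f_f intro: rev_image_eqI\<close>)
qed

lemma negligible_funpow_preimage:
  fixes g :: "'a::euclidean_space \<Rightarrow> 'a"
  assumes g: "locally_inverse_lipschitz_on g X" "g ` X \<subseteq> X" and N: "negligible N"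
  shows "negligible {z \<in> X. (g ^^ k) z \<in> N}"
proof (induction k)
  case 0
  show ?case using N by (rule negligible_subset) auto
next
  case (Suc k)
  have "{z \<in> X. (g ^^ Suc k) z \<in> N} = {z \<in> X. g z \<in> {z \<in> X. (g ^^ k) z \<in> N}}"
    using g(2) by (auto simp del: funpow.simps simp: funpow_Suc_right)
  then show ?case using negligible_preimage[OF g(1) Suc] by simp
qed

text \<open>
  Two orbits that stay in a bounded set never differ by a vector on which the expanding form is
  nonnegative, because the form would grow geometrically along their difference. Hence the set is a
  Lipschitz graph over the orthogonal complement of the unstable eigenvector.
\<close>

lemma negligible_invariant_near_unstable:
  fixes T :: "'a::euclidean_space \<Rightarrow> 'a"
  assumes T: "linear T" and v: "T v = \<mu> *\<^sub>R v" "v \<noteq> 0" and \<mu>: "\<mu> > 1"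
  obtains \<epsilon> where "\<epsilon> > 0"
    "\<And>g W. bounded W \<Longrightarrow> g ` W \<subseteq> W \<Longrightarrow>
       (\<And>z z'. z \<in> W \<Longrightarrow> z' \<in> W \<Longrightarrow> norm (g z' - g z - T (z' - z)) \<le> \<epsilon> * norm (z' - z)) \<Longrightarrow>
       negligible W"
proof -
  \<comment> \<open>The factor c is placed between 1 and \<mu>^2: c > 1 gives geometric growth along
    differences of orbits, c < \<mu>^2 gives q v v > 0.\<close>
  have "1 < \<mu>\<^sup>2" using \<mu> by (simp add: one_less_power)
  then obtain q c \<delta> where q: "bounded_bilinear q" and c: "1 < c" "c < \<mu>\<^sup>2" and \<delta>: "\<delta> > 0"
    and exp: "\<And>x. c * q x x + \<delta> * (norm x)\<^sup>2 \<le> q (T x) (T x :: 'a)"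
    using expanding_quadratic_form[OF T] by metis
  interpret q: bounded_bilinear q by (rule q)
  obtain K where K: "K > 0" "\<And>x y. norm (q x y) \<le> norm x * norm y * K"
    using q.pos_bounded by blast
  obtain M where M: "M > 0" "\<And>x. norm (T x) \<le> M * norm x" using linear_bound[OF T] by blast
  define \<kappa> where "\<kappa> = q v v"
  have \<kappa>: "\<kappa> > 0"
  proof -
    have "\<delta> * (norm v)\<^sup>2 \<le> (\<mu>\<^sup>2 - c) * \<kappa>"
      using exp[of v] by (simp add: v(1) q.scaleR_left q.scaleR_right \<kappa>_def power2_eq_square algebra_simps)
    moreover have "\<delta> * (norm v)\<^sup>2 > 0" using \<delta> v(2) by simp
    ultimately have "(\<mu>\<^sup>2 - c) * \<kappa> > 0" by linarith
    then show ?thesis using c by (simp add: zero_less_mult_iff)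
  qed
  \<comment> \<open>Replacing T d by T d + r with |r| \<le> \<epsilon> |d| \<le> |d| changes q by at
    most L \<epsilon> |d|^2. The choice of \<epsilon> makes this at most half of the gain \<delta>
    |d|^2, and it depends on T alone, so the neighbourhood can be fitted to it later.\<close>
  define L where "L = K * (2 * M + 1)"
  define \<epsilon> where "\<epsilon> = min 1 (\<delta> / (2 * L))"
  have L: "L > 0" using K(1) M(1) by (simp add: L_def)
  have "L * \<epsilon> \<le> L * (\<delta> / (2 * L))" using L by (intro mult_left_mono) (auto simp: \<epsilon>_def)
  then have \<epsilon>: "\<epsilon> > 0" "\<epsilon> \<le> 1" "K * (2 * M + 1) * \<epsilon> \<le> \<delta> / 2"
    using L \<delta> by (auto simp: \<epsilon>_def L_def[symmetric])
  have grow: "c * q d d + \<delta> / 2 * (norm d)\<^sup>2 \<le> q e e" if "norm (e - T d) \<le> \<epsilon> * norm d" for d e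
  proof -
    define r where "r = e - T d"
    have r: "norm r \<le> \<epsilon> * norm d" using that by (simp add: r_def)
    have e: "e = T d + r" by (simp add: r_def)
    have r1: "norm r \<le> norm d" using r mult_right_mono[OF \<epsilon>(2), of "norm d"] by simp
    have "\<bar>q (T d) r\<bar> \<le> norm (T d) * norm r * K" "\<bar>q r (T d)\<bar> \<le> norm r * norm (T d) * K"
      "\<bar>q r r\<bar> \<le> norm r * norm r * K"
      using K(2)[of "T d" r] K(2)[of r "T d"] K(2)[of r r] by simp_all
    moreover have "norm (T d) * norm r \<le> (M * norm d) * (\<epsilon> * norm d)"
      using M r by (intro mult_mono) auto
    moreover have "norm r * norm r \<le> norm d * (\<epsilon> * norm d)" using r r1 by (intro mult_mono) auto
    ultimately have "\<bar>q (T d) r\<bar> \<le> (M * norm d) * (\<epsilon> * norm d) * K"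
      "\<bar>q r (T d)\<bar> \<le> (M * norm d) * (\<epsilon> * norm d) * K" "\<bar>q r r\<bar> \<le> norm d * (\<epsilon> * norm d) * K"
      using K(1) by (simp_all add: mult.commute[of "norm r" "norm (T d)"] order_trans[OF _ mult_right_mono])
    then have "q e e \<ge> q (T d) (T d) - (K * (2 * M + 1) * \<epsilon>) * (norm d)\<^sup>2"
      unfolding e by (simp add: q.add_left q.add_right power2_eq_square algebra_simps)
    moreover have "(K * (2 * M + 1) * \<epsilon>) * (norm d)\<^sup>2 \<le> \<delta> / 2 * (norm d)\<^sup>2"
      using \<epsilon>(3) by (intro mult_right_mono) auto
    ultimately show ?thesis using exp[of d] by simp
  qed
  have key: "negligible W"
    if W: "bounded W" "g ` W \<subseteq> W"
      and lin: "\<And>z z'. z \<in> W \<Longrightarrow> z' \<in> W \<Longrightarrow> norm (g z' - g z - T (z' - z)) \<le> \<epsilon> * norm (z' - z)"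
    for g W
  proof -
    obtain R where R: "\<And>x. x \<in> W \<Longrightarrow> norm x \<le> R" using W(1) by (auto simp: bounded_iff)
    have neg: "q (z' - z) (z' - z) < 0" if z: "z \<in> W" "z' \<in> W" "z \<noteq> z'" for z z'
    proof (rule ccontr)
      assume nn: "\<not> q (z' - z) (z' - z) < 0"
      define d where "d n = (g ^^ n) z' - (g ^^ n) z" for n
      have inW: "(g ^^ n) z \<in> W" "(g ^^ n) z' \<in> W" for n
        using z W(2) by (induction n) auto
      have step: "c * q (d n) (d n) + \<delta> / 2 * (norm (d n))\<^sup>2 \<le> q (d (Suc n)) (d (Suc n))" for n
        using lin[OF inW] by (intro grow) (simp add: d_def)
      have "0 < \<delta> / 2 * (norm (d 0))\<^sup>2" using z(3) \<delta> by (simp add: d_def)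
      moreover have "0 \<le> c * q (d 0) (d 0)" using nn c by (simp add: d_def)
      \<comment> \<open>The form may vanish at d 0; the term with \<delta> makes it positive after
        one step, and the geometric growth is counted from there.\<close>
      ultimately have pos: "q (d 1) (d 1) > 0" using step[of 0] by simp
      have pw: "c ^ n * q (d 1) (d 1) \<le> q (d (Suc n)) (d (Suc n))" for n
      proof (induction n)
        case (Suc n)
        have "c ^ Suc n * q (d 1) (d 1) \<le> c * q (d (Suc n)) (d (Suc n))" using Suc c by simp
        also have "\<dots> \<le> c * q (d (Suc n)) (d (Suc n)) + \<delta> / 2 * (norm (d (Suc n)))\<^sup>2" using \<delta> by simp
        finally show ?case using step[of "Suc n"] by linarith
      qed simp
      have dR: "norm (d n) \<le> 2 * R" for n
        using norm_triangle_ineq4[of "(g ^^ n) z'" "(g ^^ n) z"] R[OF inW(1)[of n]] R[OF inW(2)[of n]]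
        by (simp add: d_def)
      have "norm (d n) * norm (d n) * K \<le> (2 * R) * (2 * R) * K" for n
        using K(1) order_trans[OF norm_ge_zero dR] by (intro mult_right_mono mult_mono dR) auto
      then have "q (d n) (d n) \<le> (2 * R) * (2 * R) * K" for n
        using order_trans[OF order_trans[OF abs_ge_self K(2)[of "d n" "d n", unfolded real_norm_def]]] by blast
      then have "c ^ n \<le> (2 * R) * (2 * R) * K / q (d 1) (d 1)" for n
        using order_trans[OF pw[of n]] pos by (simp add: pos_le_divide_eq)
      then show False using real_arch_pow[OF c(1)] by (meson not_le)
    qed
    define s where "s d = (d \<bullet> v) / (v \<bullet> v)" for d
    define P where "P d = d - s d *\<^sub>R v" for d
    have P_diff: "P (x - y) = P x - P y" for x y
      by (simp add: P_def s_def inner_diff_left diff_divide_distrib algebra_simps)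
    \<comment> \<open>Write d = t v + p with p orthogonal to v. If q d d < 0, then \<kappa> t^2 is
      at most 2 K |v| |t| |p| + K |p|^2; half of \<kappa> t^2 absorbs the cross term, and C is what
      remains as a bound for t^2 / |p|^2.\<close>
    define C where "C = 2 / \<kappa> * ((K * norm v)\<^sup>2 / (\<kappa> / 2) + K)"
    have C: "C \<ge> 0" using K(1) \<kappa> by (simp add: C_def)
    have bd: "norm d \<le> (sqrt C * norm v + 1) * norm (P d)" if "q d d < 0" for d
    proof -
      let ?t = "s d" and ?p = "P d"
      have d: "d = ?t *\<^sub>R v + ?p" by (simp add: P_def)
      have "q d d = ?t\<^sup>2 * \<kappa> + ?t * (q v ?p + q ?p v) + q ?p ?p"
        by (subst (1 2) d) (simp add: q.add_left q.add_right q.scaleR_left q.scaleR_right \<kappa>_def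
            power2_eq_square algebra_simps)
      moreover have "\<bar>?t * (q v ?p + q ?p v)\<bar> \<le> \<bar>?t\<bar> * (2 * (norm v * norm ?p * K))"
        using K(2)[of v ?p] K(2)[of ?p v] unfolding abs_mult
        by (intro mult_left_mono) (auto simp: mult.commute)
      moreover have "\<bar>q ?p ?p\<bar> \<le> norm ?p * norm ?p * K" using K(2)[of ?p ?p] by simp
      ultimately have "?t\<^sup>2 * \<kappa> \<le> 2 * (K * norm v) * \<bar>?t\<bar> * norm ?p + K * (norm ?p)\<^sup>2"
        using that by (simp add: power2_eq_square algebra_simps abs_le_iff)
      also have "2 * (K * norm v) * \<bar>?t\<bar> * norm ?p \<le> (\<kappa> / 2) * \<bar>?t\<bar>\<^sup>2 + (K * norm v)\<^sup>2 / (\<kappa> / 2) * (norm ?p)\<^sup>2"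
        using weighted_product_le[of "\<kappa> / 2" "K * norm v" "\<bar>?t\<bar>" "norm ?p"] \<kappa> by simp
      finally have "\<kappa> / 2 * ?t\<^sup>2 \<le> ((K * norm v)\<^sup>2 / (\<kappa> / 2) + K) * (norm ?p)\<^sup>2"
        by (simp add: algebra_simps power_mult_distrib)
      then have "2 / \<kappa> * (\<kappa> / 2 * ?t\<^sup>2) \<le> 2 / \<kappa> * (((K * norm v)\<^sup>2 / (\<kappa> / 2) + K) * (norm ?p)\<^sup>2)"
        using \<kappa> by (intro mult_left_mono) auto
      moreover have "2 / \<kappa> * (\<kappa> / 2 * ?t\<^sup>2) = ?t\<^sup>2" using \<kappa> by simp
      ultimately have "?t\<^sup>2 \<le> C * (norm ?p)\<^sup>2" unfolding C_def by (simp only: mult.assoc)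
      then have "sqrt (?t\<^sup>2) \<le> sqrt (C * (norm ?p)\<^sup>2)" by (rule real_sqrt_le_mono)
      then have t: "\<bar>?t\<bar> \<le> sqrt C * norm ?p" by (simp add: real_sqrt_mult)
      have "norm d \<le> \<bar>?t\<bar> * norm v + norm ?p"
        using norm_triangle_ineq[of "?t *\<^sub>R v" ?p] by (simp flip: d)
      also have "\<dots> \<le> (sqrt C * norm ?p) * norm v + norm ?p" using t by (intro add_mono mult_right_mono) auto
      finally show ?thesis by (simp add: algebra_simps)
    qed
    define B where "B = sqrt C * norm v + 1"
    have lip: "norm (z' - z) \<le> B * norm (P z' - P z)" if "z \<in> W" "z' \<in> W" for z z'
      using bd[OF neg[OF that]] by (cases "z = z'") (auto simp: B_def P_diff)
    have inj: "inj_on P W"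
    proof (rule inj_onI)
      fix z z' assume "z \<in> W" "z' \<in> W" "P z = P z'"
      then show "z = z'" using lip[of z z'] by simp
    qed
    have "negligible (the_inv_into W P ` P ` W)"
    proof (rule negligible_locally_Lipschitz_image)
      have "P ` W \<subseteq> {x. v \<bullet> x = 0}"
        using v(2) by (auto simp: P_def s_def inner_diff_right inner_commute)
      then show "negligible (P ` W)" by (rule negligible_subset[rotated]) (simp add: negligible_hyperplane v(2))
      fix x assume "x \<in> P ` W"
      then show "\<exists>U B. open U \<and> x \<in> U \<and>
          (\<forall>y\<in>P ` W \<inter> U. norm (the_inv_into W P y - the_inv_into W P x) \<le> B * norm (y - x))"
        using lip inj by (intro exI[of _ UNIV] exI[of _ B]) (auto simp: the_inv_into_f_f)
    qed simp
    then show ?thesis using inj by (simp add: the_inv_into_onto)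
  qed
  show ?thesis by (rule that[OF \<epsilon>(1)]) (rule key)
qed

lemma negligible_convergence_to_unstable:
  fixes g :: "'a::euclidean_space \<Rightarrow> 'a"
  assumes g: "locally_inverse_lipschitz_on g X" "g ` X \<subseteq> X"
    and A: "\<And>z. z \<in> A \<Longrightarrow> \<exists>T v \<mu>. has_strict_derivative_on g T X z \<and> v \<noteq> 0 \<and> T v = \<mu> *\<^sub>R v \<and> \<mu> > 1"
  shows "negligible {z0 \<in> X. \<exists>z\<in>A. (\<lambda>k. (g ^^ k) z0) \<longlonglongrightarrow> z}"
proof -
  \<comment> \<open>The part of X whose whole forward orbit stays in U. It is forward invariant, and
    an orbit converging to a point of an open U enters it after finitely many steps.\<close>
  define W where "W U = {x \<in> X. \<forall>n. (g ^^ n) x \<in> U}" for U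
  have "\<exists>U. open U \<and> z \<in> U \<and> negligible (W U)" if "z \<in> A" for z
  proof -
    obtain T v \<mu> where T: "has_strict_derivative_on g T X z" "v \<noteq> 0" "T v = \<mu> *\<^sub>R v" "\<mu> > 1"
      using A[OF \<open>z \<in> A\<close>] by blast
    then have "linear T" by (simp add: has_strict_derivative_on_def)
    then obtain \<epsilon> where "\<epsilon> > 0" and \<epsilon>:
      "\<And>W. bounded W \<Longrightarrow> g ` W \<subseteq> W \<Longrightarrow>
       (\<And>z z'. z \<in> W \<Longrightarrow> z' \<in> W \<Longrightarrow> norm (g z' - g z - T (z' - z)) \<le> \<epsilon> * norm (z' - z)) \<Longrightarrow>
       negligible W"
      using negligible_invariant_near_unstable T by metis
    then obtain U where U: "open U" "z \<in> U"
      "\<And>z z'. z \<in> U \<inter> X \<Longrightarrow> z' \<in> U \<inter> X \<Longrightarrow> norm (g z' - g z - T (z' - z)) \<le> \<epsilon> * norm (z' - z)"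
      using T(1) unfolding has_strict_derivative_on_def by metis
    let ?U = "U \<inter> ball z 1"
    have sub: "W ?U \<subseteq> ?U \<inter> X" by (auto simp: W_def dest: spec[of _ 0])
    have "negligible (W ?U)"
    proof (rule \<epsilon>)
      show "bounded (W ?U)" by (rule bounded_subset[OF bounded_ball[of z 1]]) (use sub in auto)
      show "g ` W ?U \<subseteq> W ?U"
      proof safe
        fix x assume x: "x \<in> W ?U"
        have "(g ^^ n) (g x) = (g ^^ Suc n) x" for n by (simp add: funpow_swap1)
        then show "g x \<in> W ?U" using x g(2) unfolding W_def by (auto simp del: funpow.simps)
      qed
      fix y y' assume "y \<in> W ?U" "y' \<in> W ?U"
      then show "norm (g y' - g y - T (y' - y)) \<le> \<epsilon> * norm (y' - y)"
        using sub by (intro U(3)) auto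
    qed
    then show ?thesis using U by (intro exI[of _ ?U]) auto
  qed
  then obtain U where U: "\<And>z. z \<in> A \<Longrightarrow> open (U z) \<and> z \<in> U z \<and> negligible (W (U z))" by metis
  obtain \<F> where \<F>: "\<F> \<subseteq> U ` A" "countable \<F>" "\<Union>\<F> = \<Union>(U ` A)"
    by (rule Lindelof[of "U ` A"]) (use U in auto)
  have "negligible (\<Union>k. \<Union>V\<in>\<F>. {z \<in> X. (g ^^ k) z \<in> W V})"
    using \<F> U by (intro negligible_countable_Union countable_image)
      (auto intro!: negligible_countable_Union negligible_funpow_preimage g)
  moreover have "{z0 \<in> X. \<exists>z\<in>A. (\<lambda>k. (g ^^ k) z0) \<longlonglongrightarrow> z} \<subseteq> (\<Union>k. \<Union>V\<in>\<F>. {z \<in> X. (g ^^ k) z \<in> W V})"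
  proof clarify
    fix z0 z assume z: "z0 \<in> X" "z \<in> A" "(\<lambda>k. (g ^^ k) z0) \<longlonglongrightarrow> z"
    have "z \<in> \<Union>\<F>" unfolding \<F>(3) using U[OF z(2)] z(2) by blast
    then obtain V where V: "V \<in> \<F>" "z \<in> V" by blast
    then have "open V" using \<F> U by auto
    then have "\<forall>\<^sub>F k in sequentially. (g ^^ k) z0 \<in> V" using z V topological_tendstoD by blast
    then obtain N where N: "\<And>k. k \<ge> N \<Longrightarrow> (g ^^ k) z0 \<in> V" by (auto simp: eventually_sequentially)
    have "(g ^^ N) z0 \<in> X" using z(1) g(2) by (induction N) auto
    moreover have "(g ^^ n) ((g ^^ N) z0) \<in> V" for n
      using N[of "n + N"] by (simp add: funpow_add)
    ultimately have "(g ^^ N) z0 \<in> W V" by (auto simp: W_def)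
    then show "z0 \<in> (\<Union>k. \<Union>V\<in>\<F>. {z \<in> X. (g ^^ k) z \<in> W V})" using V z by auto
  qed
  ultimately show ?thesis by (rule negligible_subset)
qed

section \<open>A single block update\<close>

lemma has_derivative_imp_locally_lipschitz_at:
  fixes f :: "'a::euclidean_space \<Rightarrow> 'b::euclidean_space"
  assumes "(f has_derivative f') (at a)"
  obtains B \<delta> where "B > 0" "\<delta> > 0" "\<And>x. norm (x - a) < \<delta> \<Longrightarrow> norm (f x - f a) \<le> B * norm (x - a)"
proof -
  have "linear f'" using assms has_derivative_linear by blast
  then obtain M where M: "M > 0" "\<And>x. norm (f' x) \<le> M * norm x" using linear_bound by blast
  obtain \<delta> where \<delta>: "\<delta> > 0" "\<And>y. norm (y - a) < \<delta> \<Longrightarrow> norm (f y - f a - f' (y - a)) \<le> 1 * norm (y - a)"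
    using assms unfolding has_derivative_at_alt by (meson zero_less_one)
  have "norm (f y - f a) \<le> (M + 1) * norm (y - a)" if "norm (y - a) < \<delta>" for y
  proof -
    have "norm (f y - f a) \<le> norm (f y - f a - f' (y - a)) + norm (f' (y - a))"
      using norm_triangle_ineq[of "f y - f a - f' (y - a)" "f' (y - a)"] by simp
    then show ?thesis using \<delta>(2)[OF that] M(2)[of "y - a"] unfolding distrib_right by linarith
  qed
  then show ?thesis using that[of "M + 1" \<delta>] \<delta> M by simp
qed

text \<open>Continuity along the finitely many basis directions gives continuity of the derivative
  in operator norm. The mean value inequality for G - G' a on a small ball then bounds the error
  uniformly in both points.\<close>

lemma C1_imp_has_strict_derivative:
  fixes G :: "'a::euclidean_space \<Rightarrow> 'b::euclidean_space"
  assumes X: "open X" "a \<in> X"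
    and G: "\<And>x. x \<in> X \<Longrightarrow> (G has_derivative G' x) (at x)"
    and cont: "\<And>d. continuous_on X (\<lambda>x. G' x d)"
  shows "has_strict_derivative_on G (G' a) UNIV a"
  unfolding has_strict_derivative_on_def
proof (intro conjI allI impI)
  have lin: "linear (G' x)" if "x \<in> X" for x using G[OF that] has_derivative_linear by blast
  show "linear (G' a)" using lin X by blast
  fix \<epsilon> :: real assume "\<epsilon> > 0"
  define \<epsilon>' where "\<epsilon>' = \<epsilon> / real DIM('a)"
  have \<epsilon>': "\<epsilon>' > 0" using \<open>\<epsilon> > 0\<close> by (simp add: \<epsilon>'_def)
  have "\<forall>\<^sub>F x in nhds a. \<forall>b\<in>Basis. norm (G' x b - G' a b) < \<epsilon>'"
  proof (intro eventually_ball_finite ballI finite_Basis)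
    fix b :: 'a
    have "isCont (\<lambda>x. G' x b) a"
      using cont[of b] X continuous_on_eq_continuous_at by blast
    then have "((\<lambda>x. G' x b) \<longlongrightarrow> G' a b) (nhds a)"
      using tendsto_at_iff_tendsto_nhds[of "\<lambda>x. G' x b" a] by (simp add: isCont_def)
    from tendstoD[OF this \<epsilon>'] show "\<forall>\<^sub>F x in nhds a. norm (G' x b - G' a b) < \<epsilon>'"
      by (simp add: dist_norm)
  qed
  moreover have "\<forall>\<^sub>F x in nhds a. x \<in> X" using X eventually_nhds by blast
  ultimately have "\<forall>\<^sub>F x in nhds a. x \<in> X \<and> (\<forall>b\<in>Basis. norm (G' x b - G' a b) < \<epsilon>')"
    by eventually_elim simp
  then obtain r where r: "r > 0" "\<And>x. dist x a < r \<Longrightarrow> x \<in> X \<and> (\<forall>b\<in>Basis. norm (G' x b - G' a b) < \<epsilon>')"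
    unfolding eventually_nhds_metric by blast
  have on: "onorm (\<lambda>d. G' x d - G' a d) \<le> \<epsilon>" if "x \<in> ball a r" for x
  proof (rule onorm_bound)
    have x: "x \<in> X" "\<And>b. b \<in> Basis \<Longrightarrow> norm (G' x b - G' a b) < \<epsilon>'"
      using r(2)[of x] that by (auto simp: dist_commute)
    fix d :: 'a
    let ?D = "\<lambda>d. G' x d - G' a d"
    have lD: "linear ?D" by (intro linear_compose_sub lin x X)
    have "?D d = ?D (\<Sum>b\<in>Basis. (d \<bullet> b) *\<^sub>R b)" by (simp add: euclidean_representation)
    also have "\<dots> = (\<Sum>b\<in>Basis. (d \<bullet> b) *\<^sub>R ?D b)"
      by (simp only: linear_sum[OF lD] linear_scale[OF lD])
    finally have "?D d = (\<Sum>b\<in>Basis. (d \<bullet> b) *\<^sub>R ?D b)" .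
    then have "norm (?D d) \<le> (\<Sum>b\<in>Basis. norm ((d \<bullet> b) *\<^sub>R ?D b))"
      using norm_sum[of "\<lambda>b. (d \<bullet> b) *\<^sub>R ?D b" Basis] by (simp only:)
    also have "\<dots> \<le> (\<Sum>b\<in>(Basis::'a set). norm d * \<epsilon>')"
      unfolding norm_scaleR by (intro sum_mono mult_mono less_imp_le[OF x(2)]) (auto simp: Basis_le_norm)
    also have "\<dots> = \<epsilon> * norm d" by (simp add: \<epsilon>'_def)
    finally show "norm (?D d) \<le> \<epsilon> * norm d" .
  qed (use \<open>\<epsilon> > 0\<close> in simp)
  have "norm (G z' - G z - G' a (z' - z)) \<le> \<epsilon> * norm (z' - z)" if "z \<in> ball a r" "z' \<in> ball a r" for z z'
  proof -
    have "norm ((G z' - G' a z') - (G z - G' a z)) \<le> \<epsilon> * norm (z' - z)"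
    proof (rule differentiable_bound[OF convex_ball _ on])
      fix x assume "x \<in> ball a r"
      then have "x \<in> X" using r by (auto simp: dist_commute)
      have "(G' a has_derivative G' a) (at x)"
        using lin[OF X(2)] by (simp add: linear_imp_has_derivative)
      then show "((\<lambda>z. G z - G' a z) has_derivative (\<lambda>d. G' x d - G' a d)) (at x within ball a r)"
        using G[OF \<open>x \<in> X\<close>] by (rule has_derivative_at_withinI[OF has_derivative_diff, rotated])
    qed (use that in auto)
    then show ?thesis using lin[OF X(2)] by (simp add: linear_diff algebra_simps)
  qed
  then show "\<exists>U. open U \<and> a \<in> U \<and> (\<forall>z\<in>U \<inter> UNIV. \<forall>z'\<in>U \<inter> UNIV.
      norm (G z' - G z - G' a (z' - z)) \<le> \<epsilon> * norm (z' - z))"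
    using r(1) by (intro exI[of _ "ball a r"]) auto
qed

text \<open>Mean value theorem for the scalar function G(s + t d) \<bullet> d on the segment.
  Coercivity enters only in the direction s' - s, so the lemma applies to moves within one
  block.\<close>

lemma coercive_derivative_imp_strongly_monotone:
  fixes G :: "'a::euclidean_space \<Rightarrow> 'a"
  assumes X: "convex X" and s: "s \<in> X" "s' \<in> X"
    and G: "\<And>x. x \<in> X \<Longrightarrow> (G has_derivative G' x) (at x)"
    and m: "\<And>x. x \<in> X \<Longrightarrow> m * (norm (s' - s))\<^sup>2 \<le> G' x (s' - s) \<bullet> (s' - s)"
  shows "m * (norm (s' - s))\<^sup>2 \<le> (G s' - G s) \<bullet> (s' - s)"
proof -
  let ?d = "s' - s"
  have inX: "s + t *\<^sub>R ?d \<in> X" if "0 \<le> t" "t \<le> 1" for t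
    using convexD_alt[OF X s that] by (simp add: algebra_simps)
  have der: "((\<lambda>t. G (s + t *\<^sub>R ?d) \<bullet> ?d) has_derivative (\<lambda>h. G' (s + t *\<^sub>R ?d) (h *\<^sub>R ?d) \<bullet> ?d)) (at t within {0..1})"
    if "0 \<le> t" "t \<le> 1" for t
  proof -
    have "((\<lambda>t. s + t *\<^sub>R ?d) has_derivative (\<lambda>h. h *\<^sub>R ?d)) (at t within {0..1})"
      by (auto intro!: derivative_eq_intros)
    from has_derivative_compose[OF this G[OF inX[OF that]]]
    have *: "((\<lambda>t. G (s + t *\<^sub>R ?d)) has_derivative (\<lambda>h. G' (s + t *\<^sub>R ?d) (h *\<^sub>R ?d))) (at t within {0..1})" .
    show ?thesis by (rule has_derivative_inner_left[OF *])
  qed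
  obtain t where t: "t \<in> {0..1}"
      "G (s + 1 *\<^sub>R ?d) \<bullet> ?d - G (s + 0 *\<^sub>R ?d) \<bullet> ?d = G' (s + t *\<^sub>R ?d) ((1 - 0) *\<^sub>R ?d) \<bullet> ?d"
    using mvt_very_simple[of 0 1 "\<lambda>t. G (s + t *\<^sub>R ?d) \<bullet> ?d", OF _ der] by auto
  then show ?thesis using m[OF inX[of t]] by (simp add: inner_diff_left)
qed

text \<open>One template for the x-updates and the y-updates. \<open>proj\<close> is the orthogonal
  projection onto the block that moves. Coercivity is available only within a block, because
  convexity and smoothness hold in x and in y separately; one constant m serves both maps.\<close>

locale block_step =
  fixes X :: "'s::euclidean_space set" and \<Theta> \<Psi> :: "'s \<Rightarrow> 's" and \<Theta>' \<Psi>' :: "'s \<Rightarrow> 's \<Rightarrow> 's"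
    and proj :: "'s \<Rightarrow> 's" and m :: real
  assumes X: "open X" "convex X"
    and linear_proj: "linear proj" and proj_proj: "proj (proj d) = proj d"
    and proj_selfadjoint: "proj d \<bullet> e = d \<bullet> proj e"
    and \<Theta>: "s \<in> X \<Longrightarrow> (\<Theta> has_derivative \<Theta>' s) (at s)"
    and \<Psi>: "s \<in> X \<Longrightarrow> (\<Psi> has_derivative \<Psi>' s) (at s)"
    and \<Theta>_cont: "continuous_on X (\<lambda>s. \<Theta>' s d)"
    and \<Psi>_cont: "continuous_on X (\<lambda>s. \<Psi>' s d)"
    and m: "m > 0"
    and \<Theta>_coercive: "s \<in> X \<Longrightarrow> proj d = d \<Longrightarrow> m * (norm d)\<^sup>2 \<le> \<Theta>' s d \<bullet> d"
    and \<Psi>_coercive: "s \<in> X \<Longrightarrow> proj d = d \<Longrightarrow> m * (norm d)\<^sup>2 \<le> \<Psi>' s d \<bullet> d"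
begin

section \<open>Inverse, fixed points and linearization of a block update\<close>

definition step_rel :: "'s \<Rightarrow> 's \<Rightarrow> bool" where
  "step_rel s t \<longleftrightarrow> s \<in> X \<and> t \<in> X \<and> proj (t - s) = t - s \<and> proj (\<Psi> t) = proj (\<Theta> s)"

lemma inner_proj_eq: "proj a = proj b \<Longrightarrow> proj e = e \<Longrightarrow> a \<bullet> e = b \<bullet> e"
  by (metis proj_selfadjoint)

lemma \<Psi>_monotone:
  "s \<in> X \<Longrightarrow> t \<in> X \<Longrightarrow> proj (t - s) = t - s \<Longrightarrow> m * (norm (t - s))\<^sup>2 \<le> (\<Psi> t - \<Psi> s) \<bullet> (t - s)"
  by (rule coercive_derivative_imp_strongly_monotone[OF X(2) _ _ \<Psi>]) (auto intro: \<Psi>_coercive)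

lemma \<Theta>_monotone:
  "s \<in> X \<Longrightarrow> t \<in> X \<Longrightarrow> proj (t - s) = t - s \<Longrightarrow> m * (norm (t - s))\<^sup>2 \<le> (\<Theta> t - \<Theta> s) \<bullet> (t - s)"
  by (rule coercive_derivative_imp_strongly_monotone[OF X(2) _ _ \<Theta>]) (auto intro: \<Theta>_coercive)

lemma norm_le_if_coercive:
  assumes "m * (norm e)\<^sup>2 \<le> a \<bullet> e"
  shows "norm e \<le> norm a / m"
proof (cases "e = 0")
  case False
  have "m * norm e * norm e \<le> norm a * norm e"
    using assms norm_cauchy_schwarz[of a e] by (simp add: power2_eq_square)
  then show ?thesis using False m by (simp add: field_simps)
qed (use m in simp)

text \<open>The outputs determine the inputs: outside the block they agree with them, and inside it
  the block equation recovers the input from \<Theta>, which is strongly monotone there.\<close>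

lemma locally_inverse_lipschitz_on_step:
  assumes F: "\<And>s. s \<in> Y \<Longrightarrow> step_rel s (F s)"
  shows "locally_inverse_lipschitz_on F Y"
  unfolding locally_inverse_lipschitz_on_def
proof
  fix s assume "s \<in> Y"
  then have s: "s \<in> X" "F s \<in> X" "proj (F s - s) = F s - s" "proj (\<Psi> (F s)) = proj (\<Theta> s)"
    using F by (auto simp: step_rel_def)
  obtain B1 \<delta>1 where 1: "\<delta>1 > 0" "B1 > 0" "\<And>x. norm (x - F s) < \<delta>1 \<Longrightarrow> norm (\<Psi> x - \<Psi> (F s)) \<le> B1 * norm (x - F s)"
    using has_derivative_imp_locally_lipschitz_at[OF \<Psi>[OF s(2)]] by blast
  obtain B2 \<delta>2 where 2: "\<delta>2 > 0" "B2 > 0" "\<And>x. norm (x - s) < \<delta>2 \<Longrightarrow> norm (\<Theta> x - \<Theta> s) \<le> B2 * norm (x - s)"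
    using has_derivative_imp_locally_lipschitz_at[OF \<Theta>[OF s(1)]] by blast
  obtain r where r: "r > 0" "ball s r \<subseteq> X" using X s open_contains_ball by blast
  define \<delta> where "\<delta> = min r (min \<delta>1 \<delta>2)"
  have "norm (t - s) \<le> ((B1 + B2) / m + 1) * norm (F t - F s)" if t: "t \<in> Y" "norm (F t - F s) < \<delta>" for t
  proof -
    have t': "t \<in> X" "F t \<in> X" "proj (F t - t) = F t - t" "proj (\<Psi> (F t)) = proj (\<Theta> t)"
      using F[OF t(1)] by (auto simp: step_rel_def)
    \<comment> \<open>Shifting s by the change of the outputs makes t - p a difference of two
      updates, hence a vector of the block, to which monotonicity of \<Theta> applies. The radius r
      in \<delta> keeps p in X.\<close>
    define p where "p = s + (F t - F s)"
    define e where "e = t - p"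
    have "dist s p < r" using t by (simp add: p_def \<delta>_def dist_norm norm_minus_commute)
    then have "p \<in> X" using r by auto
    have "e = (F s - s) - (F t - t)" by (simp add: e_def p_def)
    then have pe: "proj e = e" using s t' linear_proj by (simp add: linear_diff)
    have "m * (norm e)\<^sup>2 \<le> (\<Theta> t - \<Theta> p) \<bullet> e"
      using \<Theta>_monotone[OF \<open>p \<in> X\<close> t'(1)] pe by (simp add: e_def)
    also have "\<dots> = ((\<Psi> (F t) - \<Psi> (F s)) - (\<Theta> p - \<Theta> s)) \<bullet> e"
      using inner_proj_eq[OF t'(4) pe] inner_proj_eq[OF s(4) pe] by (simp add: inner_diff_left)
    finally have "norm e \<le> norm ((\<Psi> (F t) - \<Psi> (F s)) - (\<Theta> p - \<Theta> s)) / m" by (rule norm_le_if_coercive)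
    also have "\<dots> \<le> (B1 * norm (F t - F s) + B2 * norm (F t - F s)) / m"
    proof -
      have "norm (\<Theta> p - \<Theta> s) \<le> B2 * norm (p - s)" by (rule 2(3)) (use t in \<open>simp add: p_def \<delta>_def\<close>)
      moreover have "norm (\<Psi> (F t) - \<Psi> (F s)) \<le> B1 * norm (F t - F s)" by (rule 1(3)) (use t in \<open>simp add: \<delta>_def\<close>)
      ultimately show ?thesis using m norm_triangle_ineq4[of "\<Psi> (F t) - \<Psi> (F s)" "\<Theta> p - \<Theta> s"]
        by (intro divide_right_mono) (auto simp: p_def)
    qed
    finally have "norm e \<le> (B1 + B2) / m * norm (F t - F s)" by (simp add: algebra_simps add_divide_distrib)
    moreover have "t - s = e + (F t - F s)" by (simp add: e_def p_def)
    ultimately show ?thesis using norm_triangle_ineq[of e "F t - F s"] unfolding distrib_right by simp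
  qed
  moreover have "\<delta> > 0" using 1 2 r by (simp add: \<delta>_def)
  ultimately show "\<exists>B. \<exists>\<delta>>0. \<forall>t\<in>Y. norm (F t - F s) < \<delta> \<longrightarrow> norm (t - s) \<le> B * norm (F t - F s)"
    by blast
qed

text \<open>Coercivity makes the linearized block equation uniquely solvable. The last property is
  how T is evaluated later: a vector that satisfies the equation is the value.\<close>

lemma linearized_step:
  assumes "z \<in> X"
  obtains T where "linear T" "\<And>v. proj (T v - v) = T v - v" "\<And>v. proj (\<Psi>' z (T v)) = proj (\<Theta>' z v)"
    "\<And>v v'. proj (v' - v) = v' - v \<Longrightarrow> proj (\<Psi>' z v') = proj (\<Theta>' z v) \<Longrightarrow> T v = v'"
proof -
  have lin: "linear (\<Psi>' z)" "linear (\<Theta>' z)" using \<Theta> \<Psi> assms has_derivative_linear by blast+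
  note lin = lin linear_proj
  have inj0: "e = 0" if "proj e = e" "proj (\<Psi>' z e) = 0" for e
  proof -
    have "\<Psi>' z e \<bullet> e = 0" using that proj_selfadjoint[of "\<Psi>' z e" e] by simp
    then show ?thesis using \<Psi>_coercive[OF assms that(1)] m by (simp add: mult_le_0_iff)
  qed
  \<comment> \<open>The derivative of \<Psi> compressed to the block, completed by the identity on
    the orthogonal complement so that it can be inverted on the whole space.\<close>
  define A where "A e = proj (\<Psi>' z (proj e)) + (e - proj e)" for e
  have "linear A"
    by (rule linearI) (simp_all add: A_def linear_add[OF lin(1)] linear_add[OF lin(3)] linear_scale[OF lin(1)]
      linear_scale[OF lin(3)] algebra_simps)
  moreover have A_compl: "A e - proj (A e) = e - proj e" for e
    by (simp add: A_def linear_add[OF lin(3)] linear_diff[OF lin(3)] proj_proj)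
  have "inj A"
  proof (subst linear_injective_0[OF \<open>linear A\<close>], intro allI impI)
    fix e assume "A e = 0"
    then have "proj e = e" using A_compl[of e] by (simp add: linear_0[OF lin(3)])
    then show "e = 0" using \<open>A e = 0\<close> inj0 by (simp add: A_def)
  qed
  ultimately obtain B where B: "linear B" "\<And>x. A (B x) = x"
    using linear_surjective_right_inverse[of A] linear_injective_imp_surjective[of A]
    by (metis comp_apply id_apply)
  define T where "T v = v + B (proj (\<Theta>' z v - \<Psi>' z v))" for v
  have e: "proj (T v - v) = T v - v" "proj (\<Psi>' z (T v - v)) = proj (\<Theta>' z v - \<Psi>' z v)" for v
  proof -
    let ?w = "proj (\<Theta>' z v - \<Psi>' z v)"
    have "A (T v - v) = ?w" by (simp add: T_def B(2))
    moreover show "proj (T v - v) = T v - v"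
      using A_compl[of "T v - v"] by (simp add: \<open>A (T v - v) = ?w\<close> proj_proj)
    ultimately show "proj (\<Psi>' z (T v - v)) = ?w" by (simp add: A_def)
  qed
  have T2: "proj (\<Psi>' z (T v)) = proj (\<Theta>' z v)" for v
    using e(2)[of v] by (simp add: linear_diff[OF lin(1)] linear_diff[OF lin(3)])
  show ?thesis
  proof (rule that)
    show "linear T" unfolding T_def
      by (rule linearI) (simp_all add: linear_add[OF lin(1)] linear_add[OF lin(2)] linear_add[OF lin(3)]
        linear_add[OF B(1)] linear_diff[OF lin(3)] linear_diff[OF B(1)] linear_scale[OF lin(1)]
        linear_scale[OF lin(2)] linear_scale[OF lin(3)] linear_scale[OF B(1)] algebra_simps)
    show "T v = v'" if "proj (v' - v) = v' - v" "proj (\<Psi>' z v') = proj (\<Theta>' z v)" for v v'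
    proof -
      have "T v - v' = (T v - v) - (v' - v)" by simp
      then have "proj (T v - v') = T v - v'" using that(1) e(1)[of v] by (simp only: linear_diff[OF lin(3)])
      moreover have "proj (\<Psi>' z (T v - v')) = 0"
        using that(2) T2[of v] by (simp add: linear_diff[OF lin(1)] linear_diff[OF lin(3)])
      ultimately have "T v - v' = 0" by (rule inj0)
      then show ?thesis by simp
    qed
  qed (use e T2 in auto)
qed

text \<open>Continuity of the update at z: monotonicity of \<Psi> bounds the move by the block
  residual of \<Theta> - \<Psi> at s, and this residual vanishes at z.\<close>

lemma step_near_fixed_point:
  assumes z: "z \<in> X" "proj (\<Psi> z) = proj (\<Theta> z)" and t: "step_rel s t"
  shows "norm (t - s) \<le> (norm (\<Theta> s - \<Theta> z) + norm (\<Psi> s - \<Psi> z)) / m"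
proof -
  let ?e = "t - s"
  have s: "s \<in> X" "t \<in> X" "proj ?e = ?e" "proj (\<Psi> t) = proj (\<Theta> s)"
    using t by (auto simp: step_rel_def)
  have "m * (norm ?e)\<^sup>2 \<le> (\<Psi> t - \<Psi> s) \<bullet> ?e" by (rule \<Psi>_monotone[OF s(1-3)])
  also have "\<dots> = ((\<Theta> s - \<Theta> z) - (\<Psi> s - \<Psi> z)) \<bullet> ?e"
    using inner_proj_eq[OF s(4,3)] inner_proj_eq[OF z(2) s(3)] by (simp only: inner_diff_left)
  finally have "norm ?e \<le> norm ((\<Theta> s - \<Theta> z) - (\<Psi> s - \<Psi> z)) / m" by (rule norm_le_if_coercive)
  also have "\<dots> \<le> (norm (\<Theta> s - \<Theta> z) + norm (\<Psi> s - \<Psi> z)) / m"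
    using m norm_triangle_ineq4 by (intro divide_right_mono) auto
  finally show ?thesis .
qed

lemma step_at_fixed_point:
  assumes "z \<in> X" "proj (\<Psi> z) = proj (\<Theta> z)" "step_rel z t"
  shows "t = z"
  using step_near_fixed_point[OF assms] by simp

text \<open>Subtract the block equations of two updates. The deviation of F t - F s from T (t - s)
  lies in the block, where coercivity of \<open>\<Psi>' z\<close> bounds it by the linearization
  errors of \<Psi> and \<Theta>.\<close>

lemma has_strict_derivative_on_step:
  assumes F: "\<And>s. s \<in> Y \<Longrightarrow> step_rel s (F s)"
    and z: "z \<in> X" "proj (\<Psi> z) = proj (\<Theta> z)"
  obtains T where "has_strict_derivative_on F T Y z"
    "\<And>v v'. proj (v' - v) = v' - v \<Longrightarrow> proj (\<Psi>' z v') = proj (\<Theta>' z v) \<Longrightarrow> T v = v'"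
proof -
  obtain T where T: "linear T" "\<And>v. proj (T v - v) = T v - v" "\<And>v. proj (\<Psi>' z (T v)) = proj (\<Theta>' z v)"
    "\<And>v v'. proj (v' - v) = v' - v \<Longrightarrow> proj (\<Psi>' z v') = proj (\<Theta>' z v) \<Longrightarrow> T v = v'"
    using linearized_step[OF z(1)] by metis
  obtain M where M: "M > 0" "\<And>x. norm (T x) \<le> M * norm x" using linear_bound[OF T(1)] by blast
  have lin: "linear (\<Psi>' z)" using \<Psi> z has_derivative_linear by blast
  have "has_strict_derivative_on F T Y z"
    unfolding has_strict_derivative_on_def
  proof (intro conjI allI impI T(1))
    fix \<epsilon> :: real assume "\<epsilon> > 0"
    \<comment> \<open>The deviation also occurs on the right, through |F t - F s|; the bound m / 2
      absorbs it, and the other entry leaves \<epsilon> after division by m / 2.\<close>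
    define \<epsilon>1 where "\<epsilon>1 = min (m / 2) (\<epsilon> * m / (2 * (M + 1)))"
    have \<epsilon>1: "\<epsilon>1 > 0" "\<epsilon>1 \<le> m / 2" "\<epsilon>1 * (M + 1) \<le> \<epsilon> * m / 2"
    proof -
      show "\<epsilon>1 \<le> m / 2" unfolding \<epsilon>1_def by (rule min.cobounded1)
      have "\<epsilon>1 * (M + 1) \<le> \<epsilon> * m / (2 * (M + 1)) * (M + 1)"
        using M by (intro mult_right_mono) (auto simp: \<epsilon>1_def)
      also have "\<dots> = \<epsilon> * m / 2" using M(1) by (simp add: field_split_simps)
      finally show "\<epsilon>1 * (M + 1) \<le> \<epsilon> * m / 2" .
    qed (use m M \<open>\<epsilon> > 0\<close> in \<open>auto simp: \<epsilon>1_def\<close>)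
    obtain U where U: "open U" "z \<in> U"
      "\<And>x y. x \<in> U \<Longrightarrow> y \<in> U \<Longrightarrow> norm (\<Psi> y - \<Psi> x - \<Psi>' z (y - x)) \<le> \<epsilon>1 * norm (y - x)"
      using C1_imp_has_strict_derivative[OF X(1) z(1) \<Psi> \<Psi>_cont] \<epsilon>1(1)
      unfolding has_strict_derivative_on_def by (metis Int_UNIV_right)
    obtain V where V: "open V" "z \<in> V"
      "\<And>x y. x \<in> V \<Longrightarrow> y \<in> V \<Longrightarrow> norm (\<Theta> y - \<Theta> x - \<Theta>' z (y - x)) \<le> \<epsilon>1 * norm (y - x)"
      using C1_imp_has_strict_derivative[OF X(1) z(1) \<Theta> \<Theta>_cont] \<epsilon>1(1)
      unfolding has_strict_derivative_on_def by (metis Int_UNIV_right)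
    obtain r where r: "r > 0" "ball z r \<subseteq> U" using U open_contains_ball by blast
    have "isCont \<Theta> z" "isCont \<Psi> z"
      using has_derivative_continuous[OF \<Theta>[OF z(1)]] has_derivative_continuous[OF \<Psi>[OF z(1)]] by auto
    define f where "f s = norm (s - z) + (norm (\<Theta> s - \<Theta> z) + norm (\<Psi> s - \<Psi> z)) / m" for s
    have "isCont f z" unfolding f_def
      using m \<open>isCont \<Theta> z\<close> \<open>isCont \<Psi> z\<close> by (intro continuous_intros) auto
    then have "(f \<longlongrightarrow> f z) (nhds z)"
      by (simp add: isCont_def tendsto_at_iff_tendsto_nhds)
    moreover have "f z < r" using r(1) by (simp add: f_def)
    ultimately have "\<forall>\<^sub>F s in nhds z. f s < r" by (rule order_tendstoD(2))
    then obtain W where W: "open W" "z \<in> W"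
      "\<And>s. s \<in> W \<Longrightarrow> norm (s - z) + (norm (\<Theta> s - \<Theta> z) + norm (\<Psi> s - \<Psi> z)) / m < r"
      unfolding eventually_nhds f_def by blast
    have FU: "F s \<in> U" if "s \<in> W" "s \<in> Y" for s
    proof -
      have "norm (F s - z) \<le> norm (s - z) + norm (F s - s)"
        using norm_triangle_ineq[of "s - z" "F s - s"] by simp
      then have "norm (F s - z) < r" using W(3)[OF that(1)] step_near_fixed_point[OF z F[OF that(2)]] by linarith
      then show ?thesis using r(2) by (auto simp: dist_norm norm_minus_commute)
    qed
    have "norm (F t - F s - T (t - s)) \<le> \<epsilon> * norm (t - s)" if s: "s \<in> (V \<inter> W) \<inter> Y" "t \<in> (V \<inter> W) \<inter> Y" for s t
    proof -
      let ?d = "t - s" and ?D = "F t - F s"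
      define \<delta> where "\<delta> = ?D - T ?d"
      have rs: "proj (F s - s) = F s - s" "proj (\<Psi> (F s)) = proj (\<Theta> s)"
        "proj (F t - t) = F t - t" "proj (\<Psi> (F t)) = proj (\<Theta> t)"
        using F s by (auto simp: step_rel_def)
      have "\<delta> = (F t - t) - (F s - s) - (T ?d - ?d)" by (simp add: \<delta>_def)
      then have p\<delta>: "proj \<delta> = \<delta>"
        using rs(1,3) T(2)[of ?d] by (simp only: linear_diff[OF linear_proj])
      have "\<Psi>' z \<delta> \<bullet> \<delta> = \<Psi>' z ?D \<bullet> \<delta> - \<Theta>' z ?d \<bullet> \<delta>"
        using inner_proj_eq[OF T(3)[of ?d] p\<delta>] unfolding \<delta>_def
        by (simp only: linear_diff[OF lin] inner_diff_left)
      also have "\<dots> = ((\<Theta> t - \<Theta> s - \<Theta>' z ?d) - (\<Psi> (F t) - \<Psi> (F s) - \<Psi>' z ?D)) \<bullet> \<delta>"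
        using inner_proj_eq[OF rs(2) p\<delta>] inner_proj_eq[OF rs(4) p\<delta>] by (simp add: inner_diff_left)
      finally have "m * (norm \<delta>)\<^sup>2 \<le> ((\<Theta> t - \<Theta> s - \<Theta>' z ?d) - (\<Psi> (F t) - \<Psi> (F s) - \<Psi>' z ?D)) \<bullet> \<delta>"
        using \<Psi>_coercive[OF z(1) p\<delta>] by simp
      then have "norm \<delta> \<le> norm ((\<Theta> t - \<Theta> s - \<Theta>' z ?d) - (\<Psi> (F t) - \<Psi> (F s) - \<Psi>' z ?D)) / m"
        by (rule norm_le_if_coercive)
      also have "\<dots> \<le> (\<epsilon>1 * norm ?d + \<epsilon>1 * norm ?D) / m"
        using m by (intro divide_right_mono order_trans[OF norm_triangle_ineq4] add_mono U(3) V(3) FU)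
          (use s in auto)
      finally have "m * norm \<delta> \<le> \<epsilon>1 * norm ?d + \<epsilon>1 * norm ?D" using m by (simp add: field_simps)
      also have "norm ?D \<le> norm \<delta> + M * norm ?d"
        using norm_triangle_ineq[of \<delta> "T ?d"] M(2)[of ?d] by (simp add: \<delta>_def)
      finally have "m * norm \<delta> \<le> \<epsilon>1 * norm \<delta> + \<epsilon>1 * (M + 1) * norm ?d"
        using \<epsilon>1(1) by (simp add: algebra_simps)
      moreover have "\<epsilon>1 * norm \<delta> \<le> m / 2 * norm \<delta>" "\<epsilon>1 * (M + 1) * norm ?d \<le> \<epsilon> * m / 2 * norm ?d"
        using \<epsilon>1 by (intro mult_right_mono; simp)+
      ultimately have "m * norm \<delta> \<le> m * (\<epsilon> * norm ?d)" by (simp add: algebra_simps)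
      then show ?thesis using m by (simp add: \<delta>_def)
    qed
    then show "\<exists>U. open U \<and> z \<in> U \<and> (\<forall>s\<in>U \<inter> Y. \<forall>t\<in>U \<inter> Y. norm (F t - F s - T (t - s)) \<le> \<epsilon> * norm (t - s))"
      using V W by (intro exI[of _ "V \<inter> W"]) auto
  qed
  then show ?thesis using that T(4) by blast
qed

end

section \<open>Gradients and Hessians on a subspace\<close>

lemma second_difference_estimate:
  fixes f :: "'a::euclidean_space \<Rightarrow> real"
  assumes f: "\<And>x. x \<in> ball a r \<Longrightarrow> (f has_derivative (\<lambda>d. g x \<bullet> d)) (at x)"
    and A: "linear A" "\<And>x. x \<in> ball a r \<Longrightarrow> norm (g x - g a - A (x - a)) \<le> \<epsilon> * norm (x - a)"
    and t: "t > 0" "t * (norm u + norm v) < r" and "\<epsilon> \<ge> 0"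
  shows "\<bar>(f (a + t *\<^sub>R u + t *\<^sub>R v) - f (a + t *\<^sub>R u) - (f (a + t *\<^sub>R v) - f a)) - t\<^sup>2 * (A v \<bullet> u)\<bar>
    \<le> 2 * \<epsilon> * t\<^sup>2 * (norm u + norm v)\<^sup>2"
proof -
  let ?N = "norm u + norm v"
  have inb: "norm (s *\<^sub>R u + c *\<^sub>R v) \<le> t * ?N" if "0 \<le> s" "s \<le> t" "0 \<le> c" "c \<le> t" for s c
  proof -
    have "norm (s *\<^sub>R u + c *\<^sub>R v) \<le> s * norm u + c * norm v"
      using norm_triangle_ineq[of "s *\<^sub>R u" "c *\<^sub>R v"] that by simp
    also have "\<dots> \<le> t * norm u + t * norm v" using that by (intro add_mono mult_right_mono) auto
    finally show ?thesis by (simp add: distrib_left)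
  qed
  have ball: "a + s *\<^sub>R u + c *\<^sub>R v \<in> ball a r" if "0 \<le> s" "s \<le> t" "0 \<le> c" "c \<le> t" for s c
  proof -
    have "norm (s *\<^sub>R u + c *\<^sub>R v) < r" using inb[OF that] t(2) by linarith
    moreover have "dist a (a + s *\<^sub>R u + c *\<^sub>R v) = norm (s *\<^sub>R u + c *\<^sub>R v)"
      by (metis add.assoc add_diff_cancel_left' dist_commute dist_norm)
    ultimately show ?thesis by simp
  qed
  have der: "((\<lambda>s. f (a + s *\<^sub>R u + c *\<^sub>R v)) has_derivative (\<lambda>h. g (a + s *\<^sub>R u + c *\<^sub>R v) \<bullet> (h *\<^sub>R u))) (at s within {0..t})"
    if "0 \<le> s" "s \<le> t" "0 \<le> c" "c \<le> t" for s c
  proof -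
    have "((\<lambda>s. a + s *\<^sub>R u + c *\<^sub>R v) has_derivative (\<lambda>h. h *\<^sub>R u)) (at s within {0..t})"
      by (auto intro!: derivative_eq_intros)
    from has_derivative_compose[OF this f[OF ball[OF that]]] show ?thesis .
  qed
  define \<phi> where "\<phi> s = f (a + s *\<^sub>R u + t *\<^sub>R v) - f (a + s *\<^sub>R u + 0 *\<^sub>R v)" for s
  have "(\<phi> has_derivative (\<lambda>h. g (a + s *\<^sub>R u + t *\<^sub>R v) \<bullet> (h *\<^sub>R u) - g (a + s *\<^sub>R u + 0 *\<^sub>R v) \<bullet> (h *\<^sub>R u))) (at s within {0..t})"
    if "0 \<le> s" "s \<le> t" for s
    unfolding \<phi>_def using that t by (intro has_derivative_diff der) auto
  from mvt_very_simple[of 0 t \<phi>, OF _ this] obtain s where s: "s \<in> {0..t}"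
    "\<phi> t - \<phi> 0 = g (a + s *\<^sub>R u + t *\<^sub>R v) \<bullet> (t *\<^sub>R u) - g (a + s *\<^sub>R u + 0 *\<^sub>R v) \<bullet> (t *\<^sub>R u)"
    using t by auto
  let ?x = "a + s *\<^sub>R u + t *\<^sub>R v" and ?y = "a + s *\<^sub>R u + 0 *\<^sub>R v"
  have e: "norm (g z - g a - A (z - a)) \<le> \<epsilon> * (t * ?N)" if "z = a + s *\<^sub>R u + c *\<^sub>R v" "0 \<le> c" "c \<le> t" for z c
  proof -
    have "norm (g z - g a - A (z - a)) \<le> \<epsilon> * norm (z - a)"
      using s ball[of s c] that by (intro A(2)) auto
    also have "\<dots> \<le> \<epsilon> * (t * ?N)"
      using s that inb[of s c] \<open>\<epsilon> \<ge> 0\<close> by (intro mult_left_mono) (auto simp: add.assoc)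
    finally show ?thesis .
  qed
  have "\<phi> t - \<phi> 0 - t\<^sup>2 * (A v \<bullet> u) = t * (((g ?x - g a - A (?x - a)) - (g ?y - g a - A (?y - a))) \<bullet> u)"
  proof -
    have "A (?x - a) - A (?y - a) = t *\<^sub>R A v"
      by (simp add: linear_diff[OF A(1), symmetric] linear_scale[OF A(1), symmetric])
    then have "(A (?x - a) - A (?y - a)) \<bullet> u = t * (A v \<bullet> u)" by simp
    then show ?thesis unfolding s(2) by (simp add: inner_diff_left algebra_simps power2_eq_square)
  qed
  also have "\<bar>\<dots>\<bar> \<le> t * (norm ((g ?x - g a - A (?x - a)) - (g ?y - g a - A (?y - a))) * norm u)"
    using t Cauchy_Schwarz_ineq2 by (simp add: abs_mult)
  also have "\<dots> \<le> t * ((\<epsilon> * (t * ?N) + \<epsilon> * (t * ?N)) * ?N)"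
    using t \<open>\<epsilon> \<ge> 0\<close>
    by (intro mult_left_mono mult_mono order_trans[OF norm_triangle_ineq4] add_mono e[of ?x t] e[of ?y 0]) auto
  also have "\<dots> = 2 * \<epsilon> * t\<^sup>2 * ?N\<^sup>2" by (simp add: power2_eq_square algebra_simps)
  finally show ?thesis by (simp add: \<phi>_def algebra_simps)
qed

text \<open>The second difference of f is symmetric in u and v, and up to an error \<epsilon> t^2 it
  equals both t^2 (A v \<bullet> u) and t^2 (A u \<bullet> v).\<close>

lemma derivative_of_gradient_symmetric:
  fixes f :: "'a::euclidean_space \<Rightarrow> real"
  assumes X: "open X" "a \<in> X"
    and f: "\<And>x. x \<in> X \<Longrightarrow> (f has_derivative (\<lambda>d. g x \<bullet> d)) (at x)"
    and A: "(g has_derivative A) (at a)"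
  shows "A u \<bullet> v = A v \<bullet> u"
proof (rule ccontr)
  assume "A u \<bullet> v \<noteq> A v \<bullet> u"
  then have pos: "\<bar>A u \<bullet> v - A v \<bullet> u\<bar> > 0" by simp
  let ?N = "norm u + norm v"
  \<comment> \<open>The two estimates together allow a difference of 4 \<epsilon> N^2; the extra 1
    puts this strictly below the assumed difference.\<close>
  define \<epsilon> where "\<epsilon> = \<bar>A u \<bullet> v - A v \<bullet> u\<bar> / (4 * ?N\<^sup>2 + 1)"
  have lin: "linear A" using A has_derivative_linear by blast
  have "\<epsilon> > 0" using pos by (simp add: \<epsilon>_def add_nonneg_pos)
  then obtain \<delta> where \<delta>: "\<delta> > 0" "\<And>y. norm (y - a) < \<delta> \<Longrightarrow> norm (g y - g a - A (y - a)) \<le> \<epsilon> * norm (y - a)"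
    using A unfolding has_derivative_at_alt by blast
  obtain \<delta>' where \<delta>': "\<delta>' > 0" "ball a \<delta>' \<subseteq> X" using X open_contains_ball by blast
  define r where "r = min \<delta> \<delta>'"
  have r: "r > 0" "\<And>x. x \<in> ball a r \<Longrightarrow> x \<in> X"
    "\<And>x. x \<in> ball a r \<Longrightarrow> norm (g x - g a - A (x - a)) \<le> \<epsilon> * norm (x - a)"
    using \<delta> \<delta>' by (auto simp: r_def dist_norm norm_minus_commute)
  define t where "t = r / (2 * (?N + 1))"
  have N: "?N + 1 > 0" by (simp add: add_nonneg_pos)
  then have "t * (?N + 1) = r / 2" by (simp add: t_def field_simps)
  moreover have "t > 0" using r N by (simp add: t_def)
  ultimately have t: "t > 0" "t * ?N < r" using r(1) by (auto simp: algebra_simps)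
  let ?\<Delta> = "f (a + t *\<^sub>R u + t *\<^sub>R v) - f (a + t *\<^sub>R u) - f (a + t *\<^sub>R v) + f a"
  have 1: "\<bar>?\<Delta> - t\<^sup>2 * (A v \<bullet> u)\<bar> \<le> 2 * \<epsilon> * t\<^sup>2 * ?N\<^sup>2"
    using second_difference_estimate[of a r f g A \<epsilon> t u v] f r lin t \<open>\<epsilon> > 0\<close> by (simp add: algebra_simps)
  have 2: "\<bar>?\<Delta> - t\<^sup>2 * (A u \<bullet> v)\<bar> \<le> 2 * \<epsilon> * t\<^sup>2 * ?N\<^sup>2"
  proof -
    have "t * (norm v + norm u) < r" using t(2) by (simp add: add.commute)
    from second_difference_estimate[OF f[OF r(2)] lin r(3) t(1) this] \<open>\<epsilon> > 0\<close>
    have "\<bar>f (a + t *\<^sub>R v + t *\<^sub>R u) - f (a + t *\<^sub>R v) - (f (a + t *\<^sub>R u) - f a) - t\<^sup>2 * (A u \<bullet> v)\<bar>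
      \<le> 2 * \<epsilon> * t\<^sup>2 * (norm v + norm u)\<^sup>2" by simp
    moreover have e: "a + t *\<^sub>R v + t *\<^sub>R u = a + t *\<^sub>R u + t *\<^sub>R v" by simp
    ultimately show ?thesis unfolding e add.commute[of "norm v"] by argo
  qed
  have "\<bar>t\<^sup>2 * (A u \<bullet> v) - t\<^sup>2 * (A v \<bullet> u)\<bar> \<le> 2 * \<epsilon> * t\<^sup>2 * ?N\<^sup>2 + 2 * \<epsilon> * t\<^sup>2 * ?N\<^sup>2"
    using 1 2 by linarith
  then have "t\<^sup>2 * \<bar>A u \<bullet> v - A v \<bullet> u\<bar> \<le> t\<^sup>2 * (4 * \<epsilon> * ?N\<^sup>2)"
    unfolding right_diff_distrib[symmetric] abs_mult by (simp add: algebra_simps)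
  then have "\<bar>A u \<bullet> v - A v \<bullet> u\<bar> \<le> 4 * \<epsilon> * ?N\<^sup>2" using t(1) by simp
  moreover have "\<epsilon> * (4 * ?N\<^sup>2 + 1) = \<bar>A u \<bullet> v - A v \<bullet> u\<bar>"
  proof -
    have "4 * ?N\<^sup>2 + 1 \<noteq> 0" by (metis add_nonneg_pos less_irrefl mult_nonneg_nonneg zero_le_numeral zero_le_power2 zero_less_one)
    then show ?thesis by (simp add: \<epsilon>_def)
  qed
  ultimately show False using \<open>\<epsilon> > 0\<close> by (simp add: algebra_simps)
qed

text \<open>The Riesz vector of any derivative within S is projected orthogonally onto S. This does
  not change the derivative on directions in S, which is all that a derivative within S
  sees.\<close>

lemma gradient_in_subspace:
  assumes S: "subspace S" "v \<in> S" and F: "F differentiable (at v within S)"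
  shows "gradient S F v \<in> S" "(F has_derivative (\<lambda>d. gradient S F v \<bullet> d)) (at v within S)"
proof -
  obtain A where A: "(F has_derivative A) (at v within S)" using F by (auto simp: differentiable_def)
  then have lin: "linear A" using has_derivative_linear by blast
  obtain y z where yz: "y \<in> span S" "\<And>w. w \<in> span S \<Longrightarrow> orthogonal z w" "adjoint A 1 = y + z"
    using orthogonal_subspace_decomp_exists[of S "adjoint A 1"] by metis
  have "span S = S" using S by (simp add: span_eq_iff)
  note yz = yz[unfolded this]
  have eq: "A d = y \<bullet> d" if "d \<in> S" for d
  proof -
    have "A d = d \<bullet> adjoint A 1" using adjoint_works[OF lin, of d 1] by simp
    then show ?thesis using yz(2)[OF that] by (simp add: yz(3) inner_add_right orthogonal_def inner_commute)
  qed
  have "(F has_derivative (\<lambda>d. y \<bullet> d)) (at v within S)"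
    using A unfolding has_derivative_within_alt
    by (auto simp: bounded_linear_inner_right eq subspace_diff S)
  then have "gradient S F v = y" using gradient_eqI S yz by blast
  then show "gradient S F v \<in> S" "(F has_derivative (\<lambda>d. gradient S F v \<bullet> d)) (at v within S)"
    using yz \<open>(F has_derivative (\<lambda>d. y \<bullet> d)) (at v within S)\<close> by auto
qed

lemma C2_onD:
  assumes "C2_on S D F" "subspace S" "D \<subseteq> S" "v \<in> D"
  shows "gradient S F v \<in> S" "(F has_derivative (\<lambda>d. gradient S F v \<bullet> d)) (at v within S)"
    "(gradient S F has_derivative hessian S F v) (at v within S)"
proof -
  have "v \<in> S" and d: "F differentiable (at v within S)" "gradient S F differentiable (at v within S)"
    using assms by (auto simp: C2_on_def)
  then show "gradient S F v \<in> S" "(F has_derivative (\<lambda>d. gradient S F v \<bullet> d)) (at v within S)"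
    using gradient_in_subspace assms(2) by blast+
  show "(gradient S F has_derivative hessian S F v) (at v within S)"
    using d(2) unfolding hessian_def frechet_derivative_works .
qed

text \<open>The functions live on relatively open subsets of a subspace, with derivatives taken
  within it. Composing with a linear map into S turns these into ordinary derivatives on the whole
  state space.\<close>

locale C2_pullback =
  fixes S :: "'p::euclidean_space set" and D F and P :: "'s::euclidean_space \<Rightarrow> 'p"
  assumes C2: "C2_on S D F" and S: "subspace S" "D \<subseteq> S" and P: "linear P" "range P \<subseteq> S"
begin

lemma has_derivative_pullback:
  assumes "P s \<in> D"
  shows "((\<lambda>s. F (P s)) has_derivative (\<lambda>d. adjoint P (gradient S F (P s)) \<bullet> d)) (at s)"
proof -
  have "(P has_derivative P) (at s within UNIV)" using P(1) by (simp add: linear_imp_has_derivative)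
  moreover have "(F has_derivative (\<lambda>d. gradient S F (P s) \<bullet> d)) (at (P s) within P ` UNIV)"
    using has_derivative_subset[OF C2_onD(2)[OF C2 S assms] P(2)] .
  ultimately have "((\<lambda>s. F (P s)) has_derivative (\<lambda>d. gradient S F (P s) \<bullet> P d)) (at s within UNIV)"
    by (rule has_derivative_in_compose)
  moreover have "adjoint P (gradient S F (P s)) \<bullet> d = gradient S F (P s) \<bullet> P d" for d
    using adjoint_works[OF P(1), of d "gradient S F (P s)"] by (simp add: inner_commute)
  ultimately show ?thesis by simp
qed

lemma has_derivative_gradient_pullback:
  assumes "P s \<in> D"
  shows "((\<lambda>s. adjoint P (gradient S F (P s))) has_derivative (\<lambda>d. adjoint P (hessian S F (P s) (P d)))) (at s)"
proof -
  have "(P has_derivative P) (at s within UNIV)" using P(1) by (simp add: linear_imp_has_derivative)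
  moreover have "(gradient S F has_derivative hessian S F (P s)) (at (P s) within P ` UNIV)"
    using has_derivative_subset[OF C2_onD(3)[OF C2 S assms] P(2)] .
  ultimately have *: "((\<lambda>s. gradient S F (P s)) has_derivative (\<lambda>d. hessian S F (P s) (P d))) (at s within UNIV)"
    by (rule has_derivative_in_compose)
  show ?thesis
    using bounded_linear.has_derivative[OF _ *, of "adjoint P"] adjoint_linear[OF P(1)]
    by (simp add: linear_conv_bounded_linear)
qed

lemma continuous_on_hessian_pullback:
  assumes "\<And>s. s \<in> X \<Longrightarrow> P s \<in> D"
  shows "continuous_on X (\<lambda>s. adjoint P (hessian S F (P s) (P d)))"
proof -
  have "continuous_on D (\<lambda>v. hessian S F v (P d))" using C2 P(2) by (auto simp: C2_on_def)
  moreover have "continuous_on X P" using P(1) by (simp add: linear_continuous_on linear_conv_bounded_linear)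
  ultimately have "continuous_on X (\<lambda>s. hessian S F (P s) (P d))"
    using assms by (intro continuous_on_compose2[of D "\<lambda>v. hessian S F v (P d)" X P]) auto
  then show ?thesis
    using bounded_linear.continuous_on adjoint_linear[OF P(1)] linear_conv_bounded_linear by blast
qed

lemma hessian_symmetric:
  assumes X: "open X" "\<And>s. s \<in> X \<Longrightarrow> P s \<in> D" "s \<in> X"
  shows "hessian S F (P s) (P d) \<bullet> P e = hessian S F (P s) (P e) \<bullet> P d"
proof -
  have "adjoint P (hessian S F (P s) (P d)) \<bullet> e = adjoint P (hessian S F (P s) (P e)) \<bullet> d"
    by (rule derivative_of_gradient_symmetric[OF X(1,3) has_derivative_pullback[OF X(2)]
      has_derivative_gradient_pullback[OF X(2)[OF X(3)]]])
  then show ?thesis using adjoint_works[OF P(1)] by (simp add: inner_commute)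
qed

end

text \<open>Convexity, smoothness and Bregman divergences use gradients and Hessians of slices,
  while the C2 hypothesis concerns the joint function. Here the former are identified with blocks of
  the latter.\<close>

locale C2_product =
  fixes Y :: "'b::euclidean_space set" and Dx :: "'a::euclidean_space set" and Dy :: "'b set"
    and F :: "'a \<Rightarrow> 'b \<Rightarrow> real"
  assumes Y: "subspace Y" and Dx: "open Dx" and Dy: "openin (top_of_set Y) Dy"
    and C2: "C2_on (UNIV \<times> Y) (Dx \<times> Dy) (\<lambda>(u, v). F u v)"
begin

abbreviation "G \<equiv> gradient (UNIV \<times> Y) (\<lambda>(u, v). F u v)"
abbreviation "H \<equiv> hessian (UNIV \<times> Y) (\<lambda>(u, v). F u v)"

lemma Dy_subset: "Dy \<subseteq> Y" using Dy openin_subset by fastforce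

lemma subspace_prod: "subspace ((UNIV :: 'a set) \<times> Y)" using Y by (intro subspace_Times) auto

lemma G:
  assumes "x \<in> Dx" "y \<in> Dy"
  shows "G (x, y) \<in> UNIV \<times> Y" "((\<lambda>(u, v). F u v) has_derivative (\<lambda>d. G (x, y) \<bullet> d)) (at (x, y) within UNIV \<times> Y)"
    "(G has_derivative H (x, y)) (at (x, y) within UNIV \<times> Y)"
  using C2_onD[OF C2 subspace_prod, of "(x, y)"] assms Dy_subset by auto

lemma slice_x: "((\<lambda>u. (u, y)) has_derivative (\<lambda>d. (d, 0))) (at x within UNIV)"
  by (auto intro!: derivative_eq_intros)

lemma slice_y: "((\<lambda>v. (x, v)) has_derivative (\<lambda>d. (0, d))) (at y within Y)"
  by (auto intro!: derivative_eq_intros)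

lemma gradient_x:
  assumes "x \<in> Dx" "y \<in> Dy"
  shows "gradient UNIV (\<lambda>u. F u y) x = fst (G (x, y))"
proof (rule gradient_eqI)
  have "((\<lambda>(u, v). F u v) has_derivative (\<lambda>d. G (x, y) \<bullet> d)) (at (x, y) within (\<lambda>u. (u, y)) ` UNIV)"
    by (rule has_derivative_subset[OF G(2)[OF assms]]) (use assms Dy_subset in auto)
  from has_derivative_in_compose[OF slice_x this]
  show "((\<lambda>u. F u y) has_derivative (\<lambda>d. fst (G (x, y)) \<bullet> d)) (at x within UNIV)"
    by (simp add: inner_prod_def)
qed auto

lemma gradient_y:
  assumes "x \<in> Dx" "y \<in> Dy"
  shows "gradient Y (\<lambda>v. F x v) y = snd (G (x, y))"
proof (rule gradient_eqI[OF Y])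
  have "((\<lambda>(u, v). F u v) has_derivative (\<lambda>d. G (x, y) \<bullet> d)) (at (x, y) within (\<lambda>v. (x, v)) ` Y)"
    by (rule has_derivative_subset[OF G(2)[OF assms]]) auto
  from has_derivative_in_compose[OF slice_y this]
  show "((\<lambda>v. F x v) has_derivative (\<lambda>d. snd (G (x, y)) \<bullet> d)) (at y within Y)"
    by (simp add: inner_prod_def)
  show "y \<in> Y" using assms Dy_subset by auto
  show "snd (G (x, y)) \<in> Y" using G(1)[OF assms] by (auto simp: mem_Times_iff)
qed

lemma hess_form_x:
  assumes "x \<in> Dx" "y \<in> Dy"
  shows "hess_form UNIV (\<lambda>u. F u y) x d = H (x, y) (d, 0) \<bullet> (d, 0)"
proof -
  have "(G has_derivative H (x, y)) (at (x, y) within (\<lambda>u. (u, y)) ` UNIV)"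
    by (rule has_derivative_subset[OF G(3)[OF assms]]) (use assms Dy_subset in auto)
  from has_derivative_fst[OF has_derivative_in_compose[OF slice_x this]]
  have "((\<lambda>u. fst (G (u, y))) has_derivative (\<lambda>d. fst (H (x, y) (d, 0)))) (at x)" .
  then have "(gradient UNIV (\<lambda>u. F u y) has_derivative (\<lambda>d. fst (H (x, y) (d, 0)))) (at x)"
    by (rule has_derivative_transform_within_open[OF _ Dx assms(1)]) (simp add: gradient_x assms)
  from hessian_eqI[OF _ _ _ this, of d] show ?thesis
    by (simp add: hess_form_def inner_prod_def inner_commute)
qed

lemma hess_form_y:
  assumes "x \<in> Dx" "y \<in> Dy" "d \<in> Y"
  shows "hess_form Y (\<lambda>v. F x v) y d = H (x, y) (0, d) \<bullet> (0, d)"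
proof -
  have yY: "y \<in> Y" using assms Dy_subset by auto
  have "(G has_derivative H (x, y)) (at (x, y) within (\<lambda>v. (x, v)) ` Y)"
    by (rule has_derivative_subset[OF G(3)[OF assms(1,2)]]) auto
  from has_derivative_snd[OF has_derivative_in_compose[OF slice_y this]]
  have *: "((\<lambda>v. snd (G (x, v))) has_derivative (\<lambda>d. snd (H (x, y) (0, d)))) (at y within Y)" .
  obtain O' where O': "open O'" "Dy = Y \<inter> O'" using Dy by (auto simp: openin_open)
  then obtain r where r: "r > 0" "ball y r \<subseteq> O'" using assms open_contains_ball by blast
  have "(gradient Y (\<lambda>v. F x v) has_derivative (\<lambda>d. snd (H (x, y) (0, d)))) (at y within Y)"
  proof (rule has_derivative_transform_within[OF * r(1) yY])
    fix v assume "v \<in> Y" "dist v y < r"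
    then have "v \<in> Dy" using r O' by (auto simp: dist_commute)
    then show "snd (G (x, v)) = gradient Y (\<lambda>v. F x v) v" by (simp add: gradient_y assms)
  qed
  from hessian_eqI[OF Y yY assms(3) this] show ?thesis
    by (simp add: hess_form_def inner_prod_def inner_commute)
qed

end

section \<open>The consensus ADMM iteration\<close>

text \<open>Fermat's rule along one line suffices: in the direction of the block residual e = proj
  (\<Psi> t - \<Theta> s), the derivative of the objective is |e|^2.\<close>

lemma (in block_step) step_relI_minimizer:
  assumes s: "s \<in> X" and t: "t \<in> X" "proj (t - s) = t - s"
    and \<phi>: "(\<phi> has_derivative (\<lambda>d. \<Psi> t \<bullet> d)) (at t)"
    and min: "\<And>t'. t' \<in> X \<Longrightarrow> proj (t' - s) = t' - s \<Longrightarrow> \<phi> t - \<Theta> s \<bullet> t \<le> \<phi> t' - \<Theta> s \<bullet> t'"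
  shows "step_rel s t"
proof -
  define e where "e = proj (\<Psi> t - \<Theta> s)"
  have e: "proj e = e" by (simp add: e_def proj_proj)
  define \<psi> where "\<psi> c = \<phi> (t + c *\<^sub>R e) - \<Theta> s \<bullet> (t + c *\<^sub>R e)" for c
  have line: "((\<lambda>c. t + c *\<^sub>R e) has_derivative (\<lambda>c. c *\<^sub>R e)) (at 0)"
    by (auto intro!: derivative_eq_intros)
  have "((\<lambda>c. \<phi> (t + c *\<^sub>R e)) has_derivative (\<lambda>c. \<Psi> t \<bullet> (c *\<^sub>R e))) (at 0)"
    using has_derivative_compose[OF line, of \<phi> "\<lambda>d. \<Psi> t \<bullet> d"] \<phi> by simp
  then have "(\<psi> has_derivative (\<lambda>c. \<Psi> t \<bullet> (c *\<^sub>R e) - \<Theta> s \<bullet> (c *\<^sub>R e))) (at 0)"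
    unfolding \<psi>_def by (intro has_derivative_diff has_derivative_inner_right line)
  moreover have "(\<lambda>c. \<Psi> t \<bullet> (c *\<^sub>R e) - \<Theta> s \<bullet> (c *\<^sub>R e)) = (*) ((\<Psi> t - \<Theta> s) \<bullet> e)"
    by (auto simp: inner_diff_left algebra_simps)
  ultimately have der: "(\<psi> has_field_derivative ((\<Psi> t - \<Theta> s) \<bullet> e)) (at 0)"
    by (simp add: has_field_derivative_def)
  have "isCont (\<lambda>c. t + c *\<^sub>R e) 0" by (intro continuous_intros)
  then have "((\<lambda>c. t + c *\<^sub>R e) \<longlongrightarrow> t) (nhds 0)"
    using tendsto_at_iff_tendsto_nhds[of "\<lambda>c. t + c *\<^sub>R e" 0] by (simp add: isCont_def)
  from topological_tendstoD[OF this X(1) t(1)] have "\<forall>\<^sub>F c in nhds 0. t + c *\<^sub>R e \<in> X" .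
  then obtain \<delta> where \<delta>: "\<delta> > 0" "\<And>c. dist c 0 < \<delta> \<Longrightarrow> t + c *\<^sub>R e \<in> X"
    unfolding eventually_nhds_metric by blast
  have "\<psi> 0 \<le> \<psi> c" if "\<bar>0 - c\<bar> < \<delta>" for c
  proof -
    have "t + c *\<^sub>R e \<in> X" using \<delta>(2)[of c] that by simp
    moreover have "t + c *\<^sub>R e - s = (t - s) + c *\<^sub>R e" by simp
    then have "proj (t + c *\<^sub>R e - s) = t + c *\<^sub>R e - s"
      by (simp only: linear_add[OF linear_proj] linear_scale[OF linear_proj] e t(2))
    ultimately show ?thesis using min unfolding \<psi>_def by auto
  qed
  then have "(\<Psi> t - \<Theta> s) \<bullet> e = 0" using DERIV_local_min[OF der \<delta>(1)] by blast
  then have "e \<bullet> e = 0" using proj_selfadjoint[of "\<Psi> t - \<Theta> s" e] by (simp add: e flip: e_def)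
  then have "proj (\<Psi> t) = proj (\<Theta> s)" by (simp add: e_def linear_diff[OF linear_proj])
  then show ?thesis using s t by (simp add: step_rel_def)
qed

lemma linear_block_part: "linear (block_part blk j)"
  by (rule linearI) (auto simp: block_part_def vec_eq_iff)

lemma block_part_block_part: "block_part blk i (block_part blk j y) = (if i = j then block_part blk j y else 0)"
  by (auto simp: block_part_def vec_eq_iff)

lemma block_part_of_block: "v \<in> block blk j \<Longrightarrow> block_part blk i v = (if i = j then v else 0)"
  by (auto simp: block_part_def block_def vec_eq_iff)

lemma block_part_selfadjoint: "block_part blk j v \<bullet> w = v \<bullet> block_part blk j w"
  unfolding inner_vec_def by (intro sum.cong) (auto simp: block_part_def)

lemma upd_block_eq: "v \<in> block blk j \<Longrightarrow> upd_block blk j v y = y + (v - block_part blk j y)"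
  by (auto simp: block_part_def block_def upd_block_def vec_eq_iff)

lemma upd_vec_eq: "upd_vec j u x = x + axis j (u - x $ j)" for u :: "'a::ab_group_add"
  by (auto simp: upd_vec_def axis_def vec_eq_iff)

lemma inner_adjoint: fixes P :: "'a::euclidean_space \<Rightarrow> 'b::euclidean_space" shows "linear P \<Longrightarrow> adjoint P w \<bullet> e = w \<bullet> P e"
  using adjoint_works[of P e w] by (simp add: inner_commute)

lemma linear_adjoint_compose:
  fixes P :: "'a::euclidean_space \<Rightarrow> 'b::euclidean_space"
  shows "linear P \<Longrightarrow> linear Q \<Longrightarrow> linear (\<lambda>s. adjoint P (Q s))"
  using linear_compose[of Q "adjoint P"] adjoint_linear[of P] by (simp add: o_def)

lemma sum_at:
  fixes c :: "'i::finite \<Rightarrow> 'p::real_inner"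
  shows "(\<Sum>i\<in>UNIV. c i \<bullet> (if i = j then w else 0)) = c j \<bullet> w"
  by (simp add: if_distrib[of "\<lambda>w. _ \<bullet> w"] cong: if_cong)

locale consensus_admm =
  fixes blk :: "'m::finite \<Rightarrow> 'k::{finite,linorder} option"
    and \<rho> \<eta> :: real
    and Dx :: "'k option \<Rightarrow> (real^'n::finite) set"
    and Dy :: "'k option \<Rightarrow> (real^'m) set"
    and f h :: "'k option \<Rightarrow> real^'n \<Rightarrow> real^'m \<Rightarrow> real"
    and Lx Ly :: "'k option \<Rightarrow> real"
  assumes \<rho>: "\<rho> > 0"
    and Dx: "open (Dx j)" "convex (Dx j)"
    and Dy: "openin (top_of_set (block blk j)) (Dy j)" "convex (Dy j)"
    and f_C2: "C2_on (UNIV \<times> block blk j) (Dx j \<times> Dy j) (\<lambda>(u, v). f j u v)"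
    and h_C2: "C2_on (UNIV \<times> block blk j) (Dx j \<times> Dy j) (\<lambda>(u, v). h j u v)"
    and h_convex: "strongly_biconvex (block blk j) (Dx j) (Dy j) (h j)"
    and L_pos: "Lx j > 0" "Ly j > 0"
    and f_smooth: "relatively_bismooth (block blk j) (Dx j) (Dy j) (Lx j) (Ly j) (h j) (f j)"
    and \<eta>: "\<eta> > 0" "\<eta> < 1 / Lx j" "\<eta> < 1 / Ly j"
begin

section \<open>Coordinates of the state and gradients on the whole state space\<close>

definition loc :: "'k option \<Rightarrow> ('n, 'm, 'k) state \<Rightarrow> (real^'n) \<times> (real^'m)" where
  "loc j s = (fst s $ j, block_part blk j (fst (snd s)))"

definition gap :: "'k \<Rightarrow> ('n, 'm, 'k) state \<Rightarrow> real^'n" where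
  "gap k s = fst s $ Some k - fst s $ None"

definition dual :: "'k \<Rightarrow> ('n, 'm, 'k) state \<Rightarrow> real^'n" where
  "dual k s = snd (snd s) $ k"

definition X :: "('n, 'm, 'k) state set" where
  "X = {s. \<forall>j. loc j s \<in> Dx j \<times> Dy j}"

lemma linear_loc: "linear (loc j)"
  by (rule linearI) (simp_all add: loc_def linear_add[OF linear_block_part] linear_scale[OF linear_block_part])

lemma linear_gap: "linear (gap k)"
  by (rule linearI) (simp_all add: gap_def algebra_simps)

lemma linear_dual: "linear (dual k)"
  by (rule linearI) (simp_all add: dual_def)

lemma loc_in: "loc j s \<in> UNIV \<times> block blk j"
  by (simp add: loc_def block_part_in_block)

sublocale f: C2_pullback "UNIV \<times> block blk j" "Dx j \<times> Dy j" "\<lambda>(u, v). f j u v" "loc j" for j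
  by (rule C2_pullback.intro[OF f_C2 subspace_Times[OF subspace_UNIV subspace_block] _ linear_loc])
    (use openin_imp_subset[OF Dy(1)[of j]] loc_in in blast)+

sublocale h: C2_pullback "UNIV \<times> block blk j" "Dx j \<times> Dy j" "\<lambda>(u, v). h j u v" "loc j" for j
  by (rule C2_pullback.intro[OF h_C2 subspace_Times[OF subspace_UNIV subspace_block] _ linear_loc])
    (use openin_imp_subset[OF Dy(1)[of j]] loc_in in blast)+

sublocale fp: C2_product "block blk j" "Dx j" "Dy j" "f j" for j
  by (rule C2_product.intro[OF subspace_block Dx(1) Dy(1) f_C2])

sublocale hp: C2_product "block blk j" "Dx j" "Dy j" "h j" for j
  by (rule C2_product.intro[OF subspace_block Dx(1) Dy(1) h_C2])

abbreviation "Gf j \<equiv> gradient (UNIV \<times> block blk j) (\<lambda>(u, v). f j u v)"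
abbreviation "Gh j \<equiv> gradient (UNIV \<times> block blk j) (\<lambda>(u, v). h j u v)"
abbreviation "Hf j \<equiv> hessian (UNIV \<times> block blk j) (\<lambda>(u, v). f j u v)"
abbreviation "Hh j \<equiv> hessian (UNIV \<times> block blk j) (\<lambda>(u, v). h j u v)"

text \<open>The gradient, in all variables including the multipliers, of the coupling terms of the
  augmented Lagrangian. These are quadratic, so it is linear and equals its own derivative.\<close>

definition grad_coupling :: "('n, 'm, 'k) state \<Rightarrow> ('n, 'm, 'k) state" where
  "grad_coupling s =
     (\<Sum>k\<in>UNIV. adjoint (dual k) (gap k s) + adjoint (gap k) (dual k s + \<rho> *\<^sub>R gap k s))"

definition \<Theta> :: "('n, 'm, 'k) state \<Rightarrow> ('n, 'm, 'k) state" where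
  "\<Theta> s = (1 / \<eta>) *\<^sub>R (\<Sum>j\<in>UNIV. adjoint (loc j) (Gh j (loc j s)))"

definition grad_L :: "('n, 'm, 'k) state \<Rightarrow> ('n, 'm, 'k) state" where
  "grad_L s = (\<Sum>j\<in>UNIV. adjoint (loc j) (Gf j (loc j s))) + grad_coupling s"

definition \<Psi> :: "('n, 'm, 'k) state \<Rightarrow> ('n, 'm, 'k) state" where
  "\<Psi> s = grad_L s + \<Theta> s"

definition \<Theta>' :: "('n, 'm, 'k) state \<Rightarrow> ('n, 'm, 'k) state \<Rightarrow> ('n, 'm, 'k) state" where
  "\<Theta>' s d = (1 / \<eta>) *\<^sub>R (\<Sum>j\<in>UNIV. adjoint (loc j) (Hh j (loc j s) (loc j d)))"

definition \<Psi>' :: "('n, 'm, 'k) state \<Rightarrow> ('n, 'm, 'k) state \<Rightarrow> ('n, 'm, 'k) state" where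
  "\<Psi>' s d = (\<Sum>j\<in>UNIV. adjoint (loc j) (Hf j (loc j s) (loc j d))) + grad_coupling d + \<Theta>' s d"

lemma inner_grad_coupling:
  "grad_coupling s \<bullet> e = (\<Sum>k\<in>UNIV. gap k s \<bullet> dual k e + (dual k s + \<rho> *\<^sub>R gap k s) \<bullet> gap k e)"
  by (simp add: grad_coupling_def inner_sum_left inner_add_left inner_adjoint linear_gap linear_dual)

lemma inner_\<Theta>: "\<Theta> s \<bullet> e = (1 / \<eta>) * (\<Sum>j\<in>UNIV. Gh j (loc j s) \<bullet> loc j e)"
  by (simp add: \<Theta>_def inner_sum_left inner_adjoint linear_loc)

lemma inner_grad_L: "grad_L s \<bullet> e = (\<Sum>j\<in>UNIV. Gf j (loc j s) \<bullet> loc j e) + grad_coupling s \<bullet> e"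
  by (simp add: grad_L_def inner_sum_left inner_add_left inner_adjoint linear_loc)

lemma inner_\<Theta>': "\<Theta>' s d \<bullet> e = (1 / \<eta>) * (\<Sum>j\<in>UNIV. Hh j (loc j s) (loc j d) \<bullet> loc j e)"
  by (simp add: \<Theta>'_def inner_sum_left inner_adjoint linear_loc)

lemma inner_\<Psi>': "\<Psi>' s d \<bullet> e = (\<Sum>j\<in>UNIV. Hf j (loc j s) (loc j d) \<bullet> loc j e) + grad_coupling d \<bullet> e + \<Theta>' s d \<bullet> e"
  by (simp add: \<Psi>'_def inner_sum_left inner_add_left inner_adjoint linear_loc)

lemma linear_grad_coupling: "linear grad_coupling"
  unfolding grad_coupling_def
  by (intro linear_compose_sum ballI linear_compose_add linear_adjoint_compose linear_gap linear_dual
      linear_compose_scale_right)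

lemma locX: "s \<in> X \<Longrightarrow> loc j s \<in> Dx j \<times> Dy j"
  by (simp add: X_def)

lemma open_X: "open X"
proof -
  have "\<exists>U. open U \<and> Dy j = block blk j \<inter> U" for j using Dy(1)[of j] by (auto simp: openin_open)
  then obtain U where U: "\<And>j. open (U j)" "\<And>j. Dy j = block blk j \<inter> U j" by metis
  have "X = (\<Inter>j. loc j -` (Dx j \<times> U j))"
    by (auto simp: X_def U(2) loc_def block_part_in_block)
  moreover have "open (loc j -` (Dx j \<times> U j))" for j
    using linear_loc[of j] by (intro continuous_open_vimage open_Times Dx U)
      (auto simp: linear_continuous_at linear_conv_bounded_linear)
  ultimately show ?thesis by (auto intro!: open_INT)
qed

lemma convex_X: "convex X"
proof -
  have "X = (\<Inter>j. loc j -` (Dx j \<times> Dy j))" by (auto simp: X_def)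
  moreover have "convex (loc j -` (Dx j \<times> Dy j))" for j
    by (intro convex_linear_vimage linear_loc convex_Times Dx Dy)
  ultimately show ?thesis by (auto intro!: convex_INT)
qed

lemma \<Theta>_has_derivative: "s \<in> X \<Longrightarrow> (\<Theta> has_derivative \<Theta>' s) (at s)"
  unfolding \<Theta>_def \<Theta>'_def
  by (intro has_derivative_scaleR_right has_derivative_sum h.has_derivative_gradient_pullback locX)

lemma \<Psi>_has_derivative:
  assumes "s \<in> X"
  shows "(\<Psi> has_derivative \<Psi>' s) (at s)"
proof -
  have "(grad_coupling has_derivative grad_coupling) (at s)"
    by (rule linear_imp_has_derivative[OF linear_grad_coupling])
  then have "((\<lambda>s. (\<Sum>j\<in>UNIV. adjoint (loc j) (Gf j (loc j s))) + grad_coupling s + \<Theta> s) has_derivative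
      (\<lambda>d. (\<Sum>j\<in>UNIV. adjoint (loc j) (Hf j (loc j s) (loc j d))) + grad_coupling d + \<Theta>' s d)) (at s)"
    by (intro has_derivative_add has_derivative_sum f.has_derivative_gradient_pullback \<Theta>_has_derivative assms locX)
  then show ?thesis by (simp add: \<Psi>_def[abs_def] grad_L_def \<Psi>'_def[abs_def])
qed

lemma \<Theta>'_continuous: "continuous_on X (\<lambda>s. \<Theta>' s d)"
  unfolding \<Theta>'_def by (intro continuous_intros h.continuous_on_hessian_pullback locX)

lemma \<Psi>'_continuous: "continuous_on X (\<lambda>s. \<Psi>' s d)"
  unfolding \<Psi>'_def by (intro continuous_intros f.continuous_on_hessian_pullback \<Theta>'_continuous locX)

text \<open>One potential for all Bregman terms, with gradient \<Theta>: when only one block of s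
  changes and gives t, the divergence over \<eta> is
  \<open>Hfun t - Hfun s - \<Theta> s \<bullet> (t - s)\<close>.\<close>

definition Hfun :: "('n, 'm, 'k) state \<Rightarrow> real" where
  "Hfun s = (1 / \<eta>) * (\<Sum>j\<in>UNIV. (\<lambda>(u, v). h j u v) (loc j s))"

lemma aug_lagrangian_eq:
  "aug_lagrangian blk \<rho> f s = (\<Sum>j\<in>UNIV. (\<lambda>(u, v). f j u v) (loc j s)) +
     (\<Sum>k\<in>UNIV. dual k s \<bullet> gap k s) + \<rho> / 2 * (\<Sum>k\<in>UNIV. gap k s \<bullet> gap k s)"
  by (cases s) (simp add: aug_lagrangian_def loc_def dual_def gap_def power2_norm_eq_inner)

lemma objective_has_derivative:
  assumes s: "s \<in> X"
  shows "((\<lambda>s. aug_lagrangian blk \<rho> f s + Hfun s) has_derivative (\<lambda>d. \<Psi> s \<bullet> d)) (at s)"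
proof -
  have gm: "(gap k has_derivative gap k) (at s)" "(dual k has_derivative dual k) (at s)" for k
    by (simp_all add: linear_imp_has_derivative linear_gap linear_dual)
  have "((\<lambda>s. (\<Sum>j\<in>UNIV. (\<lambda>(u, v). f j u v) (loc j s)) +
     (\<Sum>k\<in>UNIV. dual k s \<bullet> gap k s) + \<rho> / 2 * (\<Sum>k\<in>UNIV. gap k s \<bullet> gap k s) + Hfun s) has_derivative
    (\<lambda>d. (\<Sum>j\<in>UNIV. adjoint (loc j) (Gf j (loc j s)) \<bullet> d) +
     (\<Sum>k\<in>UNIV. dual k s \<bullet> gap k d + dual k d \<bullet> gap k s) +
     \<rho> / 2 * (\<Sum>k\<in>UNIV. gap k s \<bullet> gap k d + gap k d \<bullet> gap k s) +
     (1 / \<eta>) * (\<Sum>j\<in>UNIV. adjoint (loc j) (Gh j (loc j s)) \<bullet> d))) (at s)"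
    unfolding Hfun_def
    by (intro has_derivative_add has_derivative_sum has_derivative_mult_right has_derivative_inner gm
        f.has_derivative_pullback h.has_derivative_pullback locX s)
  moreover have "(\<Sum>j\<in>UNIV. adjoint (loc j) (Gf j (loc j s)) \<bullet> d) +
     (\<Sum>k\<in>UNIV. dual k s \<bullet> gap k d + dual k d \<bullet> gap k s) +
     \<rho> / 2 * (\<Sum>k\<in>UNIV. gap k s \<bullet> gap k d + gap k d \<bullet> gap k s) +
     (1 / \<eta>) * (\<Sum>j\<in>UNIV. adjoint (loc j) (Gh j (loc j s)) \<bullet> d) = \<Psi> s \<bullet> d" for d
  proof -
    have eq: "gap k s \<bullet> dual k d + (dual k s + \<rho> *\<^sub>R gap k s) \<bullet> gap k d =
      (dual k s \<bullet> gap k d + dual k d \<bullet> gap k s) + \<rho> / 2 * (gap k s \<bullet> gap k d + gap k d \<bullet> gap k s)" for k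
      by (simp add: inner_add_left inner_add_right inner_commute)
    have "grad_coupling s \<bullet> d = (\<Sum>k\<in>UNIV. dual k s \<bullet> gap k d + dual k d \<bullet> gap k s) +
      \<rho> / 2 * (\<Sum>k\<in>UNIV. gap k s \<bullet> gap k d + gap k d \<bullet> gap k s)"
      unfolding inner_grad_coupling eq sum_distrib_left by (rule sum.distrib)
    then show ?thesis
      by (simp add: \<Psi>_def inner_add_left[of "grad_L s"] inner_grad_L inner_\<Theta> inner_adjoint linear_loc)
  qed
  ultimately show ?thesis by (simp add: aug_lagrangian_eq)
qed

section \<open>Coercivity along single blocks\<close>

definition proj_x :: "'k option \<Rightarrow> ('n, 'm, 'k) state \<Rightarrow> ('n, 'm, 'k) state" where
  "proj_x j s = (axis j (fst s $ j), 0, 0)"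

definition proj_y :: "'k option \<Rightarrow> ('n, 'm, 'k) state \<Rightarrow> ('n, 'm, 'k) state" where
  "proj_y j s = (0, block_part blk j (fst (snd s)), 0)"

lemma loc_axis: "loc i (axis j d, 0, 0) = (if i = j then (d, 0) else 0)"
  by (auto simp: loc_def axis_def linear_0[OF linear_block_part] zero_prod_def)

lemma loc_block: "v \<in> block blk j \<Longrightarrow> loc i (0, v, 0) = (if i = j then (0, v) else 0)"
  by (auto simp: loc_def block_part_of_block zero_prod_def)

lemma biconvex_bounds:
  obtains m where "m > 0"
    "\<And>x y d. x \<in> Dx j \<Longrightarrow> y \<in> Dy j \<Longrightarrow>
       m * (d \<bullet> d) \<le> Hh j (x, y) (d, 0) \<bullet> (d, 0) \<and>
       0 \<le> Lx j * (Hh j (x, y) (d, 0) \<bullet> (d, 0)) + Hf j (x, y) (d, 0) \<bullet> (d, 0)"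
    "\<And>x y d. x \<in> Dx j \<Longrightarrow> y \<in> Dy j \<Longrightarrow> d \<in> block blk j \<Longrightarrow>
       m * (d \<bullet> d) \<le> Hh j (x, y) (0, d) \<bullet> (0, d) \<and>
       0 \<le> Ly j * (Hh j (x, y) (0, d) \<bullet> (0, d)) + Hf j (x, y) (0, d) \<bullet> (0, d)"
proof -
  obtain m where m: "m > 0" "\<And>x y. x \<in> Dx j \<Longrightarrow> y \<in> Dy j \<Longrightarrow>
        (\<forall>d. hess_form UNIV (\<lambda>u. h j u y) x d \<ge> m * (d \<bullet> d)) \<and>
        (\<forall>d\<in>block blk j. hess_form (block blk j) (\<lambda>v. h j x v) y d \<ge> m * (d \<bullet> d))"
    using h_convex[of j] unfolding strongly_biconvex_def by blast
  show ?thesis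
  proof (rule that[OF m(1)])
    fix x y d assume xy: "x \<in> Dx j" "y \<in> Dy j"
    show "m * (d \<bullet> d) \<le> Hh j (x, y) (d, 0) \<bullet> (d, 0) \<and>
       0 \<le> Lx j * (Hh j (x, y) (d, 0) \<bullet> (d, 0)) + Hf j (x, y) (d, 0) \<bullet> (d, 0)"
      using m(2)[OF xy] f_smooth[of j] xy 
      unfolding relatively_bismooth_def hp.hess_form_x[OF xy, symmetric] fp.hess_form_x[OF xy, symmetric]
      by blast
  next
    fix x y d assume xy: "x \<in> Dx j" "y \<in> Dy j" "d \<in> block blk j"
    show "m * (d \<bullet> d) \<le> Hh j (x, y) (0, d) \<bullet> (0, d) \<and>
       0 \<le> Ly j * (Hh j (x, y) (0, d) \<bullet> (0, d)) + Hf j (x, y) (0, d) \<bullet> (0, d)"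
      using m(2)[OF xy(1,2)] f_smooth[of j] xy 
      unfolding relatively_bismooth_def hp.hess_form_y[OF xy, symmetric] fp.hess_form_y[OF xy, symmetric]
      by blast
  qed
qed

text \<open>Here F and H are values of the Hessian forms of f and h, and n is a squared norm.
  Relative smoothness gives F \<ge> - L H, so F + H / \<eta> is at least (1 / \<eta> - L) H, and
  strong convexity bounds H from below.\<close>

lemma step_size_coercive:
  assumes L: "L > 0" "\<eta> < 1 / L" and m: "m > 0" "m * n \<le> H" and F: "0 \<le> L * H + F" and n: "0 \<le> n"
  shows "(1 / \<eta> - L) * m > 0" "(1 / \<eta> - L) * m * n \<le> (1 / \<eta>) * H"
    "(1 / \<eta> - L) * m * n \<le> F + (1 / \<eta>) * H"
proof -
  have c: "1 / \<eta> - L > 0" using L \<eta>(1) by (simp add: field_simps)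
  then show "(1 / \<eta> - L) * m > 0" using m by simp
  have "(1 / \<eta> - L) * (m * n) \<le> (1 / \<eta> - L) * H" using c m by (intro mult_left_mono) auto
  moreover have "0 \<le> L * H" using L m n order_trans[of 0 "m * n" H] by simp
  ultimately show "(1 / \<eta> - L) * m * n \<le> (1 / \<eta>) * H" "(1 / \<eta> - L) * m * n \<le> F + (1 / \<eta>) * H"
    using F by (auto simp: algebra_simps)
qed

text \<open>In primal directions only the penalty part \<rho> |gap|^2 survives.\<close>

lemma grad_coupling_nonneg: "(\<And>k. dual k d = 0) \<Longrightarrow> 0 \<le> grad_coupling d \<bullet> d"
  using \<rho> by (auto simp: inner_grad_coupling intro!: sum_nonneg)

lemma block_step_x: "\<exists>m. block_step X \<Theta> \<Psi> \<Theta>' \<Psi>' (proj_x j) m"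
proof -
  obtain m where m: "m > 0" "\<And>x y d. x \<in> Dx j \<Longrightarrow> y \<in> Dy j \<Longrightarrow>
       m * (d \<bullet> d) \<le> Hh j (x, y) (d, 0) \<bullet> (d, 0) \<and>
       0 \<le> Lx j * (Hh j (x, y) (d, 0) \<bullet> (d, 0)) + Hf j (x, y) (d, 0) \<bullet> (d, 0)"
    by (rule biconvex_bounds[of j]) blast
  let ?m = "(1 / \<eta> - Lx j) * m"
  have coerc: "?m * (norm d)\<^sup>2 \<le> \<Theta>' s d \<bullet> d" "?m * (norm d)\<^sup>2 \<le> \<Psi>' s d \<bullet> d"
    if s: "s \<in> X" and d: "proj_x j d = d" for s d
  proof -
    define e where "e = fst d $ j"
    have d: "d = (axis j e, 0, 0)" using d by (simp add: proj_x_def e_def)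
    have nd: "(norm d)\<^sup>2 = e \<bullet> e" by (simp add: d power2_norm_eq_inner inner_axis_axis)
    obtain x y where xy: "loc j s = (x, y)" "x \<in> Dx j" "y \<in> Dy j" using locX[OF s, of j] by auto
    have 1: "\<Theta>' s d \<bullet> d = (1 / \<eta>) * (Hh j (x, y) (e, 0) \<bullet> (e, 0))"
      unfolding inner_\<Theta>' by (simp add: d loc_axis sum_at xy)
    have 2: "\<Psi>' s d \<bullet> d = Hf j (x, y) (e, 0) \<bullet> (e, 0) + grad_coupling d \<bullet> d + \<Theta>' s d \<bullet> d"
      unfolding inner_\<Psi>' by (simp add: d loc_axis sum_at xy)
    have 3: "0 \<le> grad_coupling d \<bullet> d" by (rule grad_coupling_nonneg) (simp add: d dual_def)
    note * = step_size_coercive[OF L_pos(1) \<eta>(2) m(1) conjunct1[OF m(2)] conjunct2[OF m(2)] inner_ge_zero, OF xy(2,3) xy(2,3)]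
    show "?m * (norm d)\<^sup>2 \<le> \<Theta>' s d \<bullet> d" using *(2) unfolding 1 nd .
    show "?m * (norm d)\<^sup>2 \<le> \<Psi>' s d \<bullet> d" using *(3)[of e] 3 unfolding 2 1 nd by linarith
  qed
  have "linear (proj_x j)" by (rule linearI) (auto simp: proj_x_def axis_def vec_eq_iff)
  moreover have "proj_x j d \<bullet> e = d \<bullet> proj_x j e" for d e
    by (simp add: proj_x_def inner_prod_def inner_axis inner_axis')
  moreover have "?m > 0" using \<eta>(1) \<eta>(2)[of j] L_pos(1)[of j] m(1) by (simp add: field_simps)
  ultimately have "block_step X \<Theta> \<Psi> \<Theta>' \<Psi>' (proj_x j) ?m"
    using open_X convex_X \<Theta>_has_derivative \<Psi>_has_derivative \<Theta>'_continuous \<Psi>'_continuous coerc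
    by (intro block_step.intro) (auto simp: proj_x_def)
  then show ?thesis by blast
qed

lemma block_step_y: "\<exists>m. block_step X \<Theta> \<Psi> \<Theta>' \<Psi>' (proj_y j) m"
proof -
  obtain m where m: "m > 0" "\<And>x y d. x \<in> Dx j \<Longrightarrow> y \<in> Dy j \<Longrightarrow> d \<in> block blk j \<Longrightarrow>
       m * (d \<bullet> d) \<le> Hh j (x, y) (0, d) \<bullet> (0, d) \<and>
       0 \<le> Ly j * (Hh j (x, y) (0, d) \<bullet> (0, d)) + Hf j (x, y) (0, d) \<bullet> (0, d)"
    by (rule biconvex_bounds[of j]) blast
  let ?m = "(1 / \<eta> - Ly j) * m"
  have coerc: "?m * (norm d)\<^sup>2 \<le> \<Theta>' s d \<bullet> d" "?m * (norm d)\<^sup>2 \<le> \<Psi>' s d \<bullet> d"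
    if s: "s \<in> X" and d: "proj_y j d = d" for s d
  proof -
    define e where "e = block_part blk j (fst (snd d))"
    have d: "d = (0, e, 0)" using d by (simp add: proj_y_def e_def)
    have e: "e \<in> block blk j" by (simp add: e_def block_part_in_block)
    have nd: "(norm d)\<^sup>2 = e \<bullet> e" by (simp add: d power2_norm_eq_inner)
    obtain x y where xy: "loc j s = (x, y)" "x \<in> Dx j" "y \<in> Dy j" using locX[OF s, of j] by auto
    have 1: "\<Theta>' s d \<bullet> d = (1 / \<eta>) * (Hh j (x, y) (0, e) \<bullet> (0, e))"
      unfolding inner_\<Theta>' by (simp add: d loc_block[OF e] sum_at xy)
    have 2: "\<Psi>' s d \<bullet> d = Hf j (x, y) (0, e) \<bullet> (0, e) + grad_coupling d \<bullet> d + \<Theta>' s d \<bullet> d"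
      unfolding inner_\<Psi>' by (simp add: d loc_block[OF e] sum_at xy)
    have 3: "0 \<le> grad_coupling d \<bullet> d" by (rule grad_coupling_nonneg) (simp add: d dual_def)
    note * = step_size_coercive[OF L_pos(2) \<eta>(3) m(1) conjunct1[OF m(2)] conjunct2[OF m(2)] inner_ge_zero, OF xy(2,3) e xy(2,3) e]
    show "?m * (norm d)\<^sup>2 \<le> \<Theta>' s d \<bullet> d" using *(2) unfolding 1 nd .
    show "?m * (norm d)\<^sup>2 \<le> \<Psi>' s d \<bullet> d" using *(3) 3 unfolding 2 1 nd by linarith
  qed
  have "linear (proj_y j)"
    by (rule linearI) (auto simp: proj_y_def linear_add[OF linear_block_part] linear_scale[OF linear_block_part])
  moreover have "proj_y j d \<bullet> e = d \<bullet> proj_y j e" for d e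
    by (simp add: proj_y_def inner_prod_def block_part_selfadjoint)
  moreover have "?m > 0" using \<eta>(1) \<eta>(3)[of j] L_pos(2)[of j] m(1) by (simp add: field_simps)
  ultimately have "block_step X \<Theta> \<Psi> \<Theta>' \<Psi>' (proj_y j) ?m"
    using open_X convex_X \<Theta>_has_derivative \<Psi>_has_derivative \<Theta>'_continuous \<Psi>'_continuous coerc
    by (intro block_step.intro) (auto simp: proj_y_def block_part_block_part)
  then show ?thesis by blast
qed

end

lemma sum_option: "(\<Sum>j\<in>UNIV. g j) = g None + (\<Sum>k\<in>UNIV. g (Some k))"
  for g :: "'k::finite option \<Rightarrow> 'a::comm_monoid_add"
proof -
  have "(\<Sum>j\<in>UNIV. g j) = g None + (\<Sum>j\<in>range Some. g j)"
    by (simp add: UNIV_option_conv)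
  also have "(\<Sum>j\<in>range Some. g j) = (\<Sum>k\<in>UNIV. g (Some k))"
    by (simp add: sum.reindex)
  finally show ?thesis .
qed

lemma sorted_list_of_set_prefix:
  fixes j :: "'j::{finite,linorder}"
  assumes "sorted_list_of_set UNIV = ys @ j # zs"
  shows "sorted_list_of_set {..<j} = ys" "set ys = {..<j}"
proof -
  have "sorted_wrt (<) (ys @ j # zs)" by (simp flip: assms)
  then have s: "sorted_wrt (<) ys" "\<forall>x\<in>set ys. x < j" "\<forall>x\<in>set zs. j < x"
    by (auto simp: sorted_wrt_append)
  have "x \<in> set (ys @ j # zs)" for x by (simp flip: assms)
  then have "x \<in> set ys \<or> x = j \<or> x \<in> set zs" for x by auto
  then show *: "set ys = {..<j}" using s(2,3) by (force dest: order.asym)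
  have "sorted_list_of_set (set ys) = ys"
    using s(1) by (simp add: sorted_list_of_set.idem_if_sorted_distinct strict_sorted_iff)
  then show "sorted_list_of_set {..<j} = ys" by (simp add: *)
qed

lemma locally_inverse_lipschitz_on_linear:
  fixes T :: "'a::euclidean_space \<Rightarrow> 'b::euclidean_space"
  assumes "linear T" "inj T"
  shows "locally_inverse_lipschitz_on T X"
proof -
  obtain B where B: "B > 0" "\<And>x. B * norm x \<le> norm (T x)"
    using linear_inj_bounded_below_pos[OF assms] by metis
  have "norm (z' - z) \<le> 1 / B * norm (T z' - T z)" for z z'
    using B(2)[of "z' - z"] B(1) by (simp add: linear_diff[OF assms(1)] field_simps)
  then show ?thesis unfolding locally_inverse_lipschitz_on_def by (meson zero_less_one)
qed

context consensus_admm
begin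

abbreviation "xstep \<equiv> x_step blk \<rho> \<eta> f h Dx"
abbreviation "ystep \<equiv> y_step blk \<rho> \<eta> f h Dy"
abbreviation "xrel j \<equiv> block_step.step_rel X \<Theta> \<Psi> (proj_x j)"
abbreviation "yrel j \<equiv> block_step.step_rel X \<Theta> \<Psi> (proj_y j)"

section \<open>Minimizers as solutions of the block equations\<close>

lemma loc_x_update:
  "loc i (upd_vec j u (fst s), snd s) = (if i = j then (u, block_part blk j (fst (snd s))) else loc i s)"
  by (auto simp: loc_def upd_vec_def)

lemma loc_y_update:
  "v \<in> block blk j \<Longrightarrow>
    loc i (fst s, upd_block blk j v (fst (snd s)), snd (snd s)) = (if i = j then (fst s $ j, v) else loc i s)"
  by (auto simp: loc_def upd_block_def block_part_def block_def vec_eq_iff)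

lemma Hfun_update:
  assumes "\<And>i. loc i t = (if i = j then (u, v) else loc i s)"
  shows "Hfun t - Hfun s = (1 / \<eta>) * (h j u v - (\<lambda>(u, v). h j u v) (loc j s))"
proof -
  have "(\<Sum>i\<in>UNIV. (\<lambda>(u, v). h i u v) (loc i t)) - (\<Sum>i\<in>UNIV. (\<lambda>(u, v). h i u v) (loc i s)) =
    (\<Sum>i\<in>UNIV. if i = j then h j u v - (\<lambda>(u, v). h j u v) (loc j s) else 0)"
    unfolding sum_subtractf[symmetric] by (intro sum.cong) (auto simp: assms)
  then show ?thesis by (simp add: Hfun_def diff_divide_distrib[symmetric])
qed

text \<open>Brings the subproblem into the form that \<open>step_relI_minimizer\<close> expects; the
  last bracket is constant in u.\<close>

lemma x_objective_eq:
  assumes s: "s \<in> X"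
  shows "x_objective blk \<rho> \<eta> f h j s u =
    (aug_lagrangian blk \<rho> f (upd_vec j u (fst s), snd s) + Hfun (upd_vec j u (fst s), snd s)
      - \<Theta> s \<bullet> (upd_vec j u (fst s), snd s)) - (Hfun s - \<Theta> s \<bullet> s)"
proof -
  define t where "t = (\<lambda>u. (upd_vec j u (fst s), snd s))"
  let ?x = "fst s $ j" and ?y = "block_part blk j (fst (snd s))"
  have xy: "loc j s = (?x, ?y)" "?x \<in> Dx j" "?y \<in> Dy j" using locX[OF s, of j] by (auto simp: loc_def)
  have 1: "Hfun (t u) - Hfun s = (1 / \<eta>) * (h j u ?y - h j ?x ?y)"
    using Hfun_update[of "t u" j u ?y s] by (simp add: t_def loc_x_update xy)
  have "t u - s = (axis j (u - ?x), 0, 0)" by (cases s) (simp add: t_def upd_vec_eq zero_prod_def)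
  then have "\<Theta> s \<bullet> (t u - s) = (1 / \<eta>) * (Gh j (?x, ?y) \<bullet> (u - ?x, 0))"
    by (simp only: inner_\<Theta> loc_axis sum_at xy(1))
  then have 2: "\<Theta> s \<bullet> (t u - s) = (1 / \<eta>) * (gradient UNIV (\<lambda>u. h j u ?y) ?x \<bullet> (u - ?x))"
    by (simp only: hp.gradient_x[OF xy(2,3)]) (simp add: inner_prod_def)
  have "x_objective blk \<rho> \<eta> f h j s u = 1 / \<eta> * bregman_x (h j) u ?x ?y + aug_lagrangian blk \<rho> f (t u)"
    by (cases s) (simp add: x_objective_def t_def)
  also have "1 / \<eta> * bregman_x (h j) u ?x ?y = Hfun (t u) - Hfun s - \<Theta> s \<bullet> (t u - s)"
    unfolding 1 2 bregman_x_def by (simp add: algebra_simps diff_divide_distrib)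
  finally show ?thesis by (simp add: inner_diff_right t_def)
qed

lemma y_objective_eq:
  assumes s: "s \<in> X" and v: "v \<in> block blk j"
  shows "y_objective blk \<rho> \<eta> f h j s v =
    (aug_lagrangian blk \<rho> f (fst s, upd_block blk j v (fst (snd s)), snd (snd s))
      + Hfun (fst s, upd_block blk j v (fst (snd s)), snd (snd s))
      - \<Theta> s \<bullet> (fst s, upd_block blk j v (fst (snd s)), snd (snd s))) - (Hfun s - \<Theta> s \<bullet> s)"
proof -
  define t where "t = (\<lambda>v. (fst s, upd_block blk j v (fst (snd s)), snd (snd s)))"
  let ?x = "fst s $ j" and ?y = "block_part blk j (fst (snd s))"
  have xy: "loc j s = (?x, ?y)" "?x \<in> Dx j" "?y \<in> Dy j" using locX[OF s, of j] by (auto simp: loc_def)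
  have 1: "Hfun (t v) - Hfun s = (1 / \<eta>) * (h j ?x v - h j ?x ?y)"
    using Hfun_update[of "t v" j ?x v s] by (simp add: t_def loc_y_update v xy)
  have vy: "v - ?y \<in> block blk j" by (intro subspace_diff subspace_block v block_part_in_block)
  have "t v - s = (0, v - ?y, 0)" by (cases s) (simp add: t_def upd_block_eq v)
  then have "\<Theta> s \<bullet> (t v - s) = (1 / \<eta>) * (Gh j (?x, ?y) \<bullet> (0, v - ?y))"
    by (simp only: inner_\<Theta> loc_block[OF vy] sum_at xy(1))
  then have 2: "\<Theta> s \<bullet> (t v - s) = (1 / \<eta>) * (gradient (block blk j) (\<lambda>v. h j ?x v) ?y \<bullet> (v - ?y))"
    by (simp only: hp.gradient_y[OF xy(2,3)]) (simp add: inner_prod_def)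
  have "y_objective blk \<rho> \<eta> f h j s v = 1 / \<eta> * bregman_y (block blk j) (h j) v ?y ?x + aug_lagrangian blk \<rho> f (t v)"
    by (cases s) (simp add: y_objective_def t_def)
  also have "1 / \<eta> * bregman_y (block blk j) (h j) v ?y ?x = Hfun (t v) - Hfun s - \<Theta> s \<bullet> (t v - s)"
    unfolding 1 2 bregman_y_def by (simp add: algebra_simps diff_divide_distrib)
  finally show ?thesis by (simp add: inner_diff_right t_def)
qed

lemma arg_min_on_minimizes:
  assumes "\<exists>u. is_arg_min F (\<lambda>u. u \<in> D) (u :: 'a)"
  shows "arg_min_on F D \<in> D" "u \<in> D \<Longrightarrow> F (arg_min_on F D) \<le> (F u :: real)"
  using someI_ex[OF assms] unfolding arg_min_on_def arg_min_def is_arg_min_def by (auto simp: not_less)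

lemma xstep_rel:
  assumes s: "s \<in> X" and ex: "\<exists>u. is_arg_min (x_objective blk \<rho> \<eta> f h j s) (\<lambda>u. u \<in> Dx j) u"
  shows "xrel j s (xstep j s)"
proof -
  obtain m where "block_step X \<Theta> \<Psi> \<Theta>' \<Psi>' (proj_x j) m" using block_step_x[of j] ..
  then interpret block_step X \<Theta> \<Psi> \<Theta>' \<Psi>' "proj_x j" m .
  define u where "u = arg_min_on (x_objective blk \<rho> \<eta> f h j s) (Dx j)"
  let ?t = "\<lambda>u. (upd_vec j u (fst s), snd s)"
  have eq: "xstep j s = ?t u" by (cases s) (simp add: x_step_def u_def)
  have u: "u \<in> Dx j" using arg_min_on_minimizes(1)[OF ex] by (simp add: u_def)
  have t: "?t u \<in> X" using s u by (auto simp: X_def loc_x_update) (auto simp: loc_def)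
  show ?thesis unfolding eq
  proof (rule step_relI_minimizer[OF s t _ objective_has_derivative[OF t]])
    show "proj_x j (?t u - s) = ?t u - s" by (cases s) (simp add: proj_x_def upd_vec_eq zero_prod_def)
    \<comment> \<open>Any competitor in X that differs from s only in this block comes from a
      feasible u', so minimality over \<open>Dx j\<close> covers it.\<close>
    fix t' assume t': "t' \<in> X" "proj_x j (t' - s) = t' - s"
    define u' where "u' = fst t' $ j"
    have "t' = s + proj_x j (t' - s)" by (simp add: t'(2))
    then have t'_eq: "t' = ?t u'" by (cases s) (simp add: proj_x_def upd_vec_eq u'_def)
    have "u' \<in> Dx j" using locX[OF t'(1), of j] by (simp add: loc_def u'_def)
    then have "x_objective blk \<rho> \<eta> f h j s u \<le> x_objective blk \<rho> \<eta> f h j s u'"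
      using arg_min_on_minimizes(2)[OF ex] by (simp add: u_def)
    then show "aug_lagrangian blk \<rho> f (?t u) + Hfun (?t u) - \<Theta> s \<bullet> ?t u \<le>
        aug_lagrangian blk \<rho> f t' + Hfun t' - \<Theta> s \<bullet> t'"
      unfolding x_objective_eq[OF s] t'_eq by simp
  qed
qed

lemma ystep_rel:
  assumes s: "s \<in> X" and ex: "\<exists>v. is_arg_min (y_objective blk \<rho> \<eta> f h j s) (\<lambda>v. v \<in> Dy j) v"
  shows "yrel j s (ystep j s)"
proof -
  obtain m where "block_step X \<Theta> \<Psi> \<Theta>' \<Psi>' (proj_y j) m" using block_step_y[of j] ..
  then interpret block_step X \<Theta> \<Psi> \<Theta>' \<Psi>' "proj_y j" m .
  define v where "v = arg_min_on (y_objective blk \<rho> \<eta> f h j s) (Dy j)"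
  let ?t = "\<lambda>v. (fst s, upd_block blk j v (fst (snd s)), snd (snd s))"
  have eq: "ystep j s = ?t v" by (cases s) (simp add: y_step_def v_def)
  have v: "v \<in> Dy j" using arg_min_on_minimizes(1)[OF ex] by (simp add: v_def)
  have vb: "v \<in> block blk j" using v hp.Dy_subset by blast
  have t: "?t v \<in> X" using s v vb by (auto simp: X_def loc_y_update) (auto simp: loc_def)
  show ?thesis unfolding eq
  proof (rule step_relI_minimizer[OF s t _ objective_has_derivative[OF t]])
    show "proj_y j (?t v - s) = ?t v - s"
      by (cases s) (simp add: proj_y_def upd_block_eq vb linear_diff[OF linear_block_part]
        block_part_of_block[OF vb] block_part_block_part)
    fix t' assume t': "t' \<in> X" "proj_y j (t' - s) = t' - s"
    define v' where "v' = block_part blk j (fst (snd t'))"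
    have v'b: "v' \<in> block blk j" by (simp add: v'_def block_part_in_block)
    have "t' = s + proj_y j (t' - s)" by (simp add: t'(2))
    then have "t' = s + (0, v' - block_part blk j (fst (snd s)), 0)"
      by (simp only: proj_y_def fst_diff snd_diff linear_diff[OF linear_block_part] v'_def)
    then have t'_eq: "t' = ?t v'"
      by (cases s) (simp add: upd_block_eq[OF v'b])
    have "v' \<in> Dy j" using locX[OF t'(1), of j] by (simp add: loc_def v'_def)
    then have "y_objective blk \<rho> \<eta> f h j s v \<le> y_objective blk \<rho> \<eta> f h j s v'"
      using arg_min_on_minimizes(2)[OF ex] by (simp add: v_def)
    then show "aug_lagrangian blk \<rho> f (?t v) + Hfun (?t v) - \<Theta> s \<bullet> ?t v \<le>
        aug_lagrangian blk \<rho> f t' + Hfun t' - \<Theta> s \<bullet> t'"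
      unfolding y_objective_eq[OF s vb] y_objective_eq[OF s v'b] t'_eq by simp
  qed
qed

text \<open>KKT points are critical points of the augmented Lagrangian in all its variables,
  multipliers included, because the penalty gradient vanishes at consensus. Hence \<Psi> and
  \<Theta> agree there, and every block update fixes such a point.\<close>

lemma grad_L_KKT:
  assumes z: "z \<in> X" and KKT: "KKT_point blk f z"
  shows "grad_L z = 0" "gap k z = 0"
proof -
  obtain x y l where zz: "z = (x, y, l)" by (cases z)
  have K: "\<And>k. x $ Some k = x $ None"
    "gradient UNIV (\<lambda>u. f None u (block_part blk None y)) (x $ None) = (\<Sum>k\<in>UNIV. l $ k)"
    "\<And>k. gradient UNIV (\<lambda>u. f (Some k) u (block_part blk (Some k) y)) (x $ Some k) = - l $ k"
    "\<And>j. gradient (block blk j) (\<lambda>v. f j (x $ j) v) (block_part blk j y) = 0"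
    using KKT by (auto simp: KKT_point_def zz eq_neg_iff_add_eq_0)
  have gap0: "gap k z = 0" for k by (simp add: gap_def zz K(1))
  then show "gap k z = 0" .
  have xy: "x $ j \<in> Dx j" "block_part blk j y \<in> Dy j" "loc j z = (x $ j, block_part blk j y)" for j
    using locX[OF z, of j] by (auto simp: zz loc_def)
  have G: "Gf j (loc j z) \<bullet> loc j e = gradient UNIV (\<lambda>u. f j u (block_part blk j y)) (x $ j) \<bullet> fst e $ j" for j e
    using K(4)[of j] fp.gradient_x[OF xy(1,2), of j] fp.gradient_y[OF xy(1,2), of j]
    unfolding xy(3) by (simp add: inner_prod_def loc_def)
  have "grad_L z \<bullet> e = 0" for e
    unfolding inner_grad_L inner_grad_coupling G sum_option K(2,3) gap0
    by (simp add: inner_sum_left gap_def dual_def zz inner_diff_right sum_subtractf sum_negf)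
  from this[of "grad_L z"] show "grad_L z = 0" by simp
qed

text \<open>
  The vector reached by the linearized sweep from an eigenvector \<open>v\<close> for \<open>\<mu>\<close> once the \<open>x\<close>-blocks
  in \<open>A\<close> and the \<open>y\<close>-blocks in \<open>B\<close> have been updated.
\<close>

definition mixed :: "real \<Rightarrow> ('n, 'm, 'k) state \<Rightarrow> 'k option set \<Rightarrow> 'k option set \<Rightarrow> ('n, 'm, 'k) state" where
  "mixed \<mu> v A B = ((\<chi> j. (if j \<in> A then \<mu> else 1) *\<^sub>R fst v $ j),
     (\<chi> i. (if blk i \<in> B then \<mu> else 1) * fst (snd v) $ i), snd (snd v))"

lemma proj_x_mixed: "proj_x j (mixed \<mu> v {..j} B - mixed \<mu> v {..<j} B) = mixed \<mu> v {..j} B - mixed \<mu> v {..<j} B"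
  by (auto simp: proj_x_def mixed_def axis_def vec_eq_iff zero_prod_def)

lemma proj_y_mixed: "proj_y j (mixed \<mu> v A {..j} - mixed \<mu> v A {..<j}) = mixed \<mu> v A {..j} - mixed \<mu> v A {..<j}"
  by (auto simp: proj_y_def mixed_def block_part_def vec_eq_iff)

text \<open>The derivative of a sweep is a product of many factors; the eigenvector equation is
  instead imposed factor by factor. Each update must multiply its own block by \<mu> while later
  blocks still carry v. The last clause is the multiplier update, \<lambda> + \<rho> \<mu> gap =
  \<mu> \<lambda>.\<close>

definition linearized_eigenvector :: "('n, 'm, 'k) state \<Rightarrow> real \<Rightarrow> ('n, 'm, 'k) state \<Rightarrow> bool" where
  "linearized_eigenvector z \<mu> v \<longleftrightarrow>
     (\<forall>j. proj_x j (\<Psi>' z (mixed \<mu> v {..j} {..<j})) = proj_x j (\<Theta>' z (mixed \<mu> v {..<j} {..<j}))) \<and>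
     (\<forall>j. proj_y j (\<Psi>' z (mixed \<mu> v {..j} {..j})) = proj_y j (\<Theta>' z (mixed \<mu> v {..j} {..<j}))) \<and>
     (\<forall>k. (\<mu> - 1) *\<^sub>R dual k v = (\<rho> * \<mu>) *\<^sub>R gap k v)"

end

locale consensus_admm_invariant = consensus_admm blk \<rho> \<eta> Dx Dy f h Lx Ly
  for blk :: "'m::finite \<Rightarrow> 'k::{finite,linorder} option" and \<rho> \<eta> Dx Dy
    and f h :: "'k option \<Rightarrow> real^'n::finite \<Rightarrow> real^'m \<Rightarrow> real" and Lx Ly +
  fixes \<Omega> :: "('n, 'm, 'k) state set"
  assumes \<Omega>_subset: "\<Omega> \<subseteq> X"
    and well_defined: "admm_well_defined_on blk \<rho> \<eta> f h Dx Dy \<Omega>"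
begin

section \<open>The sweep and its linearization\<close>

definition astep :: "'k option \<Rightarrow> ('n, 'm, 'k) state \<Rightarrow> ('n, 'm, 'k) state" where
  "astep j = ystep j \<circ> xstep j"

lemma sweep_eq: "sweep blk \<rho> \<eta> f h Dx Dy A = fold astep (sorted_list_of_set A)"
  unfolding sweep_def astep_def[abs_def] ..

lemma step_rels:
  assumes l: "sorted_list_of_set UNIV = ys @ j # zs" and z: "z \<in> \<Omega>" and s: "fold astep ys z \<in> X"
  shows "xrel j (fold astep ys z) (xstep j (fold astep ys z))"
    "yrel j (xstep j (fold astep ys z)) (astep j (fold astep ys z))"
proof -
  obtain m where bs: "block_step X \<Theta> \<Psi> \<Theta>' \<Psi>' (proj_x j) m" using block_step_x[of j] ..
  have sw: "sweep blk \<rho> \<eta> f h Dx Dy {..<j} z = fold astep ys z"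
    by (simp add: sweep_eq sorted_list_of_set_prefix(1)[OF l])
  note wd = well_defined[unfolded admm_well_defined_on_def, rule_format, OF z, of j, unfolded Let_def sw]
  show *: "xrel j (fold astep ys z) (xstep j (fold astep ys z))"
    using xstep_rel[OF s] wd by blast
  then have "xstep j (fold astep ys z) \<in> X" by (simp add: block_step.step_rel_def[OF bs])
  then show "yrel j (xstep j (fold astep ys z)) (astep j (fold astep ys z))"
    using ystep_rel wd by (simp add: astep_def)
qed

lemma step_rels_image:
  assumes l: "sorted_list_of_set UNIV = ys @ j # zs" and sub: "fold astep ys ` \<Omega> \<subseteq> X"
  shows "s \<in> fold astep ys ` \<Omega> \<Longrightarrow> xrel j s (xstep j s)"
    "s \<in> xstep j ` fold astep ys ` \<Omega> \<Longrightarrow> yrel j s (ystep j s)"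
proof -
  assume "s \<in> fold astep ys ` \<Omega>"
  then obtain z where z: "z \<in> \<Omega>" "s = fold astep ys z" by blast
  then have "fold astep ys z \<in> X" using sub by blast
  from step_rels(1)[OF l z(1) this] show "xrel j s (xstep j s)" by (simp only: z(2))
next
  assume "s \<in> xstep j ` fold astep ys ` \<Omega>"
  then obtain z where z: "z \<in> \<Omega>" "s = xstep j (fold astep ys z)" by blast
  then have "fold astep ys z \<in> X" using sub by blast
  from step_rels(2)[OF l z(1) this] show "yrel j s (ystep j s)" by (simp only: z(2) astep_def comp_apply)
qed

text \<open>Minimizers are known to exist only at states reached from \<Omega>, so the domain of
  each update is the image of \<Omega> under the preceding ones, and the induction appends agents at
  the end.\<close>

lemma sweep_prefix:
  assumes "sorted_list_of_set UNIV = ys @ zs"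
  shows "fold astep ys ` \<Omega> \<subseteq> X \<and> locally_inverse_lipschitz_on (fold astep ys) \<Omega>"
  using assms
proof (induction ys arbitrary: zs rule: rev_induct)
  case Nil
  have "locally_inverse_lipschitz_on (\<lambda>z::('n, 'm, 'k) state. z) \<Omega>"
    by (rule locally_inverse_lipschitz_on_linear) (auto simp: linear_iff)
  then show ?case using \<Omega>_subset by (simp add: id_def)
next
  case (snoc j ys)
  then have l: "sorted_list_of_set UNIV = ys @ j # zs" by simp
  note IH = snoc.IH[OF l]
  obtain m where x: "block_step X \<Theta> \<Psi> \<Theta>' \<Psi>' (proj_x j) m" using block_step_x[of j] ..
  obtain m' where y: "block_step X \<Theta> \<Psi> \<Theta>' \<Psi>' (proj_y j) m'" using block_step_y[of j] ..
  let ?Y = "fold astep ys ` \<Omega>"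
  have xr: "xrel j s (xstep j s)" if "s \<in> ?Y" for s using step_rels_image(1)[OF l conjunct1[OF IH] that] .
  have yr: "yrel j s (ystep j s)" if "s \<in> xstep j ` ?Y" for s 
    using step_rels_image(2)[OF l conjunct1[OF IH] that] .
  have eq: "fold astep (ys @ [j]) = ystep j \<circ> (xstep j \<circ> fold astep ys)"
    by (simp add: astep_def comp_assoc)
  have "ystep j s \<in> X" if "s \<in> xstep j ` ?Y" for s
    using yr[OF that] unfolding block_step.step_rel_def[OF y] by blast
  then have "fold astep (ys @ [j]) ` \<Omega> \<subseteq> X"
    unfolding eq image_comp[symmetric] by (rule image_subsetI)
  moreover have "locally_inverse_lipschitz_on (ystep j \<circ> (xstep j \<circ> fold astep ys)) \<Omega>"
    by (intro locally_inverse_lipschitz_on_compose conjunct2[OF IH]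
        block_step.locally_inverse_lipschitz_on_step[OF x] block_step.locally_inverse_lipschitz_on_step[OF y])
      (simp_all only: image_comp[symmetric] xr yr)
  ultimately show ?case unfolding eq by blast
qed

text \<open>Every partial update fixes z, so the strict derivatives are all taken at z and compose.
  The derivative is tracked only on v.\<close>

lemma sweep_prefix_linearized:
  assumes z: "z \<in> \<Omega>" "KKT_point blk f z" and ev: "linearized_eigenvector z \<mu> v"
    and "sorted_list_of_set UNIV = ys @ zs"
  shows "fold astep ys z = z \<and>
    (\<exists>T. has_strict_derivative_on (fold astep ys) T \<Omega> z \<and> T v = mixed \<mu> v (set ys) (set ys))"
  using assms(4)
proof (induction ys arbitrary: zs rule: rev_induct)
  case Nil
  have "has_strict_derivative_on (\<lambda>z. z) (\<lambda>z. z) \<Omega> z"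
    by (rule has_strict_derivative_on_linear) (auto simp: linear_iff)
  moreover have "mixed \<mu> v {} {} = v" by (cases v) (simp add: mixed_def vec_eq_iff)
  ultimately show ?case by (auto simp: id_def)
next
  case (snoc j ys)
  then have l: "sorted_list_of_set UNIV = ys @ j # zs" by simp
  note pre = sweep_prefix[OF l]
  obtain T where T: "has_strict_derivative_on (fold astep ys) T \<Omega> z" "T v = mixed \<mu> v {..<j} {..<j}"
    and fz: "fold astep ys z = z"
    using snoc.IH[OF l] sorted_list_of_set_prefix(2)[OF l] by auto
  obtain m where x: "block_step X \<Theta> \<Psi> \<Theta>' \<Psi>' (proj_x j) m" using block_step_x[of j] ..
  obtain m' where y: "block_step X \<Theta> \<Psi> \<Theta>' \<Psi>' (proj_y j) m'" using block_step_y[of j] ..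
  let ?Y = "fold astep ys ` \<Omega>"
  have xr: "xrel j s (xstep j s)" if "s \<in> ?Y" for s using step_rels_image(1)[OF l conjunct1[OF pre] that] .
  have yr: "yrel j s (ystep j s)" if "s \<in> xstep j ` ?Y" for s 
    using step_rels_image(2)[OF l conjunct1[OF pre] that] .
  have zX: "z \<in> X" using z \<Omega>_subset by auto
  have fixed: "\<Psi> z = \<Theta> z" by (simp add: \<Psi>_def grad_L_KKT[OF zX z(2)])
  have zY: "z \<in> ?Y" using fz z(1) by (metis imageI)
  have xz: "xstep j z = z"
    by (rule block_step.step_at_fixed_point[OF x zX _ xr[OF zY]]) (simp add: fixed)
  have zY': "z \<in> xstep j ` ?Y" using xz zY by (metis imageI)
  have yz: "ystep j z = z"
    by (rule block_step.step_at_fixed_point[OF y zX _ yr[OF zY']]) (simp add: fixed)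
  obtain Tx where Tx: "has_strict_derivative_on (xstep j) Tx ?Y z"
    "\<And>v v'. proj_x j (v' - v) = v' - v \<Longrightarrow> proj_x j (\<Psi>' z v') = proj_x j (\<Theta>' z v) \<Longrightarrow> Tx v = v'"
    by (rule block_step.has_strict_derivative_on_step[OF x xr zX]) (auto simp: fixed)
  obtain Ty where Ty: "has_strict_derivative_on (ystep j) Ty (xstep j ` ?Y) z"
    "\<And>v v'. proj_y j (v' - v) = v' - v \<Longrightarrow> proj_y j (\<Psi>' z v') = proj_y j (\<Theta>' z v) \<Longrightarrow> Ty v = v'"
    by (rule block_step.has_strict_derivative_on_step[OF y yr zX]) (auto simp: fixed)
  have "Tx (mixed \<mu> v {..<j} {..<j}) = mixed \<mu> v {..j} {..<j}"
    using ev by (intro Tx(2) proj_x_mixed) (auto simp: linearized_eigenvector_def)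
  moreover have "Ty (mixed \<mu> v {..j} {..<j}) = mixed \<mu> v {..j} {..j}"
    using ev by (intro Ty(2) proj_y_mixed) (auto simp: linearized_eigenvector_def)
  ultimately have "(Ty \<circ> (Tx \<circ> T)) v = mixed \<mu> v {..j} {..j}" using T(2) by simp
  moreover have "{..j} = set (ys @ [j])"
    by (simp add: sorted_list_of_set_prefix(2)[OF l] flip: ivl_disj_un_singleton(2))
  moreover have "has_strict_derivative_on (xstep j \<circ> fold astep ys) (Tx \<circ> T) \<Omega> z"
    by (rule has_strict_derivative_on_compose[OF T(1) _ z(1) subset_refl]) (simp add: fz Tx(1))
  then have "has_strict_derivative_on (ystep j \<circ> (xstep j \<circ> fold astep ys)) (Ty \<circ> (Tx \<circ> T)) \<Omega> z"
    by (rule has_strict_derivative_on_compose[where Y = "xstep j ` ?Y", OF _ _ z(1)])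
      (auto simp: fz xz Ty(1))
  moreover have "fold astep (ys @ [j]) = ystep j \<circ> (xstep j \<circ> fold astep ys)"
    by (simp add: astep_def comp_assoc)
  moreover have "(ystep j \<circ> (xstep j \<circ> fold astep ys)) z = z" by (simp add: fz xz yz)
  ultimately show ?case by metis
qed

lemma linear_dual_step: "linear (dual_step \<rho> :: ('n, 'm, 'k) state \<Rightarrow> _)"
proof (rule linearI)
  fix s t :: "('n, 'm, 'k) state" and c :: real
  show "dual_step \<rho> (s + t) = dual_step \<rho> s + dual_step \<rho> t"
    by (cases s; cases t) (simp add: dual_step_def vec_eq_iff algebra_simps)
  show "dual_step \<rho> (c *\<^sub>R s) = c *\<^sub>R dual_step \<rho> s"
    by (cases s) (simp add: dual_step_def vec_eq_iff algebra_simps)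
qed

lemma admm_map_locally_inverse_lipschitz:
  "locally_inverse_lipschitz_on (admm_map blk \<rho> \<eta> f h Dx Dy) \<Omega>"
proof -
  have "inj (dual_step \<rho> :: ('n, 'm, 'k) state \<Rightarrow> _)"
    by (rule injI) (auto simp: dual_step_def vec_eq_iff)
  then show ?thesis
    unfolding admm_map_def sweep_eq
    using sweep_prefix[of "sorted_list_of_set UNIV" "[]"]
    by (auto intro: locally_inverse_lipschitz_on_compose locally_inverse_lipschitz_on_linear[OF linear_dual_step])
qed

lemma admm_map_strict_derivative:
  assumes z: "z \<in> \<Omega>" "KKT_point blk f z" and ev: "linearized_eigenvector z \<mu> v"
  obtains T where "has_strict_derivative_on (admm_map blk \<rho> \<eta> f h Dx Dy) T \<Omega> z" "T v = \<mu> *\<^sub>R v"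
proof -
  let ?F = "sweep blk \<rho> \<eta> f h Dx Dy UNIV"
  obtain T where T: "has_strict_derivative_on ?F T \<Omega> z" "T v = mixed \<mu> v UNIV UNIV"
    using sweep_prefix_linearized[OF z ev, of "sorted_list_of_set UNIV" "[]"] by (auto simp: sweep_eq)
  have "has_strict_derivative_on (dual_step \<rho> \<circ> ?F) (dual_step \<rho> \<circ> T) \<Omega> z"
    by (rule has_strict_derivative_on_compose[OF T(1) has_strict_derivative_on_linear[OF linear_dual_step] z(1) subset_UNIV])
      (simp add: linear_diff[OF linear_dual_step])
  moreover have "(dual_step \<rho> \<circ> T) v = \<mu> *\<^sub>R v"
  proof -
    have "snd (snd v) $ k + \<rho> *\<^sub>R (\<mu> *\<^sub>R fst v $ Some k - \<mu> *\<^sub>R fst v $ None) = \<mu> *\<^sub>R snd (snd v) $ k" for k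
    proof -
      have "(\<mu> - 1) *\<^sub>R dual k v = (\<rho> * \<mu>) *\<^sub>R gap k v" using ev by (simp add: linearized_eigenvector_def)
      then show ?thesis by (simp add: dual_def gap_def algebra_simps)
    qed
    then show ?thesis unfolding comp_def T(2) by (cases v) (auto simp: mixed_def dual_step_def vec_eq_iff)
  qed
  ultimately show ?thesis using that by (simp add: admm_map_def)
qed

end

section \<open>An unstable eigenvector at a strict saddle\<close>

text \<open>The quadratic form is minimal at v, so its derivative in every direction w
  vanishes.\<close>

lemma psd_form_kernel:
  fixes B :: "'w::real_vector \<Rightarrow> 'w \<Rightarrow> real"
  assumes lin: "\<And>v. linear (B v)" and sym: "\<And>v w. B v w = B w v"
    and psd: "\<And>w. 0 \<le> B w w" and v: "B v v = 0"
  shows "B v w = 0"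
proof (rule ccontr)
  assume nz: "B v w \<noteq> 0"
  define \<gamma> where "\<gamma> = B w w"
  \<comment> \<open>The minimizing step would divide by B w w, which may be 0; with \<gamma> + 1 the
    value is still negative.\<close>
  define t where "t = - B v w / (\<gamma> + 1)"
  have \<gamma>: "\<gamma> + 1 > 0" using psd[of w] by (simp add: \<gamma>_def)
  have "B (v + t *\<^sub>R w) (v + t *\<^sub>R w) = 2 * t * B v w + t\<^sup>2 * \<gamma>"
    using sym[of "v + t *\<^sub>R w" v] sym[of "v + t *\<^sub>R w" w]
    by (simp add: linear_add[OF lin] linear_scale[OF lin] v sym[of w v] \<gamma>_def power2_eq_square algebra_simps)
  then have "0 \<le> 2 * t * B v w + t\<^sup>2 * \<gamma>" using psd by metis
  moreover have "B v w = - t * (\<gamma> + 1)" using \<gamma> by (simp add: t_def)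
  then have "2 * t * B v w + t\<^sup>2 * \<gamma> = - (t\<^sup>2 * (\<gamma> + 2))" by algebra
  moreover have "t\<^sup>2 * (\<gamma> + 2) > 0" using nz \<gamma> by (simp add: t_def)
  ultimately show False by linarith
qed

text \<open>
  At the largest parameter for which the form is not positive definite it is still positive
  semidefinite, so a zero of the quadratic form lies in the kernel.
\<close>

lemma form_family_kernel:
  fixes B :: "real \<Rightarrow> 'w::euclidean_space \<Rightarrow> 'w \<Rightarrow> real"
  assumes lin: "\<And>\<mu> v. linear (B \<mu> v)" and sym: "\<And>\<mu> v w. B \<mu> v w = B \<mu> w v"
    and cont: "continuous_on ({a..b} \<times> UNIV) (\<lambda>z. B (fst z) (snd z) (snd z))"
    and neg: "B a w0 w0 < 0" and pos: "\<And>w. w \<noteq> 0 \<Longrightarrow> 0 < B b w w" and "a \<le> b"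
  obtains \<mu> v where "a \<le> \<mu>" "v \<noteq> 0" "\<And>w. B \<mu> v w = 0"
proof -
  let ?\<phi> = "\<lambda>z. B (fst z) (snd z) (snd z)"
  \<comment> \<open>Normalizing the vectors makes this set compact, so a largest parameter with a
    nonpositive value exists.\<close>
  define C where "C = {z \<in> {a..b} \<times> sphere 0 1. ?\<phi> z \<le> 0}"
  have scale: "B \<mu> (c *\<^sub>R w) (c *\<^sub>R w) = c\<^sup>2 * B \<mu> w w" for \<mu> c w
    using sym[of \<mu> "c *\<^sub>R w" w] by (simp add: linear_scale[OF lin] power2_eq_square)
  have unit: "(\<mu>, (1 / norm w) *\<^sub>R w) \<in> C" if "B \<mu> w w < 0" "\<mu> \<in> {a..b}" for \<mu> w
  proof -
    have "w \<noteq> 0" using that linear_0[OF lin[of \<mu> 0]] by auto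
    then show ?thesis using that by (simp add: C_def scale mult_nonneg_nonpos)
  qed
  let ?S = "{a..b} \<times> sphere (0::'w) 1"
  have "continuous_on ?S ?\<phi>" using cont by (rule continuous_on_subset) auto
  then have cl: "closed (?S \<inter> ?\<phi> -` {..0})"
    by (intro continuous_closed_preimage closed_Times) auto
  have eq: "C = ?S \<inter> (?S \<inter> ?\<phi> -` {..0})" by (auto simp: C_def)
  have "compact ?S" by (intro compact_Times) auto
  from compact_Int_closed[OF this cl] have "compact C" by (simp only: eq)
  then have "compact (fst ` C)" by (intro compact_continuous_image continuous_on_fst continuous_on_id)
  moreover have "fst ` C \<noteq> {}" using unit[OF neg] \<open>a \<le> b\<close> by auto
  ultimately obtain \<mu> where \<mu>: "\<mu> \<in> fst ` C" "\<And>t. t \<in> fst ` C \<Longrightarrow> t \<le> \<mu>"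
    using compact_attains_sup by metis
  then obtain v where v: "\<mu> \<in> {a..b}" "norm v = 1" "B \<mu> v v \<le> 0" by (auto simp: C_def)
  then have "v \<noteq> 0" by auto
  then have "\<mu> < b" using v pos[of v] by (metis atLeastAtMost_iff leD order_le_less)
  \<comment> \<open>A negative value at \<mu> < b would persist at slightly larger parameters,
    against the maximality of \<mu>.\<close>
  have psd: "0 \<le> B \<mu> w w" for w
  proof (rule ccontr)
    assume "\<not> 0 \<le> B \<mu> w w"
    have "continuous_on {a..b} (\<lambda>t. B t w w)"
    proof -
      have "continuous_on {a..b} (\<lambda>t. (t, w))" by (intro continuous_intros)
      from continuous_on_compose2[OF cont this] show ?thesis by auto
    qed
    moreover have "- B \<mu> w w > 0" using \<open>\<not> _ \<le> _\<close> by simp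
    ultimately obtain \<delta> where \<delta>: "\<delta> > 0"
        "\<And>t. t \<in> {a..b} \<Longrightarrow> dist t \<mu> < \<delta> \<Longrightarrow> dist (B t w w) (B \<mu> w w) < - B \<mu> w w"
      using v(1) unfolding continuous_on_iff by metis
    define t where "t = min (\<mu> + \<delta> / 2) b"
    have t: "\<mu> < t" "t \<in> {a..b}" "dist t \<mu> < \<delta>"
      using \<delta>(1) \<open>\<mu> < b\<close> v(1) by (auto simp: t_def dist_real_def)
    then have "B t w w < 0" using \<delta>(2)[of t] by (simp add: dist_real_def)
    from unit[OF this t(2)] have "t \<in> fst ` C" by force
    then show False using \<mu>(2)[of t] t by simp
  qed
  then have "B \<mu> v v = 0" using v(3) by (simp add: order_antisym)
  then have "B \<mu> v w = 0" for w using psd_form_kernel[OF lin sym psd] by blast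
  then show ?thesis using that v \<open>v \<noteq> 0\<close> by auto
qed

text \<open>The contribution of one agent, with \<alpha> = |x_j| and \<beta> = |y_j|. For large
  \<mu> the x-part is magnified by \<mu> - 1, while the y-part stays close to Fyy + Hyy because
  (\<mu> - 1) / \<mu> tends to 1.\<close>

lemma form_lower_bound:
  fixes c K :: real
  assumes c: "c > 0" and K: "K \<ge> 0"
  obtains M where "M > 1"
    "\<And>\<mu> \<alpha> \<beta> Fxx Fxy Fyy Hxx Hyy. \<mu> \<ge> M \<Longrightarrow> \<bar>Fxx\<bar> \<le> K * \<alpha>\<^sup>2 \<Longrightarrow> \<bar>Fxy\<bar> \<le> 2 * K * \<beta> * \<alpha> \<Longrightarrow>
       c * \<alpha>\<^sup>2 \<le> Fxx + Hxx \<Longrightarrow> c * \<beta>\<^sup>2 \<le> Fyy + Hyy \<Longrightarrow> Hyy \<le> K * \<beta>\<^sup>2 \<Longrightarrow>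
       c / 4 * (\<alpha>\<^sup>2 + \<beta>\<^sup>2) \<le> Fxx + Fxy + Fyy + (\<mu> - 1) * (Fxx + Hxx + Hyy / \<mu>)"
proof
  \<comment> \<open>The middle term lets the magnified x-part absorb Fxx and the \<alpha>-half of
    the cross term. The last one keeps Hyy / \<mu> below (c / 4) \<beta>^2; the \<beta>-half costs c
    / 2, so c / 4 remains.\<close>
  define M where "M = 2 + (K + K\<^sup>2 / (c / 2)) / c + 4 * K / c"
  have nn: "0 \<le> (K + K\<^sup>2 / (c / 2)) / c" "0 \<le> 4 * K / c" using c K by auto
  then show "M > 1" by (simp add: M_def)
  fix \<mu> \<alpha> \<beta> Fxx Fxy Fyy Hxx Hyy :: real
  assume \<mu>: "\<mu> \<ge> M" and 1: "\<bar>Fxx\<bar> \<le> K * \<alpha>\<^sup>2" "\<bar>Fxy\<bar> \<le> 2 * K * \<beta> * \<alpha>" "c * \<alpha>\<^sup>2 \<le> Fxx + Hxx"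
    "c * \<beta>\<^sup>2 \<le> Fyy + Hyy" "Hyy \<le> K * \<beta>\<^sup>2"
  have "\<mu> > 1" using \<mu> \<open>M > 1\<close> by simp
  have "2 * K * \<beta> * \<alpha> \<le> c / 2 * \<beta>\<^sup>2 + K\<^sup>2 / (c / 2) * \<alpha>\<^sup>2"
    using weighted_product_le[of "c / 2" K \<beta> \<alpha>] c by simp
  moreover have "(c + K + K\<^sup>2 / (c / 2)) * \<alpha>\<^sup>2 \<le> (\<mu> - 1) * (Fxx + Hxx)"
  proof -
    have "1 + (K + K\<^sup>2 / (c / 2)) / c \<le> \<mu> - 1" using \<mu> nn by (simp add: M_def)
    then have "(1 + (K + K\<^sup>2 / (c / 2)) / c) * (c * \<alpha>\<^sup>2) \<le> (\<mu> - 1) * (Fxx + Hxx)"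
      using 1(3) c nn by (intro mult_mono) (auto intro!: mult_nonneg_nonneg order_trans[OF _ 1(3)])
    moreover have "(1 + (K + K\<^sup>2 / (c / 2)) / c) * (c * \<alpha>\<^sup>2) = (c + K + K\<^sup>2 / (c / 2)) * \<alpha>\<^sup>2"
      using c by (simp add: field_simps)
    ultimately show ?thesis by (simp only:)
  qed
  moreover have "Hyy - c / 4 * \<beta>\<^sup>2 \<le> (\<mu> - 1) * (Hyy / \<mu>)"
  proof -
    have "4 * K / c \<le> \<mu>" using \<mu> nn by (simp add: M_def)
    then have "K \<le> c / 4 * \<mu>" using c by (simp add: field_simps)
    then have "K * \<beta>\<^sup>2 \<le> c / 4 * \<mu> * \<beta>\<^sup>2" by (intro mult_right_mono) auto
    then have "Hyy \<le> (c / 4 * \<beta>\<^sup>2) * \<mu>" using 1(5) by (simp add: algebra_simps)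
    then have "Hyy / \<mu> \<le> c / 4 * \<beta>\<^sup>2" using \<open>\<mu> > 1\<close> by (simp add: pos_divide_le_eq)
    moreover have "(\<mu> - 1) * (Hyy / \<mu>) = Hyy - Hyy / \<mu>" using \<open>\<mu> > 1\<close> by (simp add: field_simps)
    ultimately show ?thesis by simp
  qed
  moreover have "c / 4 * \<alpha>\<^sup>2 \<le> c * \<alpha>\<^sup>2" using c by (intro mult_right_mono) auto
  ultimately show "c / 4 * (\<alpha>\<^sup>2 + \<beta>\<^sup>2) \<le> Fxx + Fxy + Fyy + (\<mu> - 1) * (Fxx + Hxx + Hyy / \<mu>)"
    using 1 unfolding distrib_left distrib_right abs_le_iff by linarith
qed

lemma linear_mult_left: "linear g \<Longrightarrow> linear (\<lambda>x. c * g x)" for g :: "_ \<Rightarrow> real"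
  by (auto simp: linear_iff algebra_simps)

lemma linear_divide: "linear g \<Longrightarrow> linear (\<lambda>x. g x / c)" for g :: "_ \<Rightarrow> real"
  by (auto simp: linear_iff add_divide_distrib)

lemma linear_inner_right: "linear g \<Longrightarrow> linear (\<lambda>x. u \<bullet> g x)"
  by (auto simp: linear_iff inner_add_right)

type_synonym ('n, 'm, 'k) primal = "((real^'n)^('k option)) \<times> (real^'m)"

context consensus_admm
begin

section \<open>The symmetrized eigenvalue problem in the primal variables\<close>

definition lx :: "'k option \<Rightarrow> ('n, 'm, 'k) primal \<Rightarrow> (real^'n) \<times> (real^'m)" where
  "lx j w = (fst w $ j, 0)"

definition ly :: "'k option \<Rightarrow> ('n, 'm, 'k) primal \<Rightarrow> (real^'n) \<times> (real^'m)" where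
  "ly j w = (0, block_part blk j (snd w))"

definition wgap :: "'k \<Rightarrow> ('n, 'm, 'k) primal \<Rightarrow> real^'n" where
  "wgap k w = fst w $ Some k - fst w $ None"

definition cF :: "('n, 'm, 'k) state \<Rightarrow> 'k option \<Rightarrow> (real^'n) \<times> (real^'m) \<Rightarrow> (real^'n) \<times> (real^'m) \<Rightarrow> real" where
  "cF z j u v = Hf j (loc j z) u \<bullet> v"

definition cH :: "('n, 'm, 'k) state \<Rightarrow> 'k option \<Rightarrow> (real^'n) \<times> (real^'m) \<Rightarrow> (real^'n) \<times> (real^'m) \<Rightarrow> real" where
  "cH z j u v = (1 / \<eta>) * (Hh j (loc j z) u \<bullet> v)"

text \<open>After elimination, x_k enters the equation of x_1 with coefficient - \<rho> (2 \<mu> -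
  1) / (\<mu> - 1), while x_1 enters that of x_k with - \<rho> \<mu>^2 / (\<mu> - 1). These weights
  make the two equal.\<close>

definition wt :: "real \<Rightarrow> 'k option \<Rightarrow> real" where
  "wt \<mu> j = (case j of None \<Rightarrow> \<mu>\<^sup>2 | Some _ \<Rightarrow> 2 * \<mu> - 1)"

text \<open>
  Eliminating the multipliers from the eigenvalue equation of the linearized iteration leaves a
  nonsymmetric system in the primal variables. Its coupling graph (\<open>x\<^sub>1\<close> with every \<open>x\<^sub>j\<close>, and \<open>x\<^sub>j\<close>
  with \<open>y\<^sub>j\<close>) is a tree, so it becomes symmetric after weighting the equations: the equation of \<open>x\<^sub>j\<close>
  by \<open>wt \<mu> j\<close>, the one of \<open>y\<^sub>j\<close> by \<open>wt \<mu> j / \<mu>\<close>.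
\<close>

definition saddle_form :: "('n, 'm, 'k) state \<Rightarrow> real \<Rightarrow> ('n, 'm, 'k) primal \<Rightarrow>
    ('n, 'm, 'k) primal \<Rightarrow> real" where
  "saddle_form z \<mu> w w' =
     (\<Sum>j\<in>UNIV. wt \<mu> j * (cF z j (lx j w + ly j w) (lx j w' + ly j w') + (\<mu> - 1) *
        (cF z j (lx j w) (lx j w') + cH z j (lx j w) (lx j w') + cH z j (ly j w) (ly j w') / \<mu>))) +
     \<rho> * \<mu>\<^sup>2 / (\<mu> - 1) * (\<Sum>k\<in>UNIV. (2 * \<mu> - 1) * (wgap k w \<bullet> wgap k w') +
        (\<mu> - 1)\<^sup>2 * (fst w $ None \<bullet> fst w' $ None))"

lemma linear_lx: "linear (lx j)"
  by (rule linearI) (simp_all add: lx_def)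

lemma linear_ly: "linear (ly j)"
  by (rule linearI) (simp_all add: ly_def linear_add[OF linear_block_part] linear_scale[OF linear_block_part])

lemma linear_wgap: "linear (wgap k)"
  by (rule linearI) (simp_all add: wgap_def algebra_simps)

lemma linear_fst_None: "linear (\<lambda>w :: ('n, 'm, 'k) primal. fst w $ None)"
  by (rule linearI) simp_all

lemma linear_Hf: "z \<in> X \<Longrightarrow> linear (Hf j (loc j z))"
  using locX[of z j] fp.G(3)[of "fst (loc j z)" j "snd (loc j z)"] has_derivative_linear
  by (auto simp: mem_Times_iff)

lemma linear_Hh: "z \<in> X \<Longrightarrow> linear (Hh j (loc j z))"
  using locX[of z j] hp.G(3)[of "fst (loc j z)" j "snd (loc j z)"] has_derivative_linear
  by (auto simp: mem_Times_iff)

lemma loc_surj: "u \<in> UNIV \<times> block blk j \<Longrightarrow> loc j (axis j (fst u), snd u, 0) = u"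
  by (cases u) (auto simp: loc_def axis_def block_part_of_block)

lemma cF_sym:
  assumes "z \<in> X" "u \<in> UNIV \<times> block blk j" "v \<in> UNIV \<times> block blk j"
  shows "cF z j u v = cF z j v u"
  using f.hessian_symmetric[where j = j, OF open_X locX assms(1), where d = "(axis j (fst u), snd u, 0)" and e = "(axis j (fst v), snd v, 0)"]
  unfolding cF_def loc_surj[OF assms(2)] loc_surj[OF assms(3)] by blast

lemma cH_sym:
  assumes "z \<in> X" "u \<in> UNIV \<times> block blk j" "v \<in> UNIV \<times> block blk j"
  shows "cH z j u v = cH z j v u"
  using h.hessian_symmetric[where j = j, OF open_X locX assms(1), where d = "(axis j (fst u), snd u, 0)" and e = "(axis j (fst v), snd v, 0)"]
  unfolding cH_def loc_surj[OF assms(2)] loc_surj[OF assms(3)] by metis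

lemma lx_in: "lx j w \<in> UNIV \<times> block blk j" and ly_in: "ly j w \<in> UNIV \<times> block blk j"
  and lxy_in: "lx j w + ly j w \<in> UNIV \<times> block blk j"
  by (simp_all add: lx_def ly_def block_part_in_block subspace_0 subspace_block)

lemma saddle_form_sym: "z \<in> X \<Longrightarrow> saddle_form z \<mu> w w' = saddle_form z \<mu> w' w"
  unfolding saddle_form_def
  by (simp add: cF_sym[OF _ lx_in lx_in, of z _ w w'] cF_sym[OF _ lxy_in lxy_in, of z _ w w']
      cH_sym[OF _ lx_in lx_in, of z _ w w'] cH_sym[OF _ ly_in ly_in, of z _ w w'] inner_commute)

lemma saddle_form_linear: "linear (saddle_form z \<mu> w)"
  unfolding saddle_form_def[abs_def] cF_def cH_def
  by (intro linear_compose_add linear_compose_sum ballI linear_mult_left linear_divide linear_inner_right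
      linear_lx linear_ly linear_wgap linear_fst_None)

lemma saddle_form_continuous:
  assumes z: "z \<in> X" and "a > 1"
  shows "continuous_on ({a..b} \<times> UNIV) (\<lambda>p. saddle_form z (fst p) (snd p) (snd p))"
proof -
  have lin: "continuous_on S (\<lambda>p. T (snd p))" if "linear T"
    for T :: "('n, 'm, 'k) primal \<Rightarrow> 'c::euclidean_space" and S :: "(real \<times> _) set"
    using that by (intro continuous_on_compose2[OF linear_continuous_on[of T UNIV]] continuous_intros)
      (auto simp: linear_conv_bounded_linear)
  have comp: "linear (\<lambda>w. T (Q w))" if "linear Q" "linear T"
    for Q :: "('n, 'm, 'k) primal \<Rightarrow> (real^'n) \<times> (real^'m)" and T :: "_ \<Rightarrow> (real^'n) \<times> (real^'m)"
    using linear_compose[OF that] by (simp add: o_def)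
  have wt: "continuous_on S (\<lambda>p. wt (fst p) j)" for j and S :: "(real \<times> ('n, 'm, 'k) primal) set"
    by (cases j) (auto simp: wt_def intro!: continuous_intros)
  show ?thesis
    unfolding saddle_form_def cF_def cH_def
    by (intro continuous_on_add continuous_on_mult continuous_on_sum continuous_on_divide continuous_on_inner
        continuous_on_diff continuous_on_power continuous_on_const continuous_on_fst[OF continuous_on_id]
        wt lin[OF linear_lx] lin[OF linear_ly] lin[OF linear_wgap] lin[OF linear_fst_None]
        lin[OF comp[OF linear_lx linear_Hf[OF z]]] lin[OF comp[OF linear_lx linear_Hh[OF z]]]
        lin[OF comp[OF linear_ly linear_Hh[OF z]]]
        lin[OF comp[OF linear_compose_add[OF linear_lx linear_ly] linear_Hf[OF z]]])
      (use \<open>a > 1\<close> in auto)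
qed

lemma saddle_form_block_positive:
  assumes z: "z \<in> X"
  shows "\<exists>M>1. \<forall>\<mu>\<ge>M. \<forall>w.
    0 \<le> cF z j (lx j w + ly j w) (lx j w + ly j w) + (\<mu> - 1) *
        (cF z j (lx j w) (lx j w) + cH z j (lx j w) (lx j w) + cH z j (ly j w) (ly j w) / \<mu>) \<and>
    (lx j w + ly j w \<noteq> 0 \<longrightarrow>
    0 < cF z j (lx j w + ly j w) (lx j w + ly j w) + (\<mu> - 1) *
        (cF z j (lx j w) (lx j w) + cH z j (lx j w) (lx j w) + cH z j (ly j w) (ly j w) / \<mu>))"
proof -
  obtain x y where xy: "loc j z = (x, y)" "x \<in> Dx j" "y \<in> Dy j" using locX[OF z, of j] by auto
  obtain m where m: "m > 0"
    "\<And>d. m * (d \<bullet> d) \<le> Hh j (x, y) (d, 0) \<bullet> (d, 0) \<and>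
       0 \<le> Lx j * (Hh j (x, y) (d, 0) \<bullet> (d, 0)) + Hf j (x, y) (d, 0) \<bullet> (d, 0)"
    "\<And>d. d \<in> block blk j \<Longrightarrow>
       m * (d \<bullet> d) \<le> Hh j (x, y) (0, d) \<bullet> (0, d) \<and>
       0 \<le> Ly j * (Hh j (x, y) (0, d) \<bullet> (0, d)) + Hf j (x, y) (0, d) \<bullet> (0, d)"
    using biconvex_bounds[of j] xy(2,3) by metis
  define cx where "cx = (1 / \<eta> - Lx j) * m"
  define cy where "cy = (1 / \<eta> - Ly j) * m"
  note cx = step_size_coercive[OF L_pos(1) \<eta>(2) m(1) conjunct1[OF m(2)] conjunct2[OF m(2)] inner_ge_zero, folded cx_def]
  note cy = step_size_coercive[OF L_pos(2) \<eta>(3) m(1) conjunct1[OF m(3)] conjunct2[OF m(3)] inner_ge_zero, folded cy_def]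
  have "cy > 0" by (rule cy(1)[of 0]) (simp_all add: subspace_0 subspace_block)
  define c where "c = min cx cy"
  have c: "c > 0" "c \<le> cx" "c \<le> cy" using cx(1) \<open>cy > 0\<close> by (auto simp: c_def)
  obtain Kf Kh where K: "Kf > 0" "\<And>u. norm (Hf j (x, y) u) \<le> Kf * norm u"
    "Kh > 0" "\<And>u. norm (Hh j (x, y) u) \<le> Kh * norm u"
    using linear_bound[OF linear_Hf[OF z, of j]] linear_bound[OF linear_Hh[OF z, of j]] unfolding xy(1) by metis
  define K where "K = max Kf (1 / \<eta> * Kh)"
  have F: "\<bar>cF z j u v\<bar> \<le> K * (norm u * norm v)" for u v
  proof -
    have "\<bar>cF z j u v\<bar> \<le> norm (Hf j (x, y) u) * norm v"
      unfolding cF_def xy(1) by (rule Cauchy_Schwarz_ineq2)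
    also have "\<dots> \<le> (Kf * norm u) * norm v" using K(2) by (intro mult_right_mono) auto
    also have "\<dots> \<le> (K * norm u) * norm v" by (intro mult_right_mono) (auto simp: K_def)
    finally show ?thesis by (simp add: mult.assoc)
  qed
  have H: "cH z j u u \<le> K * (norm u)\<^sup>2" for u
  proof -
    have "Hh j (x, y) u \<bullet> u \<le> norm (Hh j (x, y) u) * norm u" by (rule norm_cauchy_schwarz)
    also have "\<dots> \<le> (Kh * norm u) * norm u" using K(4) by (intro mult_right_mono) auto
    finally have "cH z j u u \<le> 1 / \<eta> * ((Kh * norm u) * norm u)"
      unfolding cH_def xy(1) using \<eta>(1) by (intro mult_left_mono) auto
    also have "\<dots> = (1 / \<eta> * Kh) * (norm u)\<^sup>2" by (simp add: power2_eq_square)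
    also have "\<dots> \<le> K * (norm u)\<^sup>2" by (intro mult_right_mono) (auto simp: K_def)
    finally show ?thesis .
  qed
  have "K \<ge> 0" using K by (simp add: K_def)
  obtain M where M: "M > 1"
    "\<And>\<mu> \<alpha> \<beta> Fxx Fxy Fyy Hxx Hyy. \<mu> \<ge> M \<Longrightarrow> \<bar>Fxx\<bar> \<le> K * \<alpha>\<^sup>2 \<Longrightarrow> \<bar>Fxy\<bar> \<le> 2 * K * \<beta> * \<alpha> \<Longrightarrow>
       c * \<alpha>\<^sup>2 \<le> Fxx + Hxx \<Longrightarrow> c * \<beta>\<^sup>2 \<le> Fyy + Hyy \<Longrightarrow> Hyy \<le> K * \<beta>\<^sup>2 \<Longrightarrow>
       c / 4 * (\<alpha>\<^sup>2 + \<beta>\<^sup>2) \<le> Fxx + Fxy + Fyy + (\<mu> - 1) * (Fxx + Hxx + Hyy / \<mu>)"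
    using form_lower_bound[OF c(1) \<open>K \<ge> 0\<close>] by metis
  have main: "c / 4 * ((norm (lx j w))\<^sup>2 + (norm (ly j w))\<^sup>2) \<le>
      cF z j (lx j w + ly j w) (lx j w + ly j w) + (\<mu> - 1) *
        (cF z j (lx j w) (lx j w) + cH z j (lx j w) (lx j w) + cH z j (ly j w) (ly j w) / \<mu>)"
    if "\<mu> \<ge> M" for \<mu> w
  proof -
    let ?a = "lx j w" and ?b = "ly j w"
    have lxw: "?a = (fst w $ j, 0)" and lyw: "?b = (0, block_part blk j (snd w))" by (simp_all add: lx_def ly_def)
    have na: "(norm (fst w $ j, 0 :: real^'m))\<^sup>2 = fst w $ j \<bullet> fst w $ j" and
      nb: "(norm (0 :: real^'n, block_part blk j (snd w)))\<^sup>2 = block_part blk j (snd w) \<bullet> block_part blk j (snd w)"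
      by (simp_all add: power2_norm_eq_inner)
    have e: "cF z j (?a + ?b) (?a + ?b) = cF z j ?a ?a + (cF z j ?a ?b + cF z j ?b ?a) + cF z j ?b ?b"
      unfolding cF_def by (simp add: linear_add[OF linear_Hf[OF z]] inner_add_left inner_add_right)
    show ?thesis unfolding e
    proof (rule M(2)[OF that])
      show "\<bar>cF z j ?a ?a\<bar> \<le> K * (norm ?a)\<^sup>2" using F[of ?a ?a] by (simp add: power2_eq_square)
      show "\<bar>cF z j ?a ?b + cF z j ?b ?a\<bar> \<le> 2 * K * norm ?b * norm ?a"
        using F[of ?a ?b] F[of ?b ?a] by (simp add: algebra_simps abs_le_iff)
      have "c * (norm ?a)\<^sup>2 \<le> cx * (norm ?a)\<^sup>2" using c by (intro mult_right_mono) auto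
      then show "c * (norm ?a)\<^sup>2 \<le> cF z j ?a ?a + cH z j ?a ?a"
        using cx(3)[of "fst w $ j"] unfolding lxw na cF_def cH_def xy(1) by linarith
      have "c * (norm ?b)\<^sup>2 \<le> cy * (norm ?b)\<^sup>2" using c by (intro mult_right_mono) auto
      then show "c * (norm ?b)\<^sup>2 \<le> cF z j ?b ?b + cH z j ?b ?b"
        using cy(3)[OF block_part_in_block block_part_in_block, of "snd w"] unfolding lyw nb cF_def cH_def xy(1)
        by linarith
      show "cH z j ?b ?b \<le> K * (norm ?b)\<^sup>2" by (rule H)
    qed
  qed
  have "0 < c / 4 * ((norm (lx j w))\<^sup>2 + (norm (ly j w))\<^sup>2)" if "lx j w + ly j w \<noteq> 0" for w
  proof -
    have "lx j w \<noteq> 0 \<or> ly j w \<noteq> 0" using that by auto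
    then show ?thesis using c(1) by (auto simp: add_pos_nonneg add_nonneg_pos)
  qed
  moreover have "0 \<le> c / 4 * ((norm (lx j w))\<^sup>2 + (norm (ly j w))\<^sup>2)" for w using c(1) by simp
  ultimately show ?thesis using main M(1) by (meson less_le_trans order_trans)
qed

lemma saddle_form_positive:
  assumes z: "z \<in> X"
  obtains M where "M \<ge> a" "\<And>w. w \<noteq> 0 \<Longrightarrow> 0 < saddle_form z M w w"
proof -
  let ?E = "\<lambda>\<mu> j w. cF z j (lx j w + ly j w) (lx j w + ly j w) + (\<mu> - 1) *
        (cF z j (lx j w) (lx j w) + cH z j (lx j w) (lx j w) + cH z j (ly j w) (ly j w) / \<mu>)"
  obtain Mj where Mj: "\<And>j. Mj j > 1" "\<And>j \<mu> w. \<mu> \<ge> Mj j \<Longrightarrow> 0 \<le> ?E \<mu> j w"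
    "\<And>j \<mu> w. \<mu> \<ge> Mj j \<Longrightarrow> lx j w + ly j w \<noteq> 0 \<Longrightarrow> 0 < ?E \<mu> j w"
    using saddle_form_block_positive[OF z] by metis
  define M where "M = max a (Max (range Mj))"
  have M: "M \<ge> Mj j" for j by (simp add: M_def max.coboundedI2)
  then have "M > 1" using Mj(1) less_le_trans by blast
  have wt: "wt M j > 0" for j using \<open>M > 1\<close> by (cases j) (auto simp: wt_def)
  have "0 < saddle_form z M w w" if "w \<noteq> 0" for w
  proof -
    have "\<exists>j. lx j w + ly j w \<noteq> 0"
    proof (rule ccontr)
      assume "\<not> ?thesis"
      then have *: "fst w $ j = 0" "block_part blk j (snd w) = 0" for j
        by (auto simp: lx_def ly_def zero_prod_def)
      have "fst w = 0" using *(1) by (simp add: vec_eq_iff)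
      moreover have "snd w $ i = 0" for i
        using arg_cong[OF *(2)[of "blk i"], of "\<lambda>v. v $ i"] by (simp add: block_part_def)
      then have "snd w = 0" by (simp add: vec_eq_iff)
      ultimately show False using that by (simp add: prod_eq_iff)
    qed
    then obtain j where j: "lx j w + ly j w \<noteq> 0" by blast
    have "0 < (\<Sum>j\<in>UNIV. wt M j * ?E M j w)"
      by (rule sum_pos2[of _ j]) (auto intro!: mult_pos_pos mult_nonneg_nonneg less_imp_le[OF wt] wt Mj M j)
    moreover have "0 \<le> \<rho> * M\<^sup>2 / (M - 1) * (\<Sum>k\<in>UNIV. (2 * M - 1) * (wgap k w \<bullet> wgap k w) +
        (M - 1)\<^sup>2 * (fst w $ None \<bullet> fst w $ None))"
      using \<open>M > 1\<close> \<rho> by (intro mult_nonneg_nonneg divide_nonneg_nonneg sum_nonneg add_nonneg_nonneg) auto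
    ultimately show ?thesis unfolding saddle_form_def by (rule add_pos_nonneg)
  qed
  then show ?thesis using that[of M] by (simp add: M_def)
qed

text \<open>At \<mu> = 1 the weights are 1 and, on consensus directions, the form becomes the
  Hessian sum of the strict-saddle condition; a slightly larger \<mu> keeps the sign.\<close>

lemma saddle_form_negative:
  assumes saddle: "strict_saddle_KKT_point blk f z"
  obtains a w where "a > 1" "saddle_form z a w w < 0"
proof -
  obtain dx dy where d: "\<And>j. dy j \<in> block blk j"
    "(\<Sum>j\<in>UNIV. hess_form (UNIV \<times> block blk j) (\<lambda>(u, v). f j u v) (loc j z) (dx, dy j)) < 0"
    using saddle by (cases z) (auto simp: strict_saddle_KKT_point_def loc_def)
  define w :: "('n, 'm, 'k) primal" where "w = ((\<chi> j. dx), \<Sum>j\<in>UNIV. dy j)"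
  have lxw: "lx j w = (dx, 0)" for j by (simp add: lx_def w_def)
  have "block_part blk j (\<Sum>i\<in>UNIV. dy i) = dy j" for j
    by (simp add: linear_sum[OF linear_block_part] block_part_of_block[OF d(1)])
  then have lyw: "ly j w = (0, dy j)" for j by (simp add: ly_def w_def)
  \<comment> \<open>On a consensus direction all gaps vanish, and the remaining factor (\<mu> - 1)^2
    cancels the pole of the coupling coefficient; this is the continuous extension of the form to
    \<mu> = 1.\<close>
  define \<psi> where "\<psi> \<mu> = (\<Sum>j\<in>UNIV. wt \<mu> j * (cF z j (dx, dy j) (dx, dy j) + (\<mu> - 1) *
        (cF z j (dx, 0) (dx, 0) + cH z j (dx, 0) (dx, 0) + cH z j (0, dy j) (0, dy j) / \<mu>))) +
     \<rho> * \<mu>\<^sup>2 * (\<mu> - 1) * (\<Sum>k\<in>(UNIV :: 'k set). dx \<bullet> dx)" for \<mu>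
  have eq: "saddle_form z \<mu> w w = \<psi> \<mu>" if "\<mu> > 1" for \<mu>
    unfolding saddle_form_def \<psi>_def lxw lyw using that
    by (simp add: w_def wgap_def power2_eq_square)
  have "isCont (\<lambda>\<mu>. wt \<mu> j) 1" for j by (cases j) (auto simp: wt_def)
  then have "isCont \<psi> 1" unfolding \<psi>_def by (intro continuous_intros) auto
  then have "(\<psi> \<longlongrightarrow> \<psi> 1) (nhds 1)" by (simp add: isCont_def tendsto_at_iff_tendsto_nhds)
  moreover have "wt 1 j = 1" for j by (cases j) (auto simp: wt_def)
  then have "\<psi> 1 < 0" using d(2) by (simp add: \<psi>_def cF_def hess_form_def inner_commute)
  ultimately have "\<forall>\<^sub>F \<mu> in nhds 1. \<psi> \<mu> < 0" by (rule order_tendstoD(2))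
  then obtain \<delta> where \<delta>: "\<delta> > 0" "\<And>\<mu>. dist \<mu> 1 < \<delta> \<Longrightarrow> \<psi> \<mu> < 0" unfolding eventually_nhds_metric by blast
  show ?thesis using that[of "1 + \<delta> / 2" w] \<delta> eq[of "1 + \<delta> / 2"] by (simp add: dist_real_def)
qed

lemma proj_x_eqI: "(\<And>d. s \<bullet> (axis j d, 0, 0) = t \<bullet> (axis j d, 0, 0)) \<Longrightarrow> proj_x j s = proj_x j t"
  using vector_eq_rdot[of "fst s $ j" "fst t $ j"] by (simp add: proj_x_def inner_prod_def inner_axis)

lemma proj_y_eqI:
  assumes "\<And>d. d \<in> block blk j \<Longrightarrow> s \<bullet> (0, d, 0) = t \<bullet> (0, d, 0)"
  shows "proj_y j s = proj_y j t"
proof -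
  have "block_part blk j (fst (snd s)) \<bullet> d = block_part blk j (fst (snd t)) \<bullet> d" for d
    using assms[OF block_part_in_block, of d] by (simp add: inner_prod_def block_part_selfadjoint)
  then show ?thesis
    using vector_eq_rdot[of "block_part blk j (fst (snd s))" "block_part blk j (fst (snd t))"]
    by (simp add: proj_y_def)
qed

text \<open>Testing a kernel vector of \<open>saddle_form\<close> with directions supported in one
  block returns the block equations of the linearized sweep, multiplied by their positive
  weights.\<close>

lemma linearized_eigenvector_exists:
  assumes z: "z \<in> X" and saddle: "strict_saddle_KKT_point blk f z"
  obtains \<mu> v where "\<mu> > 1" "v \<noteq> 0" "linearized_eigenvector z \<mu> v"
proof -
  obtain a w0 where a: "a > 1" "saddle_form z a w0 w0 < 0" using saddle_form_negative[OF saddle] by blast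
  obtain M where M: "M \<ge> a" "\<And>w. w \<noteq> 0 \<Longrightarrow> 0 < saddle_form z M w w" using saddle_form_positive[OF z] by metis
  obtain \<mu> w where "a \<le> \<mu>" "w \<noteq> 0" and B: "\<And>w'. saddle_form z \<mu> w w' = 0"
    using form_family_kernel[OF saddle_form_linear saddle_form_sym[OF z] saddle_form_continuous[OF z a(1)] a(2) M(2) M(1)]
    by metis
  then have \<mu>: "\<mu> > 1" using a by simp
  \<comment> \<open>The multipliers are forced by the multiplier update, (\<mu> - 1) \<lambda> =
    \<rho> \<mu> gap.\<close>
  define v where "v = (fst w, snd w, \<chi> k. (\<rho> * \<mu> / (\<mu> - 1)) *\<^sub>R wgap k w)"
  have "v \<noteq> 0" using \<open>w \<noteq> 0\<close> by (auto simp: v_def prod_eq_iff)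
  have dual_v: "dual k v = (\<rho> * \<mu> / (\<mu> - 1)) *\<^sub>R wgap k w" for k by (simp add: dual_def v_def)
  have loc_v: "loc j v = lx j w + ly j w" for j by (simp add: loc_def v_def lx_def ly_def)
  have loc_mixed: "loc j (mixed \<mu> v A C) = (if j \<in> A then \<mu> else 1) *\<^sub>R lx j w + (if j \<in> C then \<mu> else 1) *\<^sub>R ly j w" for j A C
    by (auto simp: loc_def mixed_def v_def lx_def ly_def block_part_def vec_eq_iff)
  note linF = linear_Hf[OF z] and linH = linear_Hh[OF z]
  have eqx: "proj_x j (\<Psi>' z (mixed \<mu> v {..j} {..<j})) = proj_x j (\<Theta>' z (mixed \<mu> v {..<j} {..<j}))" for j
  proof (rule proj_x_eqI)
    fix d
    let ?e = "(axis j d, 0, 0) :: ('n, 'm, 'k) state" and ?m = "mixed \<mu> v {..j} {..<j}"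
    let ?w' = "(axis j d, 0) :: ('n, 'm, 'k) primal"
    have lx': "lx i ?w' = (if i = j then (d, 0) else 0)" and ly': "ly i ?w' = 0" for i
      by (auto simp: lx_def ly_def axis_def zero_prod_def linear_0[OF linear_block_part])
    have "wt \<mu> j * (cF z j (lx j w + ly j w) (d, 0) + (\<mu> - 1) * (cF z j (lx j w) (d, 0) + cH z j (lx j w) (d, 0))) +
      \<rho> * \<mu>\<^sup>2 / (\<mu> - 1) * (\<Sum>k\<in>UNIV. (2 * \<mu> - 1) * (wgap k w \<bullet> wgap k ?w') +
        (\<mu> - 1)\<^sup>2 * (fst w $ None \<bullet> fst ?w' $ None)) = saddle_form z \<mu> w ?w'"
    proof -
      have "(\<Sum>i\<in>UNIV. wt \<mu> i * (cF z i (lx i w + ly i w) (lx i ?w' + ly i ?w') + (\<mu> - 1) *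
          (cF z i (lx i w) (lx i ?w') + cH z i (lx i w) (lx i ?w') + cH z i (ly i w) (ly i ?w') / \<mu>))) =
        (\<Sum>i\<in>UNIV. if i = j then wt \<mu> j * (cF z j (lx j w + ly j w) (d, 0) + (\<mu> - 1) *
          (cF z j (lx j w) (d, 0) + cH z j (lx j w) (d, 0))) else 0)"
        by (intro sum.cong) (auto simp: lx' ly' cF_def cH_def)
      then show ?thesis unfolding saddle_form_def by simp
    qed
    then have B0: "wt \<mu> j * (cF z j (lx j w + ly j w) (d, 0) + (\<mu> - 1) * (cF z j (lx j w) (d, 0) + cH z j (lx j w) (d, 0))) +
      \<rho> * \<mu>\<^sup>2 / (\<mu> - 1) * (\<Sum>k\<in>UNIV. (2 * \<mu> - 1) * (wgap k w \<bullet> wgap k ?w') +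
        (\<mu> - 1)\<^sup>2 * (fst w $ None \<bullet> fst ?w' $ None)) = 0" using B by simp
    have coupling: "wt \<mu> j * (grad_coupling ?m \<bullet> ?e) =
      \<rho> * \<mu>\<^sup>2 / (\<mu> - 1) * (\<Sum>k\<in>UNIV. (2 * \<mu> - 1) * (wgap k w \<bullet> wgap k ?w') +
        (\<mu> - 1)\<^sup>2 * (fst w $ None \<bullet> fst ?w' $ None))"
      unfolding inner_grad_coupling sum_distrib_left
    proof (rule sum.cong[OF refl])
      fix k :: 'k
      define a1 ak d1 dk where "a1 = fst w $ None" "ak = fst w $ Some k" "d1 = fst ?w' $ None" "dk = fst ?w' $ Some k"
      note ad = this
      define c where "c = \<rho> * \<mu> / (\<mu> - 1)"
      have c: "(\<mu> - 1) * c = \<rho> * \<mu>" using \<mu> by (simp add: c_def)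
      have gw: "wgap k w = ak - a1" "wgap k ?w' = dk - d1" by (simp_all add: wgap_def ad)
      have dual: "dual k ?e = 0" "dual k ?m = c *\<^sub>R (ak - a1)" "gap k ?e = dk - d1"
        using dual_v[of k] by (simp_all add: dual_def mixed_def gap_def ad wgap_def c_def)
      have "wt \<mu> j * ((dual k ?m + \<rho> *\<^sub>R gap k ?m) \<bullet> (dk - d1)) =
        \<rho> * \<mu>\<^sup>2 / (\<mu> - 1) * ((2 * \<mu> - 1) * ((ak - a1) \<bullet> (dk - d1)) + (\<mu> - 1)\<^sup>2 * (a1 \<bullet> d1))"
      proof (cases j)
        case None
        \<comment> \<open>Agent 1 moves first, so the other x_k still lack the factor \<mu>. The
          term with (\<mu> - 1)^2 in the form comes from \<mu>^2 = (2 \<mu> - 1) + (\<mu> - 1)^2 on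
          the diagonal of x_1.\<close>
        then have g: "gap k ?m = ak - \<mu> *\<^sub>R a1" and dk: "dk = 0" and wt: "wt \<mu> j = \<mu>\<^sup>2"
          by (simp_all add: gap_def mixed_def v_def ad axis_def wt_def)
        have "(dual k ?m + \<rho> *\<^sub>R gap k ?m) \<bullet> (dk - d1) =
          - c * (ak \<bullet> d1 - a1 \<bullet> d1) - \<rho> * (ak \<bullet> d1 - \<mu> * (a1 \<bullet> d1))"
          unfolding dual g dk by (simp add: inner_add_left inner_diff_left algebra_simps)
        moreover have "(ak - a1) \<bullet> (dk - d1) = - (ak \<bullet> d1 - a1 \<bullet> d1)"
          unfolding dk by (simp add: inner_diff_left)
        ultimately have "(\<mu> - 1) * ((dual k ?m + \<rho> *\<^sub>R gap k ?m) \<bullet> (dk - d1)) =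
          \<rho> * ((2 * \<mu> - 1) * ((ak - a1) \<bullet> (dk - d1)) + (\<mu> - 1)\<^sup>2 * (a1 \<bullet> d1))"
          using c by algebra
        then have "(dual k ?m + \<rho> *\<^sub>R gap k ?m) \<bullet> (dk - d1) =
          \<rho> * ((2 * \<mu> - 1) * ((ak - a1) \<bullet> (dk - d1)) + (\<mu> - 1)\<^sup>2 * (a1 \<bullet> d1)) / (\<mu> - 1)"
          using \<mu> by (simp add: eq_divide_eq mult.commute)
        then show ?thesis unfolding wt by simp
      next
        case (Some i)
        \<comment> \<open>By now x_1 carries the factor \<mu>. The test direction lives at agent i,
          so only k = i contributes, and there both ends of the gap are scaled.\<close>
        then have g: "gap k ?m = (if k \<le> i then \<mu> else 1) *\<^sub>R ak - \<mu> *\<^sub>R a1" and d1: "d1 = 0"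
          and dk: "dk = (if k = i then d else 0)" and wt: "wt \<mu> j = 2 * \<mu> - 1"
          by (auto simp: gap_def mixed_def v_def ad axis_def wt_def)
        show ?thesis
        proof (cases "k = i")
          case True
          have "(dual k ?m + \<rho> *\<^sub>R gap k ?m) \<bullet> (dk - d1) = (c + \<rho> * \<mu>) * ((ak - a1) \<bullet> dk)"
            unfolding dual g d1 using True by (simp add: inner_add_left inner_diff_left algebra_simps)
          also have "c + \<rho> * \<mu> = \<rho> * \<mu>\<^sup>2 / (\<mu> - 1)"
            using \<mu> by (simp add: c_def field_simps power2_eq_square)
          finally show ?thesis unfolding wt d1 by simp
        next
          case False
          then show ?thesis by (simp add: dk d1)
        qed
      qed
      then show "wt \<mu> j * (gap k ?m \<bullet> dual k ?e + (dual k ?m + \<rho> *\<^sub>R gap k ?m) \<bullet> gap k ?e) =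
        \<rho> * \<mu>\<^sup>2 / (\<mu> - 1) * ((2 * \<mu> - 1) * (wgap k w \<bullet> wgap k ?w') + (\<mu> - 1)\<^sup>2 * (fst w $ None \<bullet> fst ?w' $ None))"
        unfolding dual(1,3) gw ad(1,3)[symmetric] by simp
    qed
    have "\<Psi>' z ?m \<bullet> ?e - \<Theta>' z (mixed \<mu> v {..<j} {..<j}) \<bullet> ?e =
      cF z j (lx j w + ly j w) (d, 0) + (\<mu> - 1) * (cF z j (lx j w) (d, 0) + cH z j (lx j w) (d, 0)) + grad_coupling ?m \<bullet> ?e"
      unfolding inner_\<Psi>' inner_\<Theta>' loc_axis sum_at loc_mixed cF_def cH_def
      by (simp add: linear_add[OF linF] linear_add[OF linH] linear_scale[OF linF] linear_scale[OF linH]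
          inner_add_left add_divide_distrib diff_divide_distrib algebra_simps)
    then have "wt \<mu> j * (\<Psi>' z ?m \<bullet> ?e - \<Theta>' z (mixed \<mu> v {..<j} {..<j}) \<bullet> ?e) = 0"
      using B0 coupling by (simp add: distrib_left)
    moreover have "wt \<mu> j \<noteq> 0" using \<mu> by (cases j) (auto simp: wt_def)
    ultimately show "\<Psi>' z ?m \<bullet> ?e = \<Theta>' z (mixed \<mu> v {..<j} {..<j}) \<bullet> ?e" by simp
  qed
  have eqy: "proj_y j (\<Psi>' z (mixed \<mu> v {..j} {..j})) = proj_y j (\<Theta>' z (mixed \<mu> v {..j} {..<j}))" for j
  proof (rule proj_y_eqI)
    fix d assume d: "d \<in> block blk j"
    let ?e = "(0, d, 0) :: ('n, 'm, 'k) state" and ?m = "mixed \<mu> v {..j} {..j}"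
    let ?w' = "(0, d) :: ('n, 'm, 'k) primal"
    have lx': "lx i ?w' = 0" and ly': "ly i ?w' = (if i = j then (0, d) else 0)" for i
      using d by (auto simp: lx_def ly_def zero_prod_def block_part_of_block)
    have "wt \<mu> j * (cF z j (lx j w + ly j w) (0, d) + (\<mu> - 1) * (cH z j (ly j w) (0, d) / \<mu>)) = saddle_form z \<mu> w ?w'"
    proof -
      have "(\<Sum>i\<in>UNIV. wt \<mu> i * (cF z i (lx i w + ly i w) (lx i ?w' + ly i ?w') + (\<mu> - 1) *
          (cF z i (lx i w) (lx i ?w') + cH z i (lx i w) (lx i ?w') + cH z i (ly i w) (ly i ?w') / \<mu>))) =
        (\<Sum>i\<in>UNIV. if i = j then wt \<mu> j * (cF z j (lx j w + ly j w) (0, d) + (\<mu> - 1) *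
          (cH z j (ly j w) (0, d) / \<mu>)) else 0)"
        by (intro sum.cong) (auto simp: lx' ly' cF_def cH_def)
      then show ?thesis unfolding saddle_form_def by (simp add: wgap_def)
    qed
    moreover have "wt \<mu> j \<noteq> 0" using \<mu> by (cases j) (auto simp: wt_def)
    ultimately have "cF z j (lx j w + ly j w) (0, d) + (\<mu> - 1) * (cH z j (ly j w) (0, d) / \<mu>) = 0"
      using B[of ?w'] by simp
    then have B0: "\<mu> * cF z j (lx j w + ly j w) (0, d) + (\<mu> - 1) * cH z j (ly j w) (0, d) = 0"
      using \<mu> by (simp add: field_simps)
    have "\<Psi>' z ?m \<bullet> ?e - \<Theta>' z (mixed \<mu> v {..j} {..<j}) \<bullet> ?e =
      \<mu> * cF z j (lx j w + ly j w) (0, d) + (\<mu> - 1) * cH z j (ly j w) (0, d)"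
    proof -
      have "grad_coupling ?m \<bullet> ?e = 0" by (simp add: inner_grad_coupling dual_def gap_def)
      then show ?thesis
        unfolding inner_\<Psi>' inner_\<Theta>' loc_block[OF d] sum_at loc_mixed cF_def cH_def
        by (simp add: linear_add[OF linF] linear_add[OF linH] linear_scale[OF linF] linear_scale[OF linH]
            inner_add_left add_divide_distrib diff_divide_distrib algebra_simps)
    qed
    then show "\<Psi>' z ?m \<bullet> ?e = \<Theta>' z (mixed \<mu> v {..j} {..<j}) \<bullet> ?e" using B0 by simp
  qed
  have "(\<mu> - 1) *\<^sub>R dual k v = (\<rho> * \<mu>) *\<^sub>R gap k v" for k
    using \<mu> unfolding dual_v by (simp add: gap_def wgap_def v_def)
  then have "linearized_eigenvector z \<mu> v" using eqx eqy by (simp add: linearized_eigenvector_def)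
  then show ?thesis using that \<mu> \<open>v \<noteq> 0\<close> by blast
qed

end

theorem theorem4p2:
  fixes blk :: "'m::finite \<Rightarrow> 'k::{finite,linorder} option"
    and \<rho> \<eta> :: real
    and Dx :: "'k option \<Rightarrow> (real^'n) set"
    and Dy :: "'k option \<Rightarrow> (real^'m) set"
    and f h :: "'k option \<Rightarrow> real^'n \<Rightarrow> real^'m \<Rightarrow> real"
    and Lx Ly :: "'k option \<Rightarrow> real"
    and \<Omega> :: "('n::finite, 'm, 'k) state set"
    and P :: "('n, 'm, 'k) state measure"
  assumes "\<rho> > 0"
    and "\<And>j. Dx j \<noteq> {}" "\<And>j. open (Dx j)" "\<And>j. convex (Dx j)"
    and "\<And>j. Dy j \<noteq> {}" "\<And>j. openin (top_of_set (block blk j)) (Dy j)" "\<And>j. convex (Dy j)"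
    and "\<And>j. C2_on (UNIV \<times> block blk j) (Dx j \<times> Dy j) (\<lambda>(u, v). f j u v)"
    and "\<And>j. C2_on (UNIV \<times> block blk j) (Dx j \<times> Dy j) (\<lambda>(u, v). h j u v)"
    and "\<And>j. strongly_biconvex (block blk j) (Dx j) (Dy j) (h j)"
    and "\<And>j. Lx j > 0" "\<And>j. Ly j > 0"
    and "\<And>j. relatively_bismooth (block blk j) (Dx j) (Dy j) (Lx j) (Ly j) (h j) (f j)"
    and "0 < \<eta>" "\<eta> < (MIN j. min (1 / Lx j) (1 / Ly j))"
    and "open \<Omega>" "\<Omega> \<subseteq> {(x, y, l). \<forall>j. x $ j \<in> Dx j \<and> block_part blk j y \<in> Dy j}"
    and "admm_well_defined_on blk \<rho> \<eta> f h Dx Dy \<Omega>"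
    and "admm_map blk \<rho> \<eta> f h Dx Dy ` \<Omega> \<subseteq> \<Omega>"
    and "prob_space P" "sets P = sets lborel" "AE z in P. z \<in> \<Omega>" "absolutely_continuous lborel P"
  shows "AE z0 in P. \<not> (\<exists>z\<in>\<Omega>. strict_saddle_KKT_point blk f z \<and>
           (\<lambda>k. (admm_map blk \<rho> \<eta> f h Dx Dy ^^ k) z0) \<longlonglongrightarrow> z)"
proof -
  have \<eta>: "\<eta> < 1 / Lx j" "\<eta> < 1 / Ly j" for j
  proof -
    have "(MIN j. min (1 / Lx j) (1 / Ly j)) \<le> min (1 / Lx j) (1 / Ly j)" by (rule Min_le) auto
    then show "\<eta> < 1 / Lx j" "\<eta> < 1 / Ly j" using assms(15) by auto
  qed
  interpret consensus_admm blk \<rho> \<eta> Dx Dy f h Lx Ly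
    by (rule consensus_admm.intro) (use assms \<eta> in blast)+
  have sub: "\<Omega> \<subseteq> X" using assms(17) by (auto simp: X_def loc_def)
  interpret consensus_admm_invariant blk \<rho> \<eta> Dx Dy f h Lx Ly \<Omega>
    by unfold_locales (use sub assms(18) in auto)
  let ?g = "admm_map blk \<rho> \<eta> f h Dx Dy"
  let ?A = "{z \<in> \<Omega>. strict_saddle_KKT_point blk f z}"
  let ?N = "{z0 \<in> \<Omega>. \<exists>z\<in>?A. (\<lambda>k. (?g ^^ k) z0) \<longlonglongrightarrow> z}"
  have "negligible ?N"
  proof (rule negligible_convergence_to_unstable[OF admm_map_locally_inverse_lipschitz assms(19)])
    fix z assume "z \<in> ?A"
    then have z: "z \<in> \<Omega>" "z \<in> X" "strict_saddle_KKT_point blk f z" using sub by auto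
    obtain \<mu> v where v: "\<mu> > 1" "v \<noteq> 0" "linearized_eigenvector z \<mu> v"
      using linearized_eigenvector_exists[OF z(2,3)] by blast
    have "KKT_point blk f z" using z(3) by (simp add: strict_saddle_KKT_point_def)
    from admm_map_strict_derivative[OF z(1) this v(3)]
    obtain T where "has_strict_derivative_on ?g T \<Omega> z" "T v = \<mu> *\<^sub>R v" by blast
    then show "\<exists>T v \<mu>. has_strict_derivative_on ?g T \<Omega> z \<and> v \<noteq> 0 \<and> T v = \<mu> *\<^sub>R v \<and> \<mu> > 1"
      using v(1,2) by blast
  qed
  then have "?N \<in> null_sets (completion lborel)" by (simp add: negligible_iff_null_sets)
  \<comment> \<open>Negligibility concerns the completed Lebesgue measure, whereas P is a Borel
    measure; the set is enlarged to a Borel null set before absolute continuity is applied.\<close>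
  then obtain N where "N \<in> null_sets lborel" "?N \<subseteq> N" by (auto simp: null_sets_completion_iff2)
  then have "N \<in> null_sets P" using assms(23) by (auto simp: absolutely_continuous_def)
  then have "AE z0 in P. z0 \<notin> N" by (rule AE_not_in)
  with assms(22) show ?thesis
    by eventually_elim (use \<open>?N \<subseteq> N\<close> in blast)
qed

end
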